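(* Let $S$ be a spray on $M$, let $k\neq 0$ be an integer, and let $\theta\in\Lambda^1(TM\setminus\{0\})$ be a semi-basic $1$-form that is $(k-1)$-homogeneous. Then the following conditions are equivalent (where condition (iv) is formulated only for $k\neq -1$; for $k=-1$ the assertion is the equivalence of (i), (ii) and (iii)): (i) $\mathcal{L}_S\theta$ is closed; (ii) $\mathcal{L}_S\theta$ is exact; (iii) $k\,\mathcal{L}_S\theta=d\,i_S\theta$; (iv) $d_h\theta=0$ and $d_J\theta=0$, when $k=1$; respectively $d_h\theta=0$, $d_J\theta=0$ and $\nabla d\theta=0$, when $k\notin\{-1,0,1\}$. Here $h$ and $\nabla$ are the horizontal projector and the dynamical covariant derivative induced by $S$, and $J$ is the tangent structure.
   Context: $M$ is a smooth ($C^\infty$) second countable Hausdorff manifold of dimension $n\ge 1$; $\pi:TM\to M$ is the tangent bundle and $TM\setminus\{0\}$ is the tangent bundle with the zero section removed. Coordinates $x^i$ on $M$ induce coordinates $(x^i,y^i)$ on $TM$. All objects are $C^\infty$-smooth. Forms and derivations. $\Lambda^p(TM\setminus\{0\})$ is the module of $p$-forms. For a $(1,1)$-type tensor field $A$ and a $p$-form $\alpha$ with $p\ge 1$, $i_A\alpha(X_1,\dots,X_p)=\sum_{i=1}^p\alpha(X_1,\dots,AX_i,\dots,X_p)$, and $i_A f=0$ for functions $f$. Set $d_A=i_A\circ d-d\circ i_A$. For a vector field $X$, $i_X$ is the usual inner product and $\mathcal{L}_X$ is the Lie derivative; on a $(1,1)$-tensor $A$, $\mathcal{L}_XA=\mathcal{L}_X\circ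 A-A\circ\mathcal{L}_X$ (as maps on vector fields). Vertical structures. The vertical distribution is $\ker D\pi$. The Liouville vector field is $\mathbb{C}=y^i\frac{\partial}{\partial y^i}$. The tangent structure is the $(1,1)$-tensor $J=\frac{\partial}{\partial y^i}\otimes dx^i$. A $1$-form $\theta$ on $TM\setminus\{0\}$ is semi-basic if it vanishes on vertical vectors (locally $\theta=\theta_i(x,y)dx^i$). Homogeneity. For an integer $m$, a $p$-form $\omega$ on $TM\setminus\{0\}$ is $m$-homogeneous if $\mathcal{L}_{\mathbb{C}}\omega=m\omega$. Sprays. A semispray on $M$ is a vector field $S$ on $TM\setminus\{0\}$ with $JS=\mathbb{C}$; it is a spray if moreover $[\mathbb{C},S]=S$. It induces the horizontal and vertical projectors $h=\frac12(\mathrm{Id}-\mathcal{L}_SJ)$, $v=\frac12(\mathrm{Id}+\mathcal{L}_SJ)$. Dynamical covariant derivative. $\nabla$ is the unique tensor derivation on $TM\setminus\{0\}$ (an $\mathbb{R}$-linear, type preserving map of the tensor algebra satisfying the Leibniz rule for $\otimes$ and commuting with contractions) such that $\nabla f=S(f)$ for functions $f$ and $\nabla X=h[S,hX]+v[S,vX]$ for vector fields $X$. Thus for a $p$-form $\omega$, $(\nabla\omega)(X_1,\dots,X_p)=S(\omega(X_1,\dots,X_p))-\sum_{i=1}^p\omega(X_1,\dots,\nabla X_i,\dots,X_p)$. *)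

theory Defs
  imports "HOL-Analysis.Analysis"
begin

section \<open>Smooth maps between normed spaces\<close>

text \<open>
  In finite dimension, being \<open>C\<^sup>k\<close> on an open set is the same as having all iterated
  directional derivatives up to order \<open>k\<close>, each of them continuous (and, below order \<open>k\<close>,
  Frechet differentiable).  Both predicates are only meant to be used on open sets.
\<close>

primrec Ck_on :: "nat \<Rightarrow> 'e::real_normed_vector set \<Rightarrow> ('e \<Rightarrow> 'f::real_normed_vector) \<Rightarrow> bool" where
  "Ck_on 0 U f \<longleftrightarrow> continuous_on U f"
| "Ck_on (Suc k) U f \<longleftrightarrow>
     (\<forall>x\<in>U. f differentiable (at x)) \<and> (\<forall>v. Ck_on k U (\<lambda>x. frechet_derivative f (at x) v))"

definition smooth_on :: "'e::real_normed_vector set \<Rightarrow> ('e \<Rightarrow> 'f::real_normed_vector) \<Rightarrow> bool" where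
  "smooth_on U f \<longleftrightarrow> (\<forall>k. Ck_on k U f)"


section \<open>Smooth manifolds\<close>

text \<open>
  A chart is a domain together with a coordinate map, whose values outside the domain are
  irrelevant.  A manifold modelled on \<open>'e\<close> (so of dimension \<open>DIM('e)\<close>) is given by a topology
  and an atlas, not necessarily maximal.
\<close>

type_synonym ('a, 'e) chart = "'a set \<times> ('a \<Rightarrow> 'e)"

definition chart_inv :: "('a, 'e) chart \<Rightarrow> 'e \<Rightarrow> 'a" where
  "chart_inv c = inv_into (fst c) (snd c)"

definition transition :: "('a, 'e) chart \<Rightarrow> ('a, 'e) chart \<Rightarrow> 'e \<Rightarrow> 'e" where
  "transition c c' = snd c' \<circ> chart_inv c"

definition smooth_manifold :: "'a topology \<Rightarrow> ('a, 'e::euclidean_space) chart set \<Rightarrow> bool" where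
  "smooth_manifold T A \<longleftrightarrow>
     Hausdorff_space T \<and> second_countable T \<and>
     topspace T = (\<Union>c\<in>A. fst c) \<and>
     (\<forall>c\<in>A. openin T (fst c) \<and> open (snd c ` fst c) \<and>
        homeomorphic_map (subtopology T (fst c)) (top_of_set (snd c ` fst c)) (snd c)) \<and>
     (\<forall>c\<in>A. \<forall>c'\<in>A. smooth_on (snd c ` (fst c \<inter> fst c')) (transition c c'))"

text \<open>The operations below need the atlas only.\<close>

definition points :: "('a, 'e) chart set \<Rightarrow> 'a set" where
  "points A = (\<Union>c\<in>A. fst c)"

definition chart_at :: "('a, 'e) chart set \<Rightarrow> 'a \<Rightarrow> ('a, 'e) chart" where
  "chart_at A p = (SOME c. c \<in> A \<and> p \<in> fst c)"


section \<open>Tangent vectors\<close>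

text \<open>
  A tangent vector at \<open>p\<close> is the family of its component vectors in all the charts around \<open>p\<close>,
  subject to the usual transformation law.  The family is set to \<open>0\<close> on every other argument, so
  that equality of tangent vectors is equality of functions and \<open>\<lambda>_. 0\<close> is the zero vector.
\<close>

type_synonym ('a, 'e) tangent = "('a, 'e) chart \<Rightarrow> 'e"

definition tangent_space ::
    "('a, 'e::euclidean_space) chart set \<Rightarrow> 'a \<Rightarrow> ('a, 'e) tangent set" where
  "tangent_space A p =
     {v. (\<forall>c. \<not> (c \<in> A \<and> p \<in> fst c) \<longrightarrow> v c = 0) \<and>
         (\<forall>c\<in>A. \<forall>c'\<in>A. p \<in> fst c \<longrightarrow> p \<in> fst c' \<longrightarrow>
            v c' = frechet_derivative (transition c c') (at (snd c p)) (v c))}"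

definition tlin ::
    "real \<Rightarrow> ('a, 'e::euclidean_space) tangent \<Rightarrow> real \<Rightarrow> ('a, 'e) tangent \<Rightarrow> ('a, 'e) tangent" where
  "tlin a v b w = (\<lambda>c. a *\<^sub>R v c + b *\<^sub>R w c)"

text \<open>The vector field on the domain of \<open>c\<close> whose components in the chart \<open>c\<close> are constantly \<open>x\<close>.\<close>

definition coord_field ::
    "('a, 'e::euclidean_space) chart set \<Rightarrow> ('a, 'e) chart \<Rightarrow> 'e \<Rightarrow> 'a \<Rightarrow> ('a, 'e) tangent" where
  "coord_field A c x = (\<lambda>q c'. if c' \<in> A \<and> q \<in> fst c'
     then frechet_derivative (transition c c') (at (snd c q)) x else 0)"

text \<open>
  A vector field near \<open>p\<close> extending \<open>v\<close>.  Tensorial expressions do not depend on the extension;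
  this one makes the components of all operators below the classical coordinate ones.
\<close>

definition local_ext ::
    "('a, 'e::euclidean_space) chart set \<Rightarrow> 'a \<Rightarrow> ('a, 'e) tangent \<Rightarrow> 'a \<Rightarrow> ('a, 'e) tangent" where
  "local_ext A p v = coord_field A (chart_at A p) (v (chart_at A p))"

definition differential ::
    "('a, 'e::euclidean_space) chart set \<Rightarrow> ('b, 'f::euclidean_space) chart set \<Rightarrow> ('a \<Rightarrow> 'b)
      \<Rightarrow> 'a \<Rightarrow> ('a, 'e) tangent \<Rightarrow> ('b, 'f) tangent" where
  "differential A B F p v = (\<lambda>c'. if c' \<in> B \<and> F p \<in> fst c'
     then frechet_derivative (snd c' \<circ> F \<circ> chart_inv (chart_at A p))
            (at (snd (chart_at A p) p)) (v (chart_at A p))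
     else 0)"

text \<open>The action \<open>v(f)\<close> of a tangent vector on a function.\<close>

definition deriv_along ::
    "('a, 'e::euclidean_space) chart set \<Rightarrow> 'a \<Rightarrow> ('a, 'e) tangent \<Rightarrow> ('a \<Rightarrow> real) \<Rightarrow> real" where
  "deriv_along A p v f =
     frechet_derivative (f \<circ> chart_inv (chart_at A p)) (at (snd (chart_at A p) p)) (v (chart_at A p))"


section \<open>Vector fields and forms\<close>

type_synonym ('a, 'e) vfield = "'a \<Rightarrow> ('a, 'e) tangent"

definition vector_field :: "('a, 'e::euclidean_space) chart set \<Rightarrow> ('a, 'e) vfield \<Rightarrow> bool" where
  "vector_field A X \<longleftrightarrow>
     (\<forall>p\<in>points A. X p \<in> tangent_space A p) \<and>
     (\<forall>c\<in>A. smooth_on (snd c ` fst c) (\<lambda>x. X (chart_inv c x) c))"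

definition eq_vfield :: "('a, 'e) chart set \<Rightarrow> ('a, 'e) vfield \<Rightarrow> ('a, 'e) vfield \<Rightarrow> bool" where
  "eq_vfield A X Y \<longleftrightarrow> (\<forall>p\<in>points A. X p = Y p)"

text \<open>\<open>[X,Y]\<^sup>i = X\<^sup>j \<partial>\<^sub>j Y\<^sup>i - Y\<^sup>j \<partial>\<^sub>j X\<^sup>i\<close> in every chart.\<close>

definition bracket ::
    "('a, 'e::euclidean_space) chart set \<Rightarrow> ('a, 'e) vfield \<Rightarrow> ('a, 'e) vfield \<Rightarrow> ('a, 'e) vfield" where
  "bracket A X Y = (\<lambda>p c. if c \<in> A \<and> p \<in> fst c
     then frechet_derivative (\<lambda>x. Y (chart_inv c x) c) (at (snd c p)) (X p c)
        - frechet_derivative (\<lambda>x. X (chart_inv c x) c) (at (snd c p)) (Y p c)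
     else 0)"

text \<open>
  A \<open>k\<close>-form takes a point and a list of \<open>k\<close> tangent vectors at this point; a function \<open>f\<close> is the
  \<open>0\<close>-form whose value at \<open>p\<close> on the empty list is \<open>f(p)\<close>.  Values on other lists are irrelevant,
  and therefore forms are compared by \<open>eq_form\<close>.
\<close>

type_synonym ('a, 'e) dform = "'a \<Rightarrow> ('a, 'e) tangent list \<Rightarrow> real"

definition form :: "('a, 'e::euclidean_space) chart set \<Rightarrow> nat \<Rightarrow> ('a, 'e) dform \<Rightarrow> bool" where
  "form A k \<omega> \<longleftrightarrow>
     (\<forall>p\<in>points A. \<forall>vs. set vs \<subseteq> tangent_space A p \<longrightarrow> length vs = k \<longrightarrow>
        (\<forall>i<k. \<forall>v\<in>tangent_space A p. \<forall>w\<in>tangent_space A p. \<forall>a b.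
           \<omega> p (vs[i := tlin a v b w]) = a * \<omega> p (vs[i := v]) + b * \<omega> p (vs[i := w])) \<and>
        (\<forall>i<k. \<forall>j<k. i \<noteq> j \<longrightarrow> vs ! i = vs ! j \<longrightarrow> \<omega> p vs = 0)) \<and>
     (\<forall>c\<in>A. \<forall>xs. length xs = k \<longrightarrow>
        smooth_on (snd c ` fst c)
          (\<lambda>x. \<omega> (chart_inv c x) (map (\<lambda>e. coord_field A c e (chart_inv c x)) xs)))"

definition eq_form ::
    "('a, 'e::euclidean_space) chart set \<Rightarrow> nat \<Rightarrow> ('a, 'e) dform \<Rightarrow> ('a, 'e) dform \<Rightarrow> bool" where
  "eq_form A k \<omega> \<eta> \<longleftrightarrow>
     (\<forall>p\<in>points A. \<forall>vs. set vs \<subseteq> tangent_space A p \<longrightarrow> length vs = k \<longrightarrow> \<omega> p vs = \<eta> p vs)"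

definition zero_form :: "('a, 'e) dform" where
  "zero_form = (\<lambda>p vs. 0)"

definition scale_form :: "real \<Rightarrow> ('a, 'e) dform \<Rightarrow> ('a, 'e) dform" where
  "scale_form a \<omega> = (\<lambda>p vs. a * \<omega> p vs)"

definition diff_form :: "('a, 'e) dform \<Rightarrow> ('a, 'e) dform \<Rightarrow> ('a, 'e) dform" where
  "diff_form \<omega> \<eta> = (\<lambda>p vs. \<omega> p vs - \<eta> p vs)"

text \<open>
  \<open>d\<omega>(X\<^sub>0,\<dots>,X\<^sub>k) = \<Sum>\<^sub>i (-1)\<^sup>i X\<^sub>i(\<omega>(X\<^sub>0,\<dots>,X\<^sub>i omitted,\<dots>,X\<^sub>k)) + \<Sum>\<^sub>i\<^sub><\<^sub>j (-1)\<^sup>i\<^sup>+\<^sup>j \<omega>([X\<^sub>i,X\<^sub>j],\<dots>)\<close>, where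
  the bracket terms are absent because the extensions are coordinate fields of one chart and
  commute.
\<close>

definition ext_d :: "('a, 'e::euclidean_space) chart set \<Rightarrow> ('a, 'e) dform \<Rightarrow> ('a, 'e) dform" where
  "ext_d A \<omega> = (\<lambda>p vs. \<Sum>i<length vs. (-1) ^ i *
     deriv_along A p (vs ! i)
       (\<lambda>q. \<omega> q (map (\<lambda>v. local_ext A p v q) (take i vs @ drop (Suc i) vs))))"

definition inner_form :: "('a, 'e) vfield \<Rightarrow> ('a, 'e) dform \<Rightarrow> ('a, 'e) dform" where
  "inner_form X \<omega> = (\<lambda>p vs. \<omega> p (X p # vs))"

definition lie_form ::
    "('a, 'e::euclidean_space) chart set \<Rightarrow> ('a, 'e) vfield \<Rightarrow> ('a, 'e) dform \<Rightarrow> ('a, 'e) dform" where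
  "lie_form A X \<omega> = (\<lambda>p vs.
     deriv_along A p (X p) (\<lambda>q. \<omega> q (map (\<lambda>v. local_ext A p v q) vs))
     - (\<Sum>i<length vs. \<omega> p (vs[i := bracket A X (local_ext A p (vs ! i)) p])))"

definition closed_form :: "('a, 'e::euclidean_space) chart set \<Rightarrow> nat \<Rightarrow> ('a, 'e) dform \<Rightarrow> bool" where
  "closed_form A k \<omega> \<longleftrightarrow> eq_form A (Suc k) (ext_d A \<omega>) zero_form"

definition exact_form :: "('a, 'e::euclidean_space) chart set \<Rightarrow> nat \<Rightarrow> ('a, 'e) dform \<Rightarrow> bool" where
  "exact_form A k \<omega> \<longleftrightarrow> (\<exists>j \<eta>. k = Suc j \<and> form A j \<eta> \<and> eq_form A k \<omega> (ext_d A \<eta>))"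


section \<open>(1,1)-tensor fields\<close>

type_synonym ('a, 'e) tensor11 = "'a \<Rightarrow> ('a, 'e) tangent \<Rightarrow> ('a, 'e) tangent"

definition tensor_app :: "('a, 'e) tensor11 \<Rightarrow> ('a, 'e) vfield \<Rightarrow> ('a, 'e) vfield" where
  "tensor_app B X = (\<lambda>p. B p (X p))"

text \<open>The empty sum makes \<open>i_tensor B f = 0\<close> for functions \<open>f\<close>.\<close>

definition i_tensor :: "('a, 'e) tensor11 \<Rightarrow> ('a, 'e) dform \<Rightarrow> ('a, 'e) dform" where
  "i_tensor B \<omega> = (\<lambda>p vs. \<Sum>i<length vs. \<omega> p (vs[i := B p (vs ! i)]))"

definition d_tensor ::
    "('a, 'e::euclidean_space) chart set \<Rightarrow> ('a, 'e) tensor11 \<Rightarrow> ('a, 'e) dform \<Rightarrow> ('a, 'e) dform" where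
  "d_tensor A B \<omega> = diff_form (i_tensor B (ext_d A \<omega>)) (ext_d A (i_tensor B \<omega>))"

text \<open>\<open>(\<L>\<^sub>X B)(Y) = [X, B Y] - B [X, Y]\<close>\<close>

definition lie_tensor ::
    "('a, 'e::euclidean_space) chart set \<Rightarrow> ('a, 'e) vfield \<Rightarrow> ('a, 'e) tensor11 \<Rightarrow> ('a, 'e) tensor11" where
  "lie_tensor A X B = (\<lambda>p v.
     tlin 1 (bracket A X (tensor_app B (local_ext A p v)) p)
        (-1) (B p (bracket A X (local_ext A p v) p)))"


section \<open>The slit tangent bundle\<close>

type_synonym ('a, 'e) tm = "'a \<times> ('a, 'e) tangent"

text \<open>
  The induced coordinates \<open>(x,y)\<close> on the tangent bundle with the zero section removed; \<open>A\<close> is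
  the atlas of the base.
\<close>

definition slit_chart ::
    "('a, 'e::euclidean_space) chart set \<Rightarrow> ('a, 'e) chart \<Rightarrow> (('a, 'e) tm, 'e \<times> 'e) chart" where
  "slit_chart A c =
     ({(p, y). p \<in> fst c \<and> y \<in> tangent_space A p \<and> y \<noteq> (\<lambda>_. 0)}, \<lambda>(p, y). (snd c p, y c))"

definition slit_atlas ::
    "('a, 'e::euclidean_space) chart set \<Rightarrow> (('a, 'e) tm, 'e \<times> 'e) chart set" where
  "slit_atlas A = slit_chart A ` A"

definition vertical_space ::
    "('a, 'e::euclidean_space) chart set \<Rightarrow> ('a, 'e) tm \<Rightarrow> (('a, 'e) tm, 'e \<times> 'e) tangent set" where
  "vertical_space A u =
     {\<xi> \<in> tangent_space (slit_atlas A) u. differential (slit_atlas A) A fst u \<xi> = (\<lambda>_. 0)}"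

text \<open>\<open>y\<^sup>i \<partial>/\<partial>y\<^sup>i\<close> has components \<open>(0, y)\<close> in every induced chart.\<close>

definition liouville ::
    "('a, 'e::euclidean_space) chart set \<Rightarrow> (('a, 'e) tm, 'e \<times> 'e) vfield" where
  "liouville A = (\<lambda>u C. if C \<in> slit_atlas A \<and> u \<in> fst C then (0, snd (snd C u)) else 0)"

text \<open>\<open>\<partial>/\<partial>y\<^sup>i \<otimes> dx\<^sup>i\<close> maps components \<open>(a, b)\<close> to \<open>(0, a)\<close> in every induced chart.\<close>

definition tangent_structure :: "(('a, 'e::euclidean_space) tm, 'e \<times> 'e) tensor11" where
  "tangent_structure = (\<lambda>u \<xi> C. (0, fst (\<xi> C)))"

definition semi_basic ::
    "('a, 'e::euclidean_space) chart set \<Rightarrow> (('a, 'e) tm, 'e \<times> 'e) dform \<Rightarrow> bool" where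
  "semi_basic A \<theta> \<longleftrightarrow> (\<forall>u\<in>points (slit_atlas A). \<forall>\<xi>\<in>vertical_space A u. \<theta> u [\<xi>] = 0)"

definition homogeneous_form ::
    "('a, 'e::euclidean_space) chart set \<Rightarrow> nat \<Rightarrow> int \<Rightarrow> (('a, 'e) tm, 'e \<times> 'e) dform \<Rightarrow> bool" where
  "homogeneous_form A k m \<omega> \<longleftrightarrow>
     eq_form (slit_atlas A) k (lie_form (slit_atlas A) (liouville A) \<omega>) (scale_form (of_int m) \<omega>)"


section \<open>Sprays\<close>

definition semispray ::
    "('a, 'e::euclidean_space) chart set \<Rightarrow> (('a, 'e) tm, 'e \<times> 'e) vfield \<Rightarrow> bool" where
  "semispray A S \<longleftrightarrow> vector_field (slit_atlas A) S \<and>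
     eq_vfield (slit_atlas A) (tensor_app tangent_structure S) (liouville A)"

definition spray ::
    "('a, 'e::euclidean_space) chart set \<Rightarrow> (('a, 'e) tm, 'e \<times> 'e) vfield \<Rightarrow> bool" where
  "spray A S \<longleftrightarrow> semispray A S \<and>
     eq_vfield (slit_atlas A) (bracket (slit_atlas A) (liouville A) S) S"

definition hproj ::
    "('a, 'e::euclidean_space) chart set \<Rightarrow> (('a, 'e) tm, 'e \<times> 'e) vfield
      \<Rightarrow> (('a, 'e) tm, 'e \<times> 'e) tensor11" where
  "hproj A S = (\<lambda>u \<xi>. tlin (1/2) \<xi> (-1/2) (lie_tensor (slit_atlas A) S tangent_structure u \<xi>))"

definition vproj ::
    "('a, 'e::euclidean_space) chart set \<Rightarrow> (('a, 'e) tm, 'e \<times> 'e) vfield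
      \<Rightarrow> (('a, 'e) tm, 'e \<times> 'e) tensor11" where
  "vproj A S = (\<lambda>u \<xi>. tlin (1/2) \<xi> (1/2) (lie_tensor (slit_atlas A) S tangent_structure u \<xi>))"

text \<open>The dynamical covariant derivative on vector fields: \<open>\<nabla>X = h[S, hX] + v[S, vX]\<close>.\<close>

definition nabla_vfield ::
    "('a, 'e::euclidean_space) chart set \<Rightarrow> (('a, 'e) tm, 'e \<times> 'e) vfield
      \<Rightarrow> (('a, 'e) tm, 'e \<times> 'e) vfield \<Rightarrow> (('a, 'e) tm, 'e \<times> 'e) vfield" where
  "nabla_vfield A S X = (\<lambda>u.
     tlin 1 (hproj A S u (bracket (slit_atlas A) S (tensor_app (hproj A S) X) u))
          1 (vproj A S u (bracket (slit_atlas A) S (tensor_app (vproj A S) X) u)))"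

text \<open>Its extension to forms as a tensor derivation with \<open>\<nabla>f = S(f)\<close> on functions.\<close>

definition nabla_form ::
    "('a, 'e::euclidean_space) chart set \<Rightarrow> (('a, 'e) tm, 'e \<times> 'e) vfield
      \<Rightarrow> (('a, 'e) tm, 'e \<times> 'e) dform \<Rightarrow> (('a, 'e) tm, 'e \<times> 'e) dform" where
  "nabla_form A S \<omega> = (\<lambda>u \<xi>s.
     deriv_along (slit_atlas A) u (S u) (\<lambda>w. \<omega> w (map (\<lambda>\<xi>. local_ext (slit_atlas A) u \<xi> w) \<xi>s))
     - (\<Sum>i<length \<xi>s. \<omega> u (\<xi>s[i := nabla_vfield A S (local_ext (slit_atlas A) u (\<xi>s ! i)) u])))"

end

theory Submission
  imports Defs
begin

text \<open>
  Work in induced coordinates \<open>(x, y)\<close>, where \<open>S = (y, s(x, y))\<close> and \<open>\<theta> = \<theta>\<^sub>i dx\<^sup>i\<close>.  Two objects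
  decide everything: the vertical derivative \<open>g(b, c)\<close> of \<open>\<theta>\<close>, with components
  \<open>\<partial>\<theta>\<^sub>i/\<partial>y\<^sup>j\<close>, and the linear map \<open>n = 1/2 \<partial>s/\<partial>y\<close>, for which \<open>(a, n a)\<close> is the horizontal lift
  of \<open>a\<close>.  The Lie derivative is \<open>\<L>\<^sub>S\<theta> = S(\<theta>\<^sub>i) dx\<^sup>i + \<theta>\<^sub>i dy\<^sup>i\<close>.

  If it is closed, the \<open>dy\<and>dy\<close> part of its differential says that \<open>g\<close> is symmetric, which is
  \<open>d\<^sub>J\<theta> = 0\<close>.  The \<open>dx\<and>dy\<close> part is one bilinear identity (\<open>mixed_condition\<close>).  Given that \<open>g\<close> is
  symmetric, its antisymmetric part is \<open>d\<^sub>h\<theta> = 0\<close> and its symmetric part says that \<open>g\<close> is parallel: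
  \<open>S(g(b, c)) + g(n b, c) + g(b, n c) = 0\<close> (lemma \<open>mixed_iff\<close>).  The latter is
  \<open>\<nabla>d\<theta> = 0\<close>, because in a frame adapted to the horizontal and vertical distributions the only
  components of \<open>d\<theta>\<close> that can survive \<open>d\<^sub>h\<theta> = 0\<close> are those of \<open>g\<close> (lemmas
  \<open>nabla_d_imp_parallel\<close> and \<open>parallel_imp_nabla_d\<close>).

  Conversely, the homogeneity relations \<open>g(y, c) = (k - 1) \<theta>(c)\<close> and \<open>n y = s\<close> allow one to contract
  with \<open>y\<close>: the mixed identity and the symmetry of \<open>g\<close> become \<open>k \<L>\<^sub>S\<theta> = d i\<^sub>S\<theta>\<close> (lemma
  \<open>mixed_imp_lie_potential\<close>).  For \<open>k = 1\<close> one has \<open>g(y, c) = 0\<close>, and then already \<open>d\<^sub>h\<theta> = 0\<close>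
  contracted with \<open>y\<close> gives this equation (lemma \<open>horizontal_imp_lie_potential\<close>).  Since \<open>k \<noteq> 0\<close>,
  it exhibits \<open>i\<^sub>S\<theta> / k\<close> as a potential of \<open>\<L>\<^sub>S\<theta>\<close>, and exact forms are closed.

  To apply this calculation one has to know that the operators may be computed in any chart.
  Their values at a point are defined through one chosen chart around this point, whereas
  \<open>d\<L>\<^sub>S\<theta>\<close>, \<open>\<nabla>d\<theta>\<close> and \<open>d\<^sub>h\<theta>\<close> differentiate such values, so that the choice varies along the
  differentiation.  Lemmas \<open>lie_form_1form\<close>, \<open>ext_d_1form\<close> and \<open>hproj_in_chart\<close> remove this dependence;
  they rest on the symmetry of the second derivatives of the transition maps (\<open>fd_commute\<close>).
\<close>

section \<open>Derivatives and smooth maps\<close>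

abbreviation fd :: "('a::real_normed_vector \<Rightarrow> 'b::real_normed_vector) \<Rightarrow> 'a \<Rightarrow> 'a \<Rightarrow> 'b" where
  "fd f z \<equiv> frechet_derivative f (at z)"

lemma fd_has_derivative: "f differentiable (at z) \<Longrightarrow> (f has_derivative fd f z) (at z)"
  by (simp add: frechet_derivative_works)

lemma fd_eqI: "(f has_derivative f') (at z) \<Longrightarrow> fd f z = f'"
  using frechet_derivative_at[of f f' z] by simp

lemma fd_linear: "f differentiable (at z) \<Longrightarrow> linear (fd f z)"
  by (rule linear_frechet_derivative)

lemma has_derivative_cong_open:
  assumes "open U" "z \<in> U" "\<And>w. w \<in> U \<Longrightarrow> f w = g w"
  shows "(f has_derivative f') (at z) \<longleftrightarrow> (g has_derivative f') (at z)"
  using has_derivative_transform_within_open[OF _ assms(1,2)] assms(3) by metis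

lemma fd_cong:
  assumes "open U" "z \<in> U" "\<And>w. w \<in> U \<Longrightarrow> f w = g w"
  shows "fd f z = fd g z"
  unfolding frechet_derivative_def using has_derivative_cong_open[OF assms] by simp

lemma differentiable_cong:
  assumes "open U" "z \<in> U" "\<And>w. w \<in> U \<Longrightarrow> f w = g w"
  shows "f differentiable (at z) \<longleftrightarrow> g differentiable (at z)"
  unfolding differentiable_def using has_derivative_cong_open[OF assms] by simp

lemma fd_chain:
  assumes "f differentiable (at z)" "g differentiable (at (f z))"
  shows "fd (\<lambda>w. g (f w)) z v = fd g (f z) (fd f z v)"
  using fd_eqI[OF has_derivative_compose[OF fd_has_derivative[OF assms(1)] fd_has_derivative[OF assms(2)]]]
  by simp

lemma differentiable_chain:
  assumes "f differentiable (at z)" "g differentiable (at (f z))"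
  shows "(\<lambda>w. g (f w)) differentiable (at z)"
  using differentiable_compose[of g f z UNIV] assms by auto

lemma fd_bounded_linear:
  assumes "bounded_linear L" "f differentiable (at z)"
  shows "fd (\<lambda>w. L (f w)) z v = L (fd f z v)"
  using fd_eqI[OF bounded_linear.has_derivative[OF assms(1) fd_has_derivative[OF assms(2)]]] by simp

lemma differentiable_bounded_linear:
  assumes "bounded_linear L" "f differentiable (at z)"
  shows "(\<lambda>w. L (f w)) differentiable (at z)"
  using bounded_linear.has_derivative[OF assms(1) fd_has_derivative[OF assms(2)]]
  unfolding differentiable_def by blast

lemma fd_add:
  assumes "f differentiable (at z)" "g differentiable (at z)"
  shows "fd (\<lambda>w. f w + g w) z v = fd f z v + fd g z v"
  using fd_eqI[OF has_derivative_add[OF assms[THEN fd_has_derivative]]] by simp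

lemma fd_diff:
  assumes "f differentiable (at z)" "g differentiable (at z)"
  shows "fd (\<lambda>w. f w - g w) z v = fd f z v - fd g z v"
  using fd_eqI[OF has_derivative_diff[OF assms[THEN fd_has_derivative]]] by simp

lemma fd_cmult:
  fixes f :: "'a::real_normed_vector \<Rightarrow> real"
  assumes "f differentiable (at z)"
  shows "fd (\<lambda>w. c * f w) z v = c * fd f z v"
  using fd_bounded_linear[OF bounded_linear_mult_right assms] .

text \<open>
  A one-form and the differential of a transition map are both linear in one argument and known to
  be differentiable only for each fixed value of it.  Expanding this argument in a basis
  reduces the Leibniz rule for such a pairing to that for scalar multiplication.
\<close>

lemma has_derivative_pairing:
  fixes B :: "'b::real_normed_vector \<Rightarrow> 'e::euclidean_space \<Rightarrow> 'g::real_normed_vector"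
  assumes "open V" "f z \<in> V" and lin: "\<And>y. y \<in> V \<Longrightarrow> linear (B y)"
    and B: "\<And>e. (\<lambda>y. B y e) differentiable (at (f z))"
    and f: "f differentiable (at z)" and g: "g differentiable (at z)"
  shows "((\<lambda>w. B (f w) (g w)) has_derivative
           (\<lambda>v. fd (\<lambda>y. B y (g z)) (f z) (fd f z v) + B (f z) (fd g z v))) (at z)"
proof -
  have expand: "B y e = (\<Sum>b\<in>Basis. (e \<bullet> b) *\<^sub>R B y b)" if "y \<in> V" for y e
  proof -
    have "B y e = B y (\<Sum>b\<in>Basis. (e \<bullet> b) *\<^sub>R b)" by (simp add: euclidean_representation)
    then show ?thesis
      using lin[OF that] by (simp add: linear_sum linear_scale)
  qed
  have fd_expand: "fd (\<lambda>y. B y e) (f z) v = (\<Sum>b\<in>Basis. (e \<bullet> b) *\<^sub>R fd (\<lambda>y. B y b) (f z) v)" for e v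
  proof -
    have "((\<lambda>y. \<Sum>b\<in>Basis. (e \<bullet> b) *\<^sub>R B y b) has_derivative
        (\<lambda>v. \<Sum>b\<in>Basis. (e \<bullet> b) *\<^sub>R fd (\<lambda>y. B y b) (f z) v)) (at (f z))"
      using fd_has_derivative[OF B] by (auto intro!: derivative_eq_intros)
    then have "((\<lambda>y. B y e) has_derivative
        (\<lambda>v. \<Sum>b\<in>Basis. (e \<bullet> b) *\<^sub>R fd (\<lambda>y. B y b) (f z) v)) (at (f z))"
      by (subst has_derivative_cong_open[OF assms(1,2), of "\<lambda>y. B y e" "\<lambda>y. \<Sum>b\<in>Basis. (e \<bullet> b) *\<^sub>R B y b"])
        (rule expand)
    then show ?thesis by (simp add: fd_eqI)
  qed
  have cont: "continuous (at z) f" using f by (rule differentiable_imp_continuous_within)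
  then obtain W where W: "open W" "z \<in> W" "\<And>w. w \<in> W \<Longrightarrow> f w \<in> V"
    using continuous_at_open[of z f] assms(1,2) by blast
  have "((\<lambda>w. B (f w) b) has_derivative (\<lambda>v. fd (\<lambda>y. B y b) (f z) (fd f z v))) (at z)" for b
    using has_derivative_compose[OF fd_has_derivative[OF f] fd_has_derivative[OF B]] .
  then have "((\<lambda>w. \<Sum>b\<in>Basis. (g w \<bullet> b) *\<^sub>R B (f w) b) has_derivative
     (\<lambda>v. \<Sum>b\<in>Basis. (g z \<bullet> b) *\<^sub>R fd (\<lambda>y. B y b) (f z) (fd f z v) + (fd g z v \<bullet> b) *\<^sub>R B (f z) b)) (at z)"
    by (auto intro!: derivative_eq_intros fd_has_derivative[OF g])
  then have "((\<lambda>w. B (f w) (g w)) has_derivative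
     (\<lambda>v. \<Sum>b\<in>Basis. (g z \<bullet> b) *\<^sub>R fd (\<lambda>y. B y b) (f z) (fd f z v) + (fd g z v \<bullet> b) *\<^sub>R B (f z) b)) (at z)"
    by (subst has_derivative_cong_open[OF W(1,2), of "\<lambda>w. B (f w) (g w)" "\<lambda>w. \<Sum>b\<in>Basis. (g w \<bullet> b) *\<^sub>R B (f w) b"])
      (rule expand[OF W(3)])
  then show ?thesis
    unfolding sum.distrib fd_expand[symmetric] expand[OF assms(2), symmetric] .
qed

lemma fd_pairing:
  fixes B :: "'b::real_normed_vector \<Rightarrow> 'e::euclidean_space \<Rightarrow> 'g::real_normed_vector"
  assumes "open V" "f z \<in> V" "\<And>y. y \<in> V \<Longrightarrow> linear (B y)"
    "\<And>e. (\<lambda>y. B y e) differentiable (at (f z))" "f differentiable (at z)" "g differentiable (at z)"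
  shows "fd (\<lambda>w. B (f w) (g w)) z v = fd (\<lambda>y. B y (g z)) (f z) (fd f z v) + B (f z) (fd g z v)"
    and "(\<lambda>w. B (f w) (g w)) differentiable (at z)"
  using has_derivative_pairing[OF assms] fd_eqI[OF has_derivative_pairing[OF assms]]
  unfolding differentiable_def by auto

text \<open>
  The closure properties of \<open>Ck_on\<close> follow the same pattern: the derivative of the new map is
  computed on the open set and is built from maps to which the induction hypothesis applies.
\<close>

lemma Ck_on_cong:
  assumes "open U" "\<And>x. x \<in> U \<Longrightarrow> f x = g x" "Ck_on k U f"
  shows "Ck_on k U g"
  using assms(2,3)
proof (induction k arbitrary: f g)
  case 0 then show ?case using continuous_on_cong by (metis Ck_on.simps(1))
next
  case (Suc k)
  have "Ck_on k U (\<lambda>x. fd g x v)" for v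
  proof (rule Suc.IH)
    show "Ck_on k U (\<lambda>x. fd f x v)" using Suc.prems by simp
    show "fd f x v = fd g x v" if "x \<in> U" for x
      using fd_cong[of U x f g, OF assms(1) that Suc.prems(1)] by simp
  qed
  moreover have "g differentiable (at x)" if "x \<in> U" for x
    using differentiable_cong[of U x f g, OF assms(1) that Suc.prems(1)] Suc.prems(2) that by simp
  ultimately show ?case by simp
qed

lemma Ck_on_subset: "Ck_on k U f \<Longrightarrow> V \<subseteq> U \<Longrightarrow> Ck_on k V f"
  by (induction k arbitrary: f) (auto intro: continuous_on_subset)

lemma Ck_on_SucD: "Ck_on (Suc k) U f \<Longrightarrow> Ck_on k U f"
proof (induction k arbitrary: f)
  case 0 then show ?case
    by (metis Ck_on.simps continuous_at_imp_continuous_on differentiable_imp_continuous_within)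
next
  case (Suc k)
  show ?case unfolding Ck_on.simps(2)[of k] using Suc.prems Suc.IH by (metis Ck_on.simps(2))
qed

lemma Ck_on_const: "Ck_on k U (\<lambda>x. c)"
  by (induction k arbitrary: c) auto

lemma Ck_on_bounded_linear:
  assumes "open U" "bounded_linear L" "Ck_on k U f"
  shows "Ck_on k U (\<lambda>x. L (f x))"
  using assms(3)
proof (induction k arbitrary: f)
  case 0 then show ?case
    using assms(2) by (auto intro!: continuous_intros bounded_linear.continuous_on[OF assms(2)])
next
  case (Suc k)
  then have d: "f differentiable (at x)" if "x \<in> U" for x using that by simp
  have "Ck_on k U (\<lambda>x. fd (\<lambda>x. L (f x)) x v)" for v
  proof (rule Ck_on_cong[OF assms(1)])
    show "Ck_on k U (\<lambda>x. L (fd f x v))" using Suc by simp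
  qed (simp add: fd_bounded_linear[OF assms(2) d])
  then show ?case using differentiable_bounded_linear[OF assms(2) d] by simp
qed

lemma Ck_on_linear: "open U \<Longrightarrow> bounded_linear L \<Longrightarrow> Ck_on k U L"
proof -
  assume a: "open U" "bounded_linear L"
  have "Ck_on k U (\<lambda>x. x)"
  proof (cases k)
    case (Suc n)
    then show ?thesis by (simp add: Ck_on_const)
  qed simp
  then show ?thesis using Ck_on_bounded_linear[OF a] by fastforce
qed

lemma Ck_on_add:
  assumes "open U" "Ck_on k U f" "Ck_on k U g"
  shows "Ck_on k U (\<lambda>x. f x + g x)"
  using assms(2,3)
proof (induction k arbitrary: f g)
  case 0 then show ?case by (auto intro!: continuous_intros)
next
  case (Suc k)
  then have d: "f differentiable (at x)" "g differentiable (at x)" if "x \<in> U" for x using that by auto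
  have "Ck_on k U (\<lambda>x. fd (\<lambda>x. f x + g x) x v)" for v
  proof (rule Ck_on_cong[OF assms(1)])
    show "Ck_on k U (\<lambda>x. fd f x v + fd g x v)" using Suc by simp
  qed (simp add: fd_add d)
  then show ?case using d by simp
qed

lemma Ck_on_sum:
  assumes "open U" "finite I" "\<And>i. i \<in> I \<Longrightarrow> Ck_on k U (f i)"
  shows "Ck_on k U (\<lambda>x. \<Sum>i\<in>I. f i x)"
  using assms(2,3) by (induction I) (auto simp: Ck_on_const intro: Ck_on_add[OF assms(1)])

lemma Ck_on_scaleR:
  fixes f :: "'a::real_normed_vector \<Rightarrow> real"
  assumes "open U" "Ck_on k U f" "Ck_on k U g"
  shows "Ck_on k U (\<lambda>x. f x *\<^sub>R g x)"
  using assms(2,3)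
proof (induction k arbitrary: f g)
  case 0 then show ?case by (auto intro!: continuous_intros)
next
  case (Suc k)
  then have d: "f differentiable (at x)" "g differentiable (at x)" if "x \<in> U" for x using that by auto
  have "Ck_on k U (\<lambda>x. fd (\<lambda>x. f x *\<^sub>R g x) x v)" for v
  proof (rule Ck_on_cong[OF assms(1)])
    have "Ck_on k U f" "Ck_on k U g" using Suc.prems Ck_on_SucD by auto
    then show "Ck_on k U (\<lambda>x. f x *\<^sub>R fd g x v + fd f x v *\<^sub>R g x)"
      using Suc by (auto intro!: Ck_on_add[OF assms(1)])
    show "f x *\<^sub>R fd g x v + fd f x v *\<^sub>R g x = fd (\<lambda>x. f x *\<^sub>R g x) x v" if "x \<in> U" for x
      using fd_eqI[OF has_derivative_scaleR[OF d(1)[OF that, THEN fd_has_derivative] d(2)[OF that, THEN fd_has_derivative]]]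
      by simp
  qed
  then show ?case using d by simp
qed

lemma Ck_on_compose_fst:
  fixes f :: "'a::real_normed_vector \<Rightarrow> 'b::real_normed_vector"
  assumes "open U" "Ck_on k U f"
  shows "Ck_on k (U \<times> (UNIV :: 'c::real_normed_vector set)) (\<lambda>z. f (fst z))"
  using assms(2)
proof (induction k arbitrary: f)
  case 0 then show ?case by (auto intro!: continuous_intros continuous_on_compose2[of U f])
next
  case (Suc k)
  have o: "open (U \<times> (UNIV :: 'c set))" using assms(1) by (simp add: open_Times)
  have d: "fst differentiable (at z)" "f differentiable (at (fst z))" if "z \<in> U \<times> (UNIV :: 'c set)" for z
    using that Suc.prems bounded_linear_fst[THEN bounded_linear_imp_differentiable] by auto
  have "Ck_on k (U \<times> (UNIV :: 'c set)) (\<lambda>z. fd (\<lambda>z. f (fst z)) z v)" for v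
  proof (rule Ck_on_cong[OF o])
    show "Ck_on k (U \<times> (UNIV :: 'c set)) (\<lambda>z. fd f (fst z) (fst v))"
      using Suc.IH[of "\<lambda>x. fd f x (fst v)"] Suc.prems by simp
    show "fd f (fst z) (fst v) = fd (\<lambda>z. f (fst z)) z v" if "z \<in> U \<times> (UNIV :: 'c set)" for z
      using fd_chain[OF d[OF that]] bounded_linear_imp_has_derivative[OF bounded_linear_fst, THEN fd_eqI]
      by metis
  qed
  then show ?case using differentiable_chain[OF d] by simp
qed

lemma smooth_on_differentiable: "smooth_on U f \<Longrightarrow> x \<in> U \<Longrightarrow> f differentiable (at x)"
  unfolding smooth_on_def by (metis Ck_on.simps(2))

lemma smooth_on_fd: "smooth_on U f \<Longrightarrow> smooth_on U (\<lambda>x. fd f x v)"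
  unfolding smooth_on_def by (metis Ck_on.simps(2))

lemma smooth_on_continuous: "smooth_on U f \<Longrightarrow> continuous_on U f"
  unfolding smooth_on_def by (metis Ck_on.simps(1))

lemma smooth_on_cong:
  "open U \<Longrightarrow> (\<And>x. x \<in> U \<Longrightarrow> f x = g x) \<Longrightarrow> smooth_on U f \<Longrightarrow> smooth_on U g"
  unfolding smooth_on_def using Ck_on_cong by blast

lemma smooth_on_bounded_linear:
  "open U \<Longrightarrow> bounded_linear L \<Longrightarrow> smooth_on U f \<Longrightarrow> smooth_on U (\<lambda>x. L (f x))"
  unfolding smooth_on_def using Ck_on_bounded_linear by blast

lemma smooth_on_linear: "open U \<Longrightarrow> bounded_linear L \<Longrightarrow> smooth_on U L"
  unfolding smooth_on_def using Ck_on_linear by blast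

lemma smooth_on_subset: "smooth_on U f \<Longrightarrow> V \<subseteq> U \<Longrightarrow> smooth_on V f"
  unfolding smooth_on_def using Ck_on_subset by blast

lemma smooth_on_add: "open U \<Longrightarrow> smooth_on U f \<Longrightarrow> smooth_on U g \<Longrightarrow> smooth_on U (\<lambda>x. f x + g x)"
  unfolding smooth_on_def using Ck_on_add by blast

lemma smooth_on_sum:
  "open U \<Longrightarrow> finite I \<Longrightarrow> (\<And>i. i \<in> I \<Longrightarrow> smooth_on U (f i)) \<Longrightarrow> smooth_on U (\<lambda>x. \<Sum>i\<in>I. f i x)"
  unfolding smooth_on_def using Ck_on_sum by blast

lemma smooth_on_scaleR:
  "open U \<Longrightarrow> smooth_on U f \<Longrightarrow> smooth_on U g \<Longrightarrow> smooth_on U (\<lambda>x. f x *\<^sub>R g x)"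
  for f :: "_ \<Rightarrow> real"
  unfolding smooth_on_def using Ck_on_scaleR by blast

lemma smooth_on_compose_fst: "open U \<Longrightarrow> smooth_on U f \<Longrightarrow> smooth_on (U \<times> UNIV) (\<lambda>z. f (fst z))"
  unfolding smooth_on_def using Ck_on_compose_fst by blast

text \<open>
  Two applications of the mean value theorem turn the second difference over a parallelogram into a
  mixed second derivative at one of its points.
\<close>

lemma second_difference:
  fixes f :: "'a::real_normed_vector \<Rightarrow> real"
  assumes h: "h > 0"
    and mem: "\<And>s t. 0 \<le> s \<Longrightarrow> s \<le> h \<Longrightarrow> 0 \<le> t \<Longrightarrow> t \<le> h \<Longrightarrow> z + s *\<^sub>R X + t *\<^sub>R Y \<in> U"
    and f: "\<And>w. w \<in> U \<Longrightarrow> f differentiable (at w)"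
    and f2: "\<And>w. w \<in> U \<Longrightarrow> (\<lambda>w. fd f w X) differentiable (at w)"
  shows "\<exists>s t. 0 \<le> s \<and> s \<le> h \<and> 0 \<le> t \<and> t \<le> h \<and>
    f (z + h *\<^sub>R X + h *\<^sub>R Y) - f (z + h *\<^sub>R X) - f (z + h *\<^sub>R Y) + f z
      = h * h * fd (\<lambda>w. fd f w X) (z + s *\<^sub>R X + t *\<^sub>R Y) Y"
proof -
  have along: "((\<lambda>r. g (a + r *\<^sub>R V)) has_derivative (\<lambda>x. x * fd g (a + r *\<^sub>R V) V)) (at r within S)"
    if "g differentiable (at (a + r *\<^sub>R V))" for g :: "'a \<Rightarrow> real" and a r V S
  proof -
    have 1: "((\<lambda>r. a + r *\<^sub>R V) has_derivative (\<lambda>x. x *\<^sub>R V)) (at r)"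
      by (auto intro!: derivative_eq_intros)
    show ?thesis
      using has_derivative_compose[OF 1 fd_has_derivative[OF that]] linear_scale[OF fd_linear[OF that]]
      by (simp add: has_derivative_at_withinI)
  qed
  define u where "u r = f (z + h *\<^sub>R Y + r *\<^sub>R X) - f (z + r *\<^sub>R X)" for r
  have "\<exists>s\<in>{0<..<h}. u h - u 0 =
      (\<lambda>x. x * fd f (z + h *\<^sub>R Y + s *\<^sub>R X) X - x * fd f (z + s *\<^sub>R X) X) (h - 0)"
  proof (rule mvt_simple[OF h])
    fix r assume r: "0 \<le> r" "r \<le> h"
    show "(u has_derivative (\<lambda>x. x * fd f (z + h *\<^sub>R Y + r *\<^sub>R X) X - x * fd f (z + r *\<^sub>R X) X))
        (at r within {0..h})"
      unfolding u_def
      by (intro has_derivative_diff along f)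
        (use mem[of r h] mem[of r 0] r h in \<open>auto simp: algebra_simps\<close>)
  qed
  then obtain s where s: "0 < s" "s < h"
    and us: "u h - u 0 = h * (fd f (z + s *\<^sub>R X + h *\<^sub>R Y) X - fd f (z + s *\<^sub>R X + 0 *\<^sub>R Y) X)"
    by (auto simp: algebra_simps)
  have "\<exists>t\<in>{0<..<h}. fd f (z + s *\<^sub>R X + h *\<^sub>R Y) X - fd f (z + s *\<^sub>R X + 0 *\<^sub>R Y) X =
      (\<lambda>x. x * fd (\<lambda>w. fd f w X) (z + s *\<^sub>R X + t *\<^sub>R Y) Y) (h - 0)"
    by (rule mvt_simple[OF h], rule along, rule f2, rule mem) (use s in auto)
  then obtain t where t: "0 < t" "t < h"
    and "fd f (z + s *\<^sub>R X + h *\<^sub>R Y) X - fd f (z + s *\<^sub>R X + 0 *\<^sub>R Y) X =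
      h * fd (\<lambda>w. fd f w X) (z + s *\<^sub>R X + t *\<^sub>R Y) Y" by auto
  with us have "u h - u 0 = h * h * fd (\<lambda>w. fd f w X) (z + s *\<^sub>R X + t *\<^sub>R Y) Y" by simp
  moreover have "u h - u 0 = f (z + h *\<^sub>R X + h *\<^sub>R Y) - f (z + h *\<^sub>R X) - f (z + h *\<^sub>R Y) + f z"
    by (simp add: u_def algebra_simps)
  ultimately show ?thesis using s[THEN less_imp_le] t[THEN less_imp_le] by auto
qed

text \<open>
  The second difference is symmetric in \<open>X\<close> and \<open>Y\<close>, so the two mixed derivatives agree at points
  that may differ but are arbitrarily close to \<open>z\<close>; by continuity they agree at \<open>z\<close>.
\<close>

lemma fd_commute_real:
  fixes f :: "'a::real_normed_vector \<Rightarrow> real"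
  assumes "open U" "z \<in> U" and sm: "smooth_on U f"
  shows "fd (\<lambda>w. fd f w X) z Y = fd (\<lambda>w. fd f w Y) z X"
proof (rule ccontr)
  assume ne: "\<not> ?thesis"
  define A where "A = (\<lambda>z. fd (\<lambda>w. fd f w X) z Y)"
  define B where "B = (\<lambda>z. fd (\<lambda>w. fd f w Y) z X)"
  define e where "e = \<bar>A z - B z\<bar> / 2"
  have e: "e > 0" using ne by (simp add: e_def A_def B_def)
  have cont: "continuous (at z) A" "continuous (at z) B"
    unfolding A_def B_def
    using smooth_on_continuous[OF smooth_on_fd[OF smooth_on_fd[OF sm]]] assms(1,2)
    by (auto simp: continuous_on_eq_continuous_at)
  obtain d1 where d1: "d1 > 0" "\<And>w. dist w z < d1 \<Longrightarrow> dist (A w) (A z) < e"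
    using cont(1) e unfolding continuous_at_eps_delta by blast
  obtain d2 where d2: "d2 > 0" "\<And>w. dist w z < d2 \<Longrightarrow> dist (B w) (B z) < e"
    using cont(2) e unfolding continuous_at_eps_delta by blast
  obtain d3 where d3: "d3 > 0" "ball z d3 \<subseteq> U" using assms(1,2) open_contains_ball by blast
  define d where "d = min d1 (min d2 d3)"
  \<comment> \<open>small enough for the parallelogram spanned by \<open>h X\<close> and \<open>h Y\<close> to stay within distance \<open>d\<close>\<close>
  define h where "h = d / (2 * (norm X + norm Y + 1))"
  have d: "d > 0" using d1 d2 d3 by (simp add: d_def)
  have pos: "norm X + norm Y + 1 > 0" using norm_ge_zero[of X] norm_ge_zero[of Y] by linarith
  have h: "h > 0" using d pos by (simp add: h_def)
  have near: "dist (z + s *\<^sub>R X + t *\<^sub>R Y) z < d" if "0 \<le> s" "s \<le> h" "0 \<le> t" "t \<le> h" for s t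
  proof -
    have "norm (s *\<^sub>R X + t *\<^sub>R Y) \<le> s * norm X + t * norm Y"
      using norm_triangle_ineq[of "s *\<^sub>R X" "t *\<^sub>R Y"] that by simp
    also have "\<dots> \<le> h * norm X + h * norm Y"
      using that by (intro add_mono mult_right_mono) auto
    also have "\<dots> < h * (norm X + norm Y + 1) * 2"
      using h pos by (simp add: algebra_simps add_nonneg_pos)
    also have "\<dots> = d" using pos unfolding h_def by (simp add: field_simps)
    finally show ?thesis by (simp add: dist_norm algebra_simps)
  qed
  have memU: "z + s *\<^sub>R X + t *\<^sub>R Y \<in> U" if "0 \<le> s" "s \<le> h" "0 \<le> t" "t \<le> h" for s t
    using near[OF that] d3 by (auto simp: d_def dist_commute)
  note df = smooth_on_differentiable[OF sm] smooth_on_differentiable[OF smooth_on_fd[OF sm]]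
  obtain s t where st: "0 \<le> s" "s \<le> h" "0 \<le> t" "t \<le> h" and
    1: "f (z + h *\<^sub>R X + h *\<^sub>R Y) - f (z + h *\<^sub>R X) - f (z + h *\<^sub>R Y) + f z
      = h * h * A (z + s *\<^sub>R X + t *\<^sub>R Y)"
    using second_difference[of h z X Y U f, OF h memU df] unfolding A_def by blast
  have memU': "z + s *\<^sub>R Y + t *\<^sub>R X \<in> U" if "0 \<le> s" "s \<le> h" "0 \<le> t" "t \<le> h" for s t
    using memU[OF that(3,4,1,2)] by (simp add: algebra_simps)
  obtain s' t' where st': "0 \<le> s'" "s' \<le> h" "0 \<le> t'" "t' \<le> h" and
    2: "f (z + h *\<^sub>R Y + h *\<^sub>R X) - f (z + h *\<^sub>R Y) - f (z + h *\<^sub>R X) + f z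
      = h * h * B (z + s' *\<^sub>R Y + t' *\<^sub>R X)"
    using second_difference[of h z Y X U f, OF h memU' df] unfolding B_def by blast
  have "h * h * A (z + s *\<^sub>R X + t *\<^sub>R Y) = h * h * B (z + s' *\<^sub>R Y + t' *\<^sub>R X)"
    using 1 2 by (simp add: algebra_simps)
  then have "A (z + s *\<^sub>R X + t *\<^sub>R Y) = B (z + t' *\<^sub>R X + s' *\<^sub>R Y)"
    using h by (simp add: algebra_simps)
  moreover have "dist (A (z + s *\<^sub>R X + t *\<^sub>R Y)) (A z) < e"
    using d1(2) near[OF st] by (simp add: d_def)
  moreover have "dist (B (z + t' *\<^sub>R X + s' *\<^sub>R Y)) (B z) < e"
    using d2(2) near[OF st'(3,4,1,2)] by (simp add: d_def)
  ultimately show False unfolding dist_real_def e_def by argo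
qed

lemma fd_commute:
  fixes f :: "'a::real_normed_vector \<Rightarrow> 'b::euclidean_space"
  assumes "open U" "z \<in> U" and sm: "smooth_on U f"
  shows "fd (\<lambda>w. fd f w X) z Y = fd (\<lambda>w. fd f w Y) z X"
proof (rule euclidean_eqI)
  fix b :: 'b assume "b \<in> Basis"
  note bl = bounded_linear_inner_left[of b]
  have *: "fd (\<lambda>w. fd f w X) z Y \<bullet> b = fd (\<lambda>w. fd (\<lambda>w. f w \<bullet> b) w X) z Y" for X Y
  proof -
    have "fd (\<lambda>w. fd (\<lambda>w. f w \<bullet> b) w X) z Y = fd (\<lambda>w. fd f w X \<bullet> b) z Y"
      using fd_bounded_linear[OF bl smooth_on_differentiable[OF sm]]
      by (subst fd_cong[OF assms(1,2)]) auto
    also have "\<dots> = fd (\<lambda>w. fd f w X) z Y \<bullet> b"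
      by (rule fd_bounded_linear[OF bl smooth_on_differentiable[OF smooth_on_fd[OF sm] assms(2)]])
    finally show ?thesis by simp
  qed
  show "fd (\<lambda>w. fd f w X) z Y \<bullet> b = fd (\<lambda>w. fd f w Y) z X \<bullet> b"
    unfolding * by (rule fd_commute_real[OF assms(1,2) smooth_on_bounded_linear[OF assms(1) bl sm]])
qed

section \<open>Smooth atlases\<close>

text \<open>
  The part of the notion of a manifold that concerns its atlas only.  The slit tangent
  bundle carries no explicit topology; it enters as a smooth atlas.
\<close>

locale smooth_atlas =
  fixes N :: "('a, 'e::euclidean_space) chart set"
  assumes inj_chart: "c \<in> N \<Longrightarrow> inj_on (snd c) (fst c)"
    and open_overlap: "c \<in> N \<Longrightarrow> c' \<in> N \<Longrightarrow> open (snd c ` (fst c \<inter> fst c'))"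
    and smooth_transition:
      "c \<in> N \<Longrightarrow> c' \<in> N \<Longrightarrow> smooth_on (snd c ` (fst c \<inter> fst c')) (transition c c')"
begin

abbreviation jac where "jac c c' q \<equiv> fd (transition c c') (snd c q)"

lemma open_image: "c \<in> N \<Longrightarrow> open (snd c ` fst c)"
  using open_overlap[of c c] by simp

lemma chart_inv_apply [simp]: "c \<in> N \<Longrightarrow> q \<in> fst c \<Longrightarrow> chart_inv c (snd c q) = q"
  by (simp add: chart_inv_def inj_chart)

lemma transition_apply [simp]: "c \<in> N \<Longrightarrow> q \<in> fst c \<Longrightarrow> transition c c' (snd c q) = snd c' q"
  by (simp add: transition_def)

lemma smooth_transition_all: 
  assumes "c \<in> N" "c' \<in> N" "q \<in> fst c" "q \<in> fst c'"
  shows "transition c c' differentiable (at (snd c q))"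
    and "(\<lambda>z. fd (transition c c') z x) differentiable (at (snd c q))"
    and "linear (jac c c' q)"
proof -
  have q: "snd c q \<in> snd c ` (fst c \<inter> fst c')" using assms by blast
  show 1: "transition c c' differentiable (at (snd c q))"
    by (rule smooth_on_differentiable[OF smooth_transition[OF assms(1,2)] q])
  show "(\<lambda>z. fd (transition c c') z x) differentiable (at (snd c q))"
    by (rule smooth_on_differentiable[OF smooth_on_fd[OF smooth_transition[OF assms(1,2)]] q])
  show "linear (jac c c' q)" by (rule fd_linear[OF 1])
qed

lemma jac_id:
  assumes "c \<in> N" "q \<in> fst c"
  shows "jac c c q v = v"
proof -
  have "jac c c q = fd (\<lambda>z. z) (snd c q)"
    by (rule fd_cong[OF open_image[OF assms(1)]]) (use assms in auto)
  then show ?thesis by simp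
qed

lemma jac_chain:
  assumes c: "c \<in> N" "c' \<in> N" "c'' \<in> N" and q: "q \<in> fst c" "q \<in> fst c'" "q \<in> fst c''"
  shows "jac c c'' q v = jac c' c'' q (jac c c' q v)"
proof -
  have "jac c c'' q v = fd (\<lambda>z. transition c' c'' (transition c c' z)) (snd c q) v"
    by (subst fd_cong[OF open_overlap[OF c(1,2)], of _ "transition c c''" "\<lambda>z. transition c' c'' (transition c c' z)"])
      (use c q in auto)
  also have "\<dots> = fd (transition c' c'') (transition c c' (snd c q)) (jac c c' q v)"
    by (rule fd_chain) (use smooth_transition_all(1) c q in auto)
  finally show ?thesis using c q by simp
qed

lemma coord_field_apply:
  "c' \<in> N \<Longrightarrow> q \<in> fst c' \<Longrightarrow> coord_field N c x q c' = jac c c' q x"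
  by (simp add: coord_field_def)

lemma coord_field_self [simp]: "c \<in> N \<Longrightarrow> q \<in> fst c \<Longrightarrow> coord_field N c x q c = x"
  by (simp add: coord_field_apply jac_id)

lemma coord_field_tangent [simp]:
  assumes "c \<in> N" "q \<in> fst c" shows "coord_field N c x q \<in> tangent_space N q"
proof -
  let ?v = "coord_field N c x q"
  show ?thesis
    unfolding tangent_space_def
  proof (intro CollectI conjI allI impI ballI)
    fix c' assume "\<not> (c' \<in> N \<and> q \<in> fst c')"
    then show "?v c' = 0" unfolding coord_field_def by argo
  next
    fix c' c'' assume c: "c' \<in> N" "c'' \<in> N" "q \<in> fst c'" "q \<in> fst c''"
    show "?v c'' = jac c' c'' q (?v c')"
      unfolding coord_field_apply[OF c(1,3)] coord_field_apply[OF c(2,4)]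
      by (rule jac_chain[OF assms(1) c(1,2) assms(2) c(3,4)])
  qed
qed

lemma tangent_change:
  "v \<in> tangent_space N q \<Longrightarrow> c \<in> N \<Longrightarrow> c' \<in> N \<Longrightarrow> q \<in> fst c \<Longrightarrow> q \<in> fst c' \<Longrightarrow> v c' = jac c c' q (v c)"
  unfolding tangent_space_def by blast

lemma tangent_eq_coord_field:
  assumes "v \<in> tangent_space N q" "c \<in> N" "q \<in> fst c" shows "coord_field N c (v c) q = v"
proof (rule ext)
  fix c'
  show "coord_field N c (v c) q c' = v c'"
  proof (cases "c' \<in> N \<and> q \<in> fst c'")
    case True
    then show ?thesis using tangent_change[OF assms(1,2) _ assms(3), of c'] coord_field_apply[of c' q c "v c"] True by metis
  next
    case False
    then have "v c' = 0" using assms(1) unfolding tangent_space_def by blast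
    then show ?thesis using False by (auto simp: coord_field_def)
  qed
qed

lemma tlin_tangent:
  assumes "v \<in> tangent_space N q" "w \<in> tangent_space N q" 
  shows "tlin a v b w \<in> tangent_space N q"
  unfolding tangent_space_def
proof (intro CollectI conjI allI impI ballI)
  fix c assume "\<not> (c \<in> N \<and> q \<in> fst c)"
  then have "v c = 0" "w c = 0" using assms unfolding tangent_space_def by blast+
  then show "tlin a v b w c = 0" by (simp add: tlin_def)
next
  fix c c' assume c: "c \<in> N" "c' \<in> N" "q \<in> fst c" "q \<in> fst c'"
  note lin = smooth_transition_all(3)[OF c]
  show "tlin a v b w c' = jac c c' q (tlin a v b w c)"
    unfolding tlin_def tangent_change[OF assms(1) c] tangent_change[OF assms(2) c]
    by (simp add: linear_add[OF lin] linear_scale[OF lin])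
qed

lemma coord_field_tlin:
  assumes "c \<in> N" "q \<in> fst c"
  shows "coord_field N c (a *\<^sub>R x + b *\<^sub>R y) q = tlin a (coord_field N c x q) b (coord_field N c y q)"
proof (rule ext)
  fix c'
  show "coord_field N c (a *\<^sub>R x + b *\<^sub>R y) q c' = tlin a (coord_field N c x q) b (coord_field N c y q) c'"
  proof (cases "c' \<in> N \<and> q \<in> fst c'")
    case True
    then have lin: "linear (jac c c' q)" using smooth_transition_all(3)[OF assms(1) _ assms(2)] by blast
    show ?thesis using True by (simp add: coord_field_def tlin_def linear_add[OF lin] linear_scale[OF lin])
  qed (auto simp: coord_field_def tlin_def)
qed

lemma chart_at:
  assumes "q \<in> points N" shows "chart_at N q \<in> N" "q \<in> fst (chart_at N q)"
proof -
  have "\<exists>c. c \<in> N \<and> q \<in> fst c" using assms unfolding points_def by blast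
  from someI_ex[OF this] show "chart_at N q \<in> N" "q \<in> fst (chart_at N q)" unfolding chart_at_def by auto
qed

lemma pointsI: "c \<in> N \<Longrightarrow> q \<in> fst c \<Longrightarrow> q \<in> points N"
  unfolding points_def by blast

lemma fd_change:
  assumes c: "c \<in> N" "c' \<in> N" and q: "q \<in> fst c" "q \<in> fst c'"
    and f: "(\<lambda>z. f (chart_inv c' z)) differentiable (at (snd c' q))"
  shows "fd (\<lambda>z. f (chart_inv c z)) (snd c q) v = fd (\<lambda>z. f (chart_inv c' z)) (snd c' q) (jac c c' q v)"
    and "(\<lambda>z. f (chart_inv c z)) differentiable (at (snd c q))"
proof -
  have eq: "f (chart_inv c z) = f (chart_inv c' (transition c c' z))"
    if "z \<in> snd c ` (fst c \<inter> fst c')" for z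
    using that c by auto
  have q': "snd c q \<in> snd c ` (fst c \<inter> fst c')" using q by blast
  have f': "(\<lambda>z. f (chart_inv c' z)) differentiable (at (transition c c' (snd c q)))"
    using f c q by simp
  note d = smooth_transition_all(1)[OF c q] f'
  have "fd (\<lambda>z. f (chart_inv c z)) (snd c q) = fd (\<lambda>z. f (chart_inv c' (transition c c' z))) (snd c q)"
    by (rule fd_cong[OF open_overlap[OF c] q']) (rule eq)
  then show "fd (\<lambda>z. f (chart_inv c z)) (snd c q) v = fd (\<lambda>z. f (chart_inv c' z)) (snd c' q) (jac c c' q v)"
    using fd_chain[OF d, of v] c q by simp
  show "(\<lambda>z. f (chart_inv c z)) differentiable (at (snd c q))"
    using differentiable_cong[OF open_overlap[OF c] q', of "\<lambda>z. f (chart_inv c z)"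
        "\<lambda>z. f (chart_inv c' (transition c c' z))", OF eq] differentiable_chain[OF d] by blast
qed

lemma deriv_along_eq:
  assumes "c \<in> N" "q \<in> fst c" "v \<in> tangent_space N q"
    "(\<lambda>z. f (chart_inv c z)) differentiable (at (snd c q))"
  shows "deriv_along N q v f = fd (\<lambda>z. f (chart_inv c z)) (snd c q) (v c)"
proof -
  note ca = chart_at[OF pointsI[OF assms(1,2)]]
  show ?thesis
    unfolding deriv_along_def comp_def
    using fd_change(1)[OF ca(1) assms(1) ca(2) assms(2,4)]
      tangent_change[OF assms(3) ca(1) assms(1) ca(2) assms(2)] by simp
qed

text \<open>
  The values of a coordinate field are tangent vectors only over the domain of its chart, so
  the calculus of vector fields is set up for fields that are tangent near one point and
  differentiable at this point.
\<close>

definition local_field :: "'a \<Rightarrow> ('a, 'e) vfield \<Rightarrow> bool" where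
  "local_field w X \<longleftrightarrow>
     (\<exists>c0\<in>N. w \<in> fst c0 \<and> (\<forall>q\<in>fst c0. X q \<in> tangent_space N q)) \<and>
     (\<forall>c\<in>N. w \<in> fst c \<longrightarrow> (\<lambda>z. X (chart_inv c z) c) differentiable (at (snd c w)))"

lemma local_field_tangent: "local_field w X \<Longrightarrow> X w \<in> tangent_space N w"
  unfolding local_field_def by blast

lemma vector_field_local: "vector_field N X \<Longrightarrow> w \<in> points N \<Longrightarrow> local_field w X"
  unfolding vector_field_def local_field_def points_def
  by (intro conjI ballI impI smooth_on_differentiable) blast+

lemma coord_field_local:
  assumes "c \<in> N" "w \<in> fst c" shows "local_field w (coord_field N c x)"
  unfolding local_field_def
proof (intro conjI ballI impI bexI[of _ c])
  fix c' assume c': "c' \<in> N" "w \<in> fst c'"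
  have w: "snd c' w \<in> snd c' ` (fst c' \<inter> fst c)" using c' assms by blast
  have eq: "coord_field N c x (chart_inv c' z) c' = fd (transition c c') (transition c' c z) x"
    if "z \<in> snd c' ` (fst c' \<inter> fst c)" for z
    using that c' assms by (auto simp: coord_field_apply)
  have d: "(\<lambda>z. fd (transition c c') z x) differentiable (at (transition c' c (snd c' w)))"
    using smooth_transition_all(2)[OF assms(1) c'(1) assms(2) c'(2)] c' by simp
  show "(\<lambda>z. coord_field N c x (chart_inv c' z) c') differentiable (at (snd c' w))"
    using differentiable_cong[OF open_overlap[OF c'(1) assms(1)] w,
        of "\<lambda>z. coord_field N c x (chart_inv c' z) c'" "\<lambda>z. fd (transition c c') (transition c' c z) x", OF eq]
      differentiable_chain[OF smooth_transition_all(1)[OF c'(1) assms(1) c'(2) assms(2)] d] by blast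
qed (use assms in auto)

text \<open>
  Differentiating the transformation law \<open>Y' \<circ> \<tau> = D\<tau> Y\<close> of the components produces the
  second derivative of the transition map \<open>\<tau>\<close>, besides the expected term.
\<close>

lemma fd_field_change:
  assumes Y: "local_field w Y" and c: "c \<in> N" "c' \<in> N" and w: "w \<in> fst c" "w \<in> fst c'"
  shows "fd (\<lambda>z. Y (chart_inv c' z) c') (snd c' w) (jac c c' w v) =
    fd (\<lambda>z. fd (transition c c') z (Y w c)) (snd c w) v
      + jac c c' w (fd (\<lambda>z. Y (chart_inv c z) c) (snd c w) v)"
proof -
  obtain c0 where c0: "c0 \<in> N" "w \<in> fst c0" "\<And>q. q \<in> fst c0 \<Longrightarrow> Y q \<in> tangent_space N q"
    using Y unfolding local_field_def by blast
  have dY: "(\<lambda>z. Y (chart_inv c z) c) differentiable (at (snd c w))"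
    "(\<lambda>z. Y (chart_inv c' z) c') differentiable (at (snd c' w))"
    using Y c w unfolding local_field_def by blast+
  let ?O = "snd c ` (fst c \<inter> fst c') \<inter> snd c ` (fst c \<inter> fst c0)"
  have O: "open ?O" "snd c w \<in> ?O"
    using open_Int[OF open_overlap[OF c] open_overlap[OF c(1) c0(1)]] c0 w by auto
  have eq: "Y (chart_inv c z) c' = fd (transition c c') z (Y (chart_inv c z) c)" if z: "z \<in> ?O" for z
  proof -
    obtain q where q: "q \<in> fst c" "q \<in> fst c'" "z = snd c q" using z by blast
    have "q \<in> fst c0" using z q inj_chart[OF c(1)] by (auto dest: inj_onD)
    then show ?thesis using tangent_change[OF c0(3) c q(1,2)] q c by simp
  qed
  have "fd (\<lambda>z. Y (chart_inv c' z) c') (snd c' w) (jac c c' w v)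
      = fd (\<lambda>z. Y (chart_inv c z) c') (snd c w) v"
    using fd_change(1)[OF c w, of "\<lambda>q. Y q c'"] dY by simp
  also have "\<dots> = fd (\<lambda>z. fd (transition c c') z (Y (chart_inv c z) c)) (snd c w) v"
    using fd_cong[OF O, of "\<lambda>z. Y (chart_inv c z) c'" "\<lambda>z. fd (transition c c') z (Y (chart_inv c z) c)", OF eq]
    by (rule fun_cong)
  also have "\<dots> = fd (\<lambda>z. fd (transition c c') z (Y (chart_inv c (snd c w)) c)) (snd c w) (fd (\<lambda>z. z) (snd c w) v)
      + jac c c' w (fd (\<lambda>z. Y (chart_inv c z) c) (snd c w) v)"
  proof (rule fd_pairing(1)[where V = "snd c ` (fst c \<inter> fst c')" and f = "\<lambda>z. z"
        and B = "fd (transition c c')" and g = "\<lambda>z. Y (chart_inv c z) c"])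
    fix z assume "z \<in> snd c ` (fst c \<inter> fst c')"
    then show "linear (fd (transition c c') z)" using smooth_transition_all(3)[OF c] by auto
  qed (use open_overlap[OF c] smooth_transition_all(2)[OF c w] w dY(1) in simp_all)
  finally show ?thesis using c w by simp
qed

lemma fd_transition_commute:
  assumes "c \<in> N" "c' \<in> N" "w \<in> fst c" "w \<in> fst c'"
  shows "fd (\<lambda>z. fd (transition c c') z x) (snd c w) y = fd (\<lambda>z. fd (transition c c') z y) (snd c w) x"
  by (rule fd_commute[OF open_overlap[OF assms(1,2)] _ smooth_transition[OF assms(1,2)]])
    (use assms in blast)

text \<open>
  The second derivatives of the transition map enter the two terms of the bracket symmetrically
  and cancel.
\<close>

lemma bracket_tangent:
  assumes X: "local_field w X" and Y: "local_field w Y"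
  shows "bracket N X Y w \<in> tangent_space N w"
  unfolding tangent_space_def
proof (intro CollectI conjI allI impI ballI)
  show "bracket N X Y w c = 0" if "\<not> (c \<in> N \<and> w \<in> fst c)" for c
    by (simp only: bracket_def if_not_P[OF that])
  fix c c' assume c: "c \<in> N" "c' \<in> N" and w: "w \<in> fst c" "w \<in> fst c'"
  have XY: "X w c' = jac c c' w (X w c)" "Y w c' = jac c c' w (Y w c)"
    using tangent_change[OF _ c w] X Y local_field_tangent by auto
  show "bracket N X Y w c' = jac c c' w (bracket N X Y w c)"
    using c w fd_transition_commute[OF c w, of "X w c" "Y w c"]
    by (simp add: bracket_def XY fd_field_change[OF X c w] fd_field_change[OF Y c w]
        linear_diff[OF smooth_transition_all(3)[OF c w]])
qed

lemma bracket_apply: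
  "c \<in> N \<Longrightarrow> w \<in> fst c \<Longrightarrow> bracket N X Y w c =
     fd (\<lambda>z. Y (chart_inv c z) c) (snd c w) (X w c) - fd (\<lambda>z. X (chart_inv c z) c) (snd c w) (Y w c)"
  by (simp add: bracket_def)

text \<open>
  For \<open>z\<close> in the image of the chart, \<open>comps \<omega> c z\<close> is the covector that represents \<open>\<omega>\<close> there.
\<close>

definition comps :: "('a, 'e) dform \<Rightarrow> ('a, 'e) chart \<Rightarrow> 'e \<Rightarrow> 'e \<Rightarrow> real" where
  "comps \<omega> c z e = \<omega> (chart_inv c z) [coord_field N c e (chart_inv c z)]"

lemma comps_smooth: "form N 1 \<omega> \<Longrightarrow> c \<in> N \<Longrightarrow> smooth_on (snd c ` fst c) (\<lambda>z. comps \<omega> c z e)"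
  unfolding form_def comps_def by (auto dest!: bspec spec[of _ "[e]"])

lemma comps_eval:
  "v \<in> tangent_space N q \<Longrightarrow> c \<in> N \<Longrightarrow> q \<in> fst c \<Longrightarrow> \<omega> q [v] = comps \<omega> c (snd c q) (v c)"
  by (simp add: comps_def tangent_eq_coord_field)

lemma form1_tlin:
  assumes "form N 1 \<omega>" "q \<in> points N" "v \<in> tangent_space N q" "w \<in> tangent_space N q"
  shows "\<omega> q [tlin a v b w] = a * \<omega> q [v] + b * \<omega> q [w]"
proof -
  have "\<forall>v'\<in>tangent_space N q. \<forall>w\<in>tangent_space N q. \<forall>a b.
     \<omega> q ([v][0 := tlin a v' b w]) = a * \<omega> q ([v][0 := v']) + b * \<omega> q ([v][0 := w])"
    using assms(1)[unfolded form_def, THEN conjunct1, rule_format, of q "[v]"] assms(2,3) by auto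
  then show ?thesis using assms(3,4) by simp
qed

lemma comps_linear:
  assumes "form N 1 \<omega>" "c \<in> N" "z \<in> snd c ` fst c"
  shows "linear (comps \<omega> c z)"
proof -
  obtain q where q: "q \<in> fst c" "z = snd c q" using assms by blast
  have *: "comps \<omega> c z (a *\<^sub>R x + b *\<^sub>R y) = a * comps \<omega> c z x + b * comps \<omega> c z y" for a b x y
    using q assms form1_tlin[OF assms(1) pointsI[OF assms(2) q(1)]]
    by (simp add: comps_def coord_field_tlin)
  show ?thesis
    using *[of 1 _ 1] *[of _ _ 0 0] by (intro linearI) auto
qed

lemma comps_differentiable:
  "form N 1 \<omega> \<Longrightarrow> c \<in> N \<Longrightarrow> q \<in> fst c \<Longrightarrow> (\<lambda>z. comps \<omega> c z e) differentiable (at (snd c q))"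
  by (rule smooth_on_differentiable[OF comps_smooth]) auto

lemma fd_comps_change:
  assumes \<omega>: "form N 1 \<omega>" and c: "c \<in> N" "c' \<in> N" and w: "w \<in> fst c" "w \<in> fst c'"
  shows "fd (\<lambda>z. comps \<omega> c z e) (snd c w) v =
    fd (\<lambda>z. comps \<omega> c' z (jac c c' w e)) (snd c' w) (jac c c' w v)
      + comps \<omega> c' (snd c' w) (fd (\<lambda>z. fd (transition c c') z e) (snd c w) v)"
proof -
  have w': "snd c w \<in> snd c ` (fst c \<inter> fst c')" using w by blast
  have eq: "comps \<omega> c z e = comps \<omega> c' (transition c c' z) (fd (transition c c') z e)"
    if z: "z \<in> snd c ` (fst c \<inter> fst c')" for z
  proof -
    obtain q where q: "q \<in> fst c" "q \<in> fst c'" "z = snd c q" using z by blast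
    show ?thesis
      using comps_eval[OF coord_field_tangent[OF c(1) q(1)] c(2) q(2), of \<omega> e] q c
      by (simp add: comps_def coord_field_apply)
  qed
  have "fd (\<lambda>z. comps \<omega> c z e) (snd c w) v
      = fd (\<lambda>z. comps \<omega> c' (transition c c' z) (fd (transition c c') z e)) (snd c w) v"
    using fd_cong[OF open_overlap[OF c] w', of "\<lambda>z. comps \<omega> c z e"
        "\<lambda>z. comps \<omega> c' (transition c c' z) (fd (transition c c') z e)", OF eq]
    by (rule fun_cong)
  also have "\<dots> = fd (\<lambda>z. comps \<omega> c' z (jac c c' w e)) (transition c c' (snd c w)) (jac c c' w v)
      + comps \<omega> c' (transition c c' (snd c w)) (fd (\<lambda>z. fd (transition c c') z e) (snd c w) v)"
    by (rule fd_pairing(1)[where V = "snd c' ` fst c'" and f = "transition c c'" and B = "comps \<omega> c'"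
          and g = "\<lambda>z. fd (transition c c') z e"])
      (use open_image[OF c(2)] comps_linear[OF \<omega> c(2)] comps_differentiable[OF \<omega> c(2) w(2)]
        smooth_transition_all[OF c w] c w in simp_all)
  finally show ?thesis using c w by simp
qed

text \<open>
  In the chart that defines \<open>ext_d\<close> at the point, only the values of the form on coordinate
  fields of this chart matter.
\<close>

lemma ext_d_at:
  assumes "u \<in> points N" and C: "C = chart_at N u"
    and f: "\<And>z e. z \<in> snd C ` fst C \<Longrightarrow> \<omega> (chart_inv C z) [coord_field N C e (chart_inv C z)] = f z e"
  shows "ext_d N \<omega> u [v0, v1] = fd (\<lambda>z. f z (v1 C)) (snd C u) (v0 C) - fd (\<lambda>z. f z (v0 C)) (snd C u) (v1 C)"
proof -
  note ca = chart_at[OF assms(1), folded C]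
  have "fd (\<lambda>z. \<omega> (chart_inv C z) [coord_field N C e (chart_inv C z)]) (snd C u) = fd (\<lambda>z. f z e) (snd C u)" for e
    by (rule fd_cong[OF open_image[OF ca(1)]]) (use ca f in auto)
  then show ?thesis
    by (simp add: ext_d_def deriv_along_def local_ext_def comp_def flip: C)
qed

text \<open>
  The second derivative of the transition map contributes a symmetric term to the derivative of
  the components (\<open>fd_comps_change\<close>); antisymmetrization removes it.
\<close>

lemma ext_d_1form:
  assumes \<omega>: "form N 1 \<omega>" and c: "c \<in> N" "w \<in> fst c"
    and v: "v0 \<in> tangent_space N w" "v1 \<in> tangent_space N w"
  shows "ext_d N \<omega> w [v0, v1] =
    fd (\<lambda>z. comps \<omega> c z (v1 c)) (snd c w) (v0 c) - fd (\<lambda>z. comps \<omega> c z (v0 c)) (snd c w) (v1 c)"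
proof -
  define C where "C = chart_at N w"
  note ca = chart_at[OF pointsI[OF c], folded C_def]
  note ch = v[THEN tangent_change, OF ca(1) c(1) ca(2) c(2)]
  have "ext_d N \<omega> w [v0, v1] =
    fd (\<lambda>z. comps \<omega> C z (v1 C)) (snd C w) (v0 C) - fd (\<lambda>z. comps \<omega> C z (v0 C)) (snd C w) (v1 C)"
    by (rule ext_d_at[OF pointsI[OF c] C_def]) (simp add: comps_def)
  then show ?thesis
    using fd_comps_change[OF \<omega> ca(1) c(1) ca(2) c(2)]
      fd_transition_commute[OF ca(1) c(1) ca(2) c(2), of "v0 C" "v1 C"] by (simp add: ch)
qed

lemma ext_d_cong:
  assumes "eq_form N k \<omega> \<eta>" "u \<in> points N" "length vs = Suc k"
  shows "ext_d N \<omega> u vs = ext_d N \<eta> u vs"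
proof -
  define C where "C = chart_at N u"
  note ca = chart_at[OF assms(2), folded C_def]
  have "fd (\<lambda>z. \<omega> (chart_inv C z) (map (\<lambda>v. local_ext N u v (chart_inv C z)) ws)) (snd C u) =
    fd (\<lambda>z. \<eta> (chart_inv C z) (map (\<lambda>v. local_ext N u v (chart_inv C z)) ws)) (snd C u)"
    if "length ws = k" for ws
  proof (rule fd_cong[OF open_image[OF ca(1)]])
    fix z assume "z \<in> snd C ` fst C"
    then obtain q where q: "q \<in> fst C" "z = snd C q" by blast
    show "\<omega> (chart_inv C z) (map (\<lambda>v. local_ext N u v (chart_inv C z)) ws) =
      \<eta> (chart_inv C z) (map (\<lambda>v. local_ext N u v (chart_inv C z)) ws)"
      using assms(1) that q ca pointsI[OF ca(1)] unfolding eq_form_def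
      by (simp add: local_ext_def image_subset_iff flip: C_def)
  qed (use ca in auto)
  note * = this
  have "fd (\<lambda>z. \<omega> (chart_inv C z) (map (\<lambda>v. local_ext N u v (chart_inv C z)) (take i vs @ drop (Suc i) vs))) (snd C u) =
    fd (\<lambda>z. \<eta> (chart_inv C z) (map (\<lambda>v. local_ext N u v (chart_inv C z)) (take i vs @ drop (Suc i) vs))) (snd C u)"
    if "i < length vs" for i
    by (rule *) (use that assms(3) in simp)
  then show ?thesis
    unfolding ext_d_def deriv_along_def comp_def C_def[symmetric] by (intro sum.cong refl) simp
qed

text \<open>
  Let \<open>Y\<close> be the extension of \<open>v\<close> used in the definition of \<open>lie_form\<close>.  The expression
  \<open>X(\<omega>(Y)) - \<omega>([X, Y])\<close> can be expanded in any chart by the Leibniz rule, and the derivatives of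
  \<open>Y\<close> cancel.
\<close>

lemma lie_form_1form:
  assumes \<omega>: "form N 1 \<omega>" and X: "vector_field N X" and c: "c \<in> N" "w \<in> fst c"
    and v: "v \<in> tangent_space N w"
  shows "lie_form N X \<omega> w [v] = fd (\<lambda>z. comps \<omega> c z (v c)) (snd c w) (X w c)
    + comps \<omega> c (snd c w) (fd (\<lambda>z. X (chart_inv c z) c) (snd c w) (v c))"
proof -
  define C where "C = chart_at N w"
  note ca = chart_at[OF pointsI[OF c], folded C_def]
  define Y where "Y = local_ext N w v"
  have Y: "local_field w Y" "Y w = v"
    unfolding Y_def local_ext_def C_def[symmetric]
    by (auto intro: coord_field_local ca tangent_eq_coord_field v)
  note Xl = vector_field_local[OF X pointsI[OF c]]
  have w: "snd c w \<in> snd c ` (fst c \<inter> fst C)" using c ca by blast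
  have dY: "(\<lambda>z. Y (chart_inv c z) c) differentiable (at (snd c w))"
    using Y c unfolding local_field_def by blast
  have eq: "\<omega> (chart_inv c z) [Y (chart_inv c z)] = comps \<omega> c z (Y (chart_inv c z) c)"
    if "z \<in> snd c ` (fst c \<inter> fst C)" for z
    using that comps_eval[of "Y (chart_inv c z)" "chart_inv c z" c \<omega>] c ca
    by (auto simp: Y_def local_ext_def simp flip: C_def)
  have pair: "fd (\<lambda>z. comps \<omega> c z (Y (chart_inv c z) c)) (snd c w) e =
      fd (\<lambda>z. comps \<omega> c z (Y (chart_inv c (snd c w)) c)) (snd c w) (fd (\<lambda>z. z) (snd c w) e)
      + comps \<omega> c (snd c w) (fd (\<lambda>z. Y (chart_inv c z) c) (snd c w) e)"
    "(\<lambda>z. comps \<omega> c z (Y (chart_inv c z) c)) differentiable (at (snd c w))" for e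
    by (rule fd_pairing[where V = "snd c ` fst c" and f = "\<lambda>z. z" and B = "comps \<omega> c"
          and g = "\<lambda>z. Y (chart_inv c z) c"];
        use open_image[OF c(1)] comps_linear[OF \<omega> c(1)] comps_differentiable[OF \<omega> c] c dY in simp)+
  have d: "(\<lambda>z. \<omega> (chart_inv c z) [Y (chart_inv c z)]) differentiable (at (snd c w))"
    using differentiable_cong[OF open_overlap[OF c(1) ca(1)] w, of "\<lambda>z. \<omega> (chart_inv c z) [Y (chart_inv c z)]"
        "\<lambda>z. comps \<omega> c z (Y (chart_inv c z) c)"] eq pair(2) by simp
  have fdeq: "fd (\<lambda>z. \<omega> (chart_inv c z) [Y (chart_inv c z)]) (snd c w)
      = fd (\<lambda>z. comps \<omega> c z (Y (chart_inv c z) c)) (snd c w)"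
    by (rule fd_cong[OF open_overlap[OF c(1) ca(1)] w]) (rule eq)
  have "lie_form N X \<omega> w [v] = deriv_along N w (X w) (\<lambda>q. \<omega> q [Y q]) - \<omega> w [bracket N X Y w]"
    by (simp add: lie_form_def Y_def)
  also have "deriv_along N w (X w) (\<lambda>q. \<omega> q [Y q]) =
      fd (\<lambda>z. comps \<omega> c z (v c)) (snd c w) (X w c)
      + comps \<omega> c (snd c w) (fd (\<lambda>z. Y (chart_inv c z) c) (snd c w) (X w c))"
    using deriv_along_eq[OF c local_field_tangent[OF Xl] d] c by (simp add: fdeq pair(1) Y(2))
  also have "\<omega> w [bracket N X Y w] = comps \<omega> c (snd c w)
      (fd (\<lambda>z. Y (chart_inv c z) c) (snd c w) (X w c) - fd (\<lambda>z. X (chart_inv c z) c) (snd c w) (v c))"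
    by (simp add: comps_eval[OF bracket_tangent[OF Xl Y(1)] c] bracket_apply[OF c] Y(2))
  finally show ?thesis
    using linear_diff[OF comps_linear[OF \<omega> c(1)], of "snd c w"] c by simp
qed

lemma ext_d_0form:
  assumes "form N 0 \<eta>" "c \<in> N" "w \<in> fst c" "v \<in> tangent_space N w"
  shows "ext_d N \<eta> w [v] = fd (\<lambda>z. \<eta> (chart_inv c z) []) (snd c w) (v c)"
proof -
  have "smooth_on (snd c ` fst c) (\<lambda>z. \<eta> (chart_inv c z) [])"
    using assms(1,2) unfolding form_def by (auto dest!: bspec spec[of _ "[]"])
  then have "(\<lambda>z. \<eta> (chart_inv c z) []) differentiable (at (snd c w))"
    using assms by (auto intro: smooth_on_differentiable)
  then show ?thesis using deriv_along_eq[OF assms(2-4)] by (simp add: ext_d_def)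
qed

lemma exact_closed:
  assumes "exact_form N 1 \<omega>" shows "closed_form N 1 \<omega>"
proof -
  obtain \<eta> where \<eta>: "form N 0 \<eta>" "eq_form N 1 \<omega> (ext_d N \<eta>)"
    using assms unfolding exact_form_def by auto
  have "ext_d N \<omega> u [v0, v1] = 0" if u: "u \<in> points N" for u v0 v1
  proof -
    define C where "C = chart_at N u"
    note ca = chart_at[OF u, folded C_def]
    have sm: "smooth_on (snd C ` fst C) (\<lambda>z. \<eta> (chart_inv C z) [])"
      using \<eta>(1) ca(1) unfolding form_def by (auto dest!: bspec spec[of _ "[]"])
    have "ext_d N \<omega> u [v0, v1] = ext_d N (ext_d N \<eta>) u [v0, v1]"
      by (rule ext_d_cong[OF \<eta>(2) u]) simp
    also have "\<dots> = fd (\<lambda>z. fd (\<lambda>z. \<eta> (chart_inv C z) []) z (v1 C)) (snd C u) (v0 C)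
        - fd (\<lambda>z. fd (\<lambda>z. \<eta> (chart_inv C z) []) z (v0 C)) (snd C u) (v1 C)"
    proof (rule ext_d_at[OF u C_def])
      fix z e assume "z \<in> snd C ` fst C"
      then obtain q where q: "q \<in> fst C" "z = snd C q" by blast
      show "ext_d N \<eta> (chart_inv C z) [coord_field N C e (chart_inv C z)] = fd (\<lambda>z. \<eta> (chart_inv C z) []) z e"
        using ext_d_0form[OF \<eta>(1) ca(1) q(1)] q ca by simp
    qed
    also have "\<dots> = 0"
      using fd_commute[OF open_image[OF ca(1)] _ sm] ca(2) by simp
    finally show ?thesis .
  qed
  then show ?thesis
    by (auto simp: closed_form_def eq_form_def zero_form_def length_Suc_conv)
qed

lemma form_0I:
  assumes "\<And>c. c \<in> N \<Longrightarrow> smooth_on (snd c ` fst c) (\<lambda>z. \<eta> (chart_inv c z) [])"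
  shows "form N 0 \<eta>"
  using assms by (simp add: form_def)

lemma inner_form_0form:
  assumes \<omega>: "form N 1 \<omega>" and X: "vector_field N X"
  shows "form N 0 (inner_form X \<omega>)"
proof (rule form_0I)
  fix c assume c: "c \<in> N"
  have "smooth_on (snd c ` fst c) (\<lambda>z. \<Sum>b\<in>Basis. (X (chart_inv c z) c \<bullet> b) *\<^sub>R comps \<omega> c z b)"
  proof (rule smooth_on_sum[OF open_image[OF c] finite_Basis])
    fix b :: 'e
    have "smooth_on (snd c ` fst c) (\<lambda>z. X (chart_inv c z) c)"
      using X c unfolding vector_field_def by blast
    then have "smooth_on (snd c ` fst c) (\<lambda>z. X (chart_inv c z) c \<bullet> b)"
      by (rule smooth_on_bounded_linear[OF open_image[OF c] bounded_linear_inner_left])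
    then show "smooth_on (snd c ` fst c) (\<lambda>z. (X (chart_inv c z) c \<bullet> b) *\<^sub>R comps \<omega> c z b)"
      by (rule smooth_on_scaleR[OF open_image[OF c] _ comps_smooth[OF \<omega> c]])
  qed
  moreover have "(\<Sum>b\<in>Basis. (X (chart_inv c z) c \<bullet> b) *\<^sub>R comps \<omega> c z b) = inner_form X \<omega> (chart_inv c z) []"
    if z: "z \<in> snd c ` fst c" for z
  proof -
    obtain q where q: "q \<in> fst c" "z = snd c q" using z by blast
    have "X q \<in> tangent_space N q" using X pointsI[OF c q(1)] unfolding vector_field_def by blast
    then have "inner_form X \<omega> (chart_inv c z) [] = comps \<omega> c (snd c q) (X q c)"
      using comps_eval[of "X q" q c \<omega>] q(1) c by (simp add: inner_form_def q(2))
    also have "\<dots> = comps \<omega> c z (\<Sum>b\<in>Basis. (X q c \<bullet> b) *\<^sub>R b)"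
      by (simp only: q(2) euclidean_representation)
    also have "\<dots> = (\<Sum>b\<in>Basis. comps \<omega> c z ((X q c \<bullet> b) *\<^sub>R b))"
      by (rule linear_sum[OF comps_linear[OF \<omega> c z]])
    also have "\<dots> = (\<Sum>b\<in>Basis. (X (chart_inv c z) c \<bullet> b) *\<^sub>R comps \<omega> c z b)"
      using q(1) c by (simp only: linear_scale[OF comps_linear[OF \<omega> c z], unfolded q(2)] q(2) chart_inv_apply)
    finally show ?thesis by (rule sym)
  qed
  ultimately show "smooth_on (snd c ` fst c) (\<lambda>z. inner_form X \<omega> (chart_inv c z) [])"
    by (rule smooth_on_cong[OF open_image[OF c], rotated])
qed

end

section \<open>The coordinate calculation\<close>

text \<open>
  What remains of a spray and a semi-basic homogeneous one-form in one induced chart with image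
  \<open>U\<close>.  The assumption \<open>spray\<close> is \<open>[\<C>, S] = S\<close>, written out for \<open>\<C> = (0, y)\<close>.
\<close>

locale spray_coordinates =
  fixes U :: "('f::euclidean_space \<times> 'f) set" and S :: "'f \<times> 'f \<Rightarrow> 'f \<times> 'f"
    and th :: "'f \<times> 'f \<Rightarrow> 'f \<times> 'f \<Rightarrow> real" and k :: real
  assumes open_U: "open U"
    and S_smooth: "smooth_on U S"
    and fst_S: "z \<in> U \<Longrightarrow> fst (S z) = snd z"
    and spray: "z \<in> U \<Longrightarrow> fd S z (0, snd z) - (0, snd (S z)) = S z"
    and th_linear: "z \<in> U \<Longrightarrow> linear (th z)"
    and th_smooth: "smooth_on U (\<lambda>z. th z X)"
    and th_vertical: "z \<in> U \<Longrightarrow> th z (0, b) = 0"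
    and th_homogeneous: "z \<in> U \<Longrightarrow> fd (\<lambda>z. th z X) z (0, snd z) = (k - 1) * th z X"
begin

text \<open>
  The covector \<open>\<theta>\<^sub>i\<close> on the base, its first and second derivatives, half the vertical
  derivative of the force \<open>s\<close> (the nonlinear connection up to sign), and the components of \<open>\<L>\<^sub>S\<theta>\<close>.
\<close>

definition cov where "cov z a = th z (a, 0)"
definition Dcov where "Dcov z V a = fd (\<lambda>z. cov z a) z V"
definition D2cov where "D2cov z V W a = fd (\<lambda>z. Dcov z W a) z V"
definition conn where "conn z a = (1/2) *\<^sub>R snd (fd S z (0, a))"
definition lie where "lie z X = Dcov z (S z) (fst X) + cov z (snd X)"

lemma cov_linear: assumes "z \<in> U" shows "linear (cov z)"
proof (rule linearI)
  note lin = th_linear[OF assms]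
  show "cov z (a + b) = cov z a + cov z b" for a b
    using linear_add[OF lin, of "(a, 0)" "(b, 0)"] by (simp add: cov_def)
  show "cov z (r *\<^sub>R a) = r *\<^sub>R cov z a" for r a
    using linear_scale[OF lin, of r "(a, 0)"] by (simp add: cov_def)
qed

lemma th_eq_cov: assumes "z \<in> U" shows "th z X = cov z (fst X)"
  using linear_add[OF th_linear[OF assms], of "(fst X, 0)" "(0, snd X)"] th_vertical[OF assms]
  by (simp add: cov_def)

lemma cov_smooth: "smooth_on U (\<lambda>z. cov z a)" unfolding cov_def by (rule th_smooth)

lemma cov_differentiable: "z \<in> U \<Longrightarrow> (\<lambda>z. cov z a) differentiable (at z)"
  by (rule smooth_on_differentiable[OF cov_smooth])

lemma fd_th: "z \<in> U \<Longrightarrow> fd (\<lambda>z. th z X) z V = Dcov z V (fst X)"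
  unfolding Dcov_def by (subst fd_cong[OF open_U, of z "\<lambda>z. th z X" "\<lambda>z. cov z (fst X)"]) (auto simp: th_eq_cov)

lemma Dcov_linear: assumes "z \<in> U" shows "linear (\<lambda>V. Dcov z V a)"
  unfolding Dcov_def by (rule fd_linear[OF cov_differentiable[OF assms]])

lemma Dcov_linear_right: assumes z: "z \<in> U" shows "linear (Dcov z V)"
proof (rule linearI)
  note d = cov_differentiable[OF z]
  show "Dcov z V (a + b) = Dcov z V a + Dcov z V b" for a b
  proof -
    have "fd (\<lambda>z. cov z (a + b)) z = fd (\<lambda>z. cov z a + cov z b) z"
      by (rule fd_cong[OF open_U z]) (rule linear_add[OF cov_linear])
    then show ?thesis unfolding Dcov_def by (simp only: fd_add[OF d d])
  qed
  show "Dcov z V (r *\<^sub>R a) = r *\<^sub>R Dcov z V a" for r a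
  proof -
    have "fd (\<lambda>z. cov z (r *\<^sub>R a)) z = fd (\<lambda>z. r * cov z a) z"
      by (rule fd_cong[OF open_U z]) (use linear_scale[OF cov_linear] in simp)
    then show ?thesis unfolding Dcov_def by (simp only: fd_cmult[OF d] real_scaleR_def)
  qed
qed

lemma Dcov_smooth: "smooth_on U (\<lambda>z. Dcov z V a)"
  unfolding Dcov_def by (rule smooth_on_fd[OF cov_smooth])

lemma Dcov_differentiable: "z \<in> U \<Longrightarrow> (\<lambda>z. Dcov z V a) differentiable (at z)"
  by (rule smooth_on_differentiable[OF Dcov_smooth])

lemma D2cov_commute: "z \<in> U \<Longrightarrow> D2cov z V W a = D2cov z W V a"
  unfolding D2cov_def Dcov_def by (rule fd_commute_real[OF open_U _ cov_smooth])

lemma D2cov_linear: "z \<in> U \<Longrightarrow> linear (\<lambda>V. D2cov z V W a)"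
  unfolding D2cov_def by (rule fd_linear[OF Dcov_differentiable])

lemma D2cov_linear_mid: 
  assumes z: "z \<in> U" shows "linear (\<lambda>W. D2cov z V W a)"
  unfolding D2cov_commute[OF z, of V] by (rule D2cov_linear[OF z])

lemma D2cov_zero: "z \<in> U \<Longrightarrow> D2cov z V W 0 = 0"
proof -
  assume z: "z \<in> U"
  have "D2cov z V W 0 = fd (\<lambda>z. 0) z V" unfolding D2cov_def
    by (subst fd_cong[OF open_U z, of _ "\<lambda>z. 0"]) (auto simp: linear_0[OF Dcov_linear_right])
  then show ?thesis by simp
qed

lemma S_differentiable: "z \<in> U \<Longrightarrow> S differentiable (at z)"
  by (rule smooth_on_differentiable[OF S_smooth])

lemma fst_fd_S: assumes z: "z \<in> U" shows "fst (fd S z X) = snd X"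
proof -
  have "fst (fd S z X) = fd (\<lambda>z. fst (S z)) z X"
    by (simp add: fd_bounded_linear[OF bounded_linear_fst S_differentiable[OF z]])
  also have "\<dots> = fd snd z X"
    by (subst fd_cong[OF open_U z, of _ snd]) (auto simp: fst_S)
  also have "\<dots> = snd X"
    by (simp add: fd_eqI[OF bounded_linear_imp_has_derivative[OF bounded_linear_snd]])
  finally show ?thesis .
qed

lemma S_eq: "z \<in> U \<Longrightarrow> S z = (snd z, snd (S z))"
  by (simp add: prod_eq_iff fst_S)

lemma conn_linear: assumes z: "z \<in> U" shows "linear (conn z)"
proof (rule linearI)
  note lin = fd_linear[OF S_differentiable[OF z]]
  show "conn z (a + b) = conn z a + conn z b" for a b
    using linear_add[OF lin, of "(0, a)" "(0, b)"] by (simp add: conn_def scaleR_add_right)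
  show "conn z (r *\<^sub>R a) = r *\<^sub>R conn z a" for r a
    using linear_scale[OF lin, of r "(0, a)"] by (simp add: conn_def)
qed

lemma conn_y: assumes z: "z \<in> U" shows "conn z (snd z) = snd (S z)"
proof -
  have "snd (fd S z (0, snd z)) = 2 *\<^sub>R snd (S z)"
    using arg_cong[OF spray[OF z], of snd] by (simp add: algebra_simps scaleR_2)
  then show ?thesis by (simp add: conn_def)
qed

lemma conn_differentiable: "z \<in> U \<Longrightarrow> (\<lambda>z. conn z a) differentiable (at z)"
  unfolding conn_def
  using smooth_on_differentiable[OF smooth_on_bounded_linear[OF open_U
        bounded_linear_compose[OF bounded_linear_scaleR_right bounded_linear_snd] smooth_on_fd[OF S_smooth]]]
  by blast

lemma fd_S_vertical: "z \<in> U \<Longrightarrow> fd S z (0, d) = (d, 2 *\<^sub>R conn z d)"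
  using fst_fd_S[of z "(0, d)"] by (simp add: conn_def prod_eq_iff)

lemma Dcov_homogeneous: "z \<in> U \<Longrightarrow> Dcov z (0, snd z) a = (k - 1) * cov z a"
  using th_homogeneous[of z "(a, 0)"] by (simp add: fd_th) (simp add: cov_def)

lemma fd_Dcov_along:
  assumes z: "z \<in> U" and g: "g differentiable (at z)"
  shows "fd (\<lambda>z. Dcov z (g z) a) z V = D2cov z V (g z) a + Dcov z (fd g z V) a"
  unfolding D2cov_def
  using fd_pairing(1)[OF open_U, of "\<lambda>z. z" z "\<lambda>z W. Dcov z W a" g V] z g Dcov_linear Dcov_differentiable by simp

text \<open>
  The homogeneity relation holds on an open set, so it may be differentiated.
\<close>

lemma D2cov_homogeneous:
  assumes z: "z \<in> U"
  shows "D2cov z V (0, snd z) a + Dcov z (0, snd V) a = (k - 1) * Dcov z V a"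
proof -
  have bl: "bounded_linear (\<lambda>z :: 'f \<times> 'f. (0 :: 'f, snd z))"
    by (intro bounded_linear_Pair bounded_linear_zero bounded_linear_snd)
  have d: "(\<lambda>z. (0 :: 'f, snd z)) differentiable (at z)"
    by (rule bounded_linear_imp_differentiable[OF bl])
  have "fd (\<lambda>z. (0 :: 'f, snd z)) z V = (0, snd V)"
    by (simp add: fd_eqI[OF bounded_linear_imp_has_derivative[OF bl]])
  then have "D2cov z V (0, snd z) a + Dcov z (0, snd V) a = fd (\<lambda>z. Dcov z (0, snd z) a) z V"
    using fd_Dcov_along[OF z d, of a V] by simp
  also have "\<dots> = fd (\<lambda>z. (k - 1) * cov z a) z V"
    by (subst fd_cong[OF open_U z, of _ "\<lambda>z. (k - 1) * cov z a"]) (auto simp: Dcov_homogeneous)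
  also have "\<dots> = (k - 1) * Dcov z V a"
    unfolding Dcov_def by (rule fd_cmult[OF cov_differentiable[OF z]])
  finally show ?thesis .
qed

lemma lie_eq: "z \<in> U \<Longrightarrow> fd (\<lambda>z. th z X) z (S z) + th z (fd S z X) = lie z X"
  by (simp add: lie_def fd_th th_eq_cov fst_fd_S)

lemma fd_lie:
  assumes z: "z \<in> U"
  shows "fd (\<lambda>z. lie z X) z V = D2cov z V (S z) (fst X) + Dcov z (fd S z V) (fst X) + Dcov z V (snd X)"
proof -
  have "(\<lambda>z. Dcov z (S z) (fst X)) differentiable (at z)"
    using fd_pairing(2)[OF open_U, of "\<lambda>z. z" z "\<lambda>z W. Dcov z W (fst X)" S] z
      S_differentiable Dcov_linear Dcov_differentiable by simp
  then show ?thesis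
    unfolding lie_def
    using fd_add[OF _ cov_differentiable[OF z], of "\<lambda>z. Dcov z (S z) (fst X)" "snd X" V]
      fd_Dcov_along[OF z S_differentiable[OF z], of "fst X" V] by (simp add: Dcov_def)
qed

lemma fd_contraction:
  assumes z: "z \<in> U" shows "fd (\<lambda>z. cov z (snd z)) z X = Dcov z X (snd z) + cov z (snd X)"
proof -
  have "fd snd z X = snd X"
    by (simp add: fd_eqI[OF bounded_linear_imp_has_derivative[OF bounded_linear_snd]])
  moreover have "(snd :: 'f \<times> 'f \<Rightarrow> 'f) differentiable (at z)"
    by (rule bounded_linear_imp_differentiable[OF bounded_linear_snd])
  ultimately show ?thesis
    using fd_pairing(1)[OF open_U, of "\<lambda>z. z" z cov snd X] z cov_linear cov_differentiable by (simp add: Dcov_def)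
qed

text \<open>
  In the notation \<open>g(b, c) = Dcov z (0, b) c\<close>: the first condition is \<open>d\<^sub>J\<theta> = 0\<close>, the next two are
  \<open>d\<L>\<^sub>S\<theta> = 0\<close> and \<open>k \<L>\<^sub>S\<theta> = d i\<^sub>S\<theta>\<close>, then comes the \<open>dx\<and>dy\<close> part of \<open>d\<L>\<^sub>S\<theta> = 0\<close>, and the last
  two are \<open>d\<^sub>h\<theta> = 0\<close> and \<open>\<nabla>g = 0\<close>.
\<close>

definition vertical_symmetric where "vertical_symmetric z \<longleftrightarrow> (\<forall>b c. Dcov z (0, b) c = Dcov z (0, c) b)"
definition lie_closed where "lie_closed z \<longleftrightarrow> (\<forall>X Y. fd (\<lambda>z. lie z Y) z X = fd (\<lambda>z. lie z X) z Y)"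
definition lie_potential where "lie_potential z \<longleftrightarrow> (\<forall>X. k * lie z X = fd (\<lambda>z. cov z (snd z)) z X)"
definition mixed_condition where
  "mixed_condition z \<longleftrightarrow> (\<forall>a d. Dcov z (a, 0) d = D2cov z (S z) (0, d) a + Dcov z (d, 0) a + 2 * Dcov z (0, conn z d) a)"
definition horizontal_symmetric where "horizontal_symmetric z \<longleftrightarrow> (\<forall>a c. Dcov z (a, conn z a) c = Dcov z (c, conn z c) a)"
definition vertical_parallel where
  "vertical_parallel z \<longleftrightarrow> (\<forall>b c. D2cov z (S z) (0, b) c + Dcov z (0, conn z b) c + Dcov z (0, b) (conn z c) = 0)"

lemma Dcov_split: "z \<in> U \<Longrightarrow> Dcov z (a, b) c = Dcov z (a, 0) c + Dcov z (0, b) c"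
  using linear_add[OF Dcov_linear[of z c], of "(a,0)" "(0,b)"] by simp

lemma Dcov_vscale: "z \<in> U \<Longrightarrow> Dcov z (0, r *\<^sub>R b) c = r * Dcov z (0, b) c"
  using linear_scale[OF Dcov_linear[of z c], of r "(0,b)"] by simp

text \<open>
  Evaluate \<open>d\<L>\<^sub>S\<theta>\<close> on two vertical vectors, and on one vertical and one coordinate vector of the
  base.
\<close>

lemma lie_closed_imp:
  assumes z: "z \<in> U" and cl: "lie_closed z"
  shows "vertical_symmetric z" "mixed_condition z"
proof -
  have 1: "D2cov z X (S z) (fst Y) + Dcov z (fd S z X) (fst Y) + Dcov z X (snd Y) =
    D2cov z Y (S z) (fst X) + Dcov z (fd S z Y) (fst X) + Dcov z Y (snd X)" for X Y
    using cl unfolding lie_closed_def fd_lie[OF z] by blast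
  note zero = D2cov_zero[OF z] linear_0[OF Dcov_linear_right[OF z]]
  show "vertical_symmetric z" unfolding vertical_symmetric_def
    using 1[of "(0,b)" "(0,c)" for b c] by (simp add: zero)
  show "mixed_condition z" unfolding mixed_condition_def
  proof (intro allI)
    fix a d
    show "Dcov z (a, 0) d = D2cov z (S z) (0, d) a + Dcov z (d, 0) a + 2 * Dcov z (0, conn z d) a"
      using 1[of "(a,0)" "(0,d)"] D2cov_commute[OF z, of "(0,d)" "S z" a] Dcov_split[OF z, of d "2 *\<^sub>R conn z d" a]
      by (simp add: zero fd_S_vertical[OF z] Dcov_vscale[OF z])
  qed
qed

lemma potential_vertical:
  assumes z: "z \<in> U" and "vertical_symmetric z" shows "k * cov z b = Dcov z (0, b) (snd z) + cov z b"
  using assms(2) Dcov_homogeneous[OF z, of b] unfolding vertical_symmetric_def by (simp add: algebra_simps)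

lemma lie_potentialI:
  assumes z: "z \<in> U" and "vertical_symmetric z" and "\<And>a. k * Dcov z (S z) a = Dcov z (a, 0) (snd z)"
  shows "lie_potential z"
  unfolding lie_potential_def
proof
  fix X
  show "k * lie z X = fd (\<lambda>z. cov z (snd z)) z X"
    using assms(3)[of "fst X"] potential_vertical[OF assms(1,2), of "snd X"] Dcov_split[OF z, of "fst X" "snd X" "snd z"]
    by (simp add: fd_contraction[OF z] lie_def algebra_simps)
qed

text \<open>
  Put \<open>d = y\<close> in the mixed condition.  Homogeneity evaluates the second-derivative term, and
  \<open>n y = s\<close> completes the remaining terms to multiples of the derivative along \<open>S\<close>.
\<close>

lemma mixed_imp_lie_potential:
  assumes z: "z \<in> U" and "vertical_symmetric z" and "mixed_condition z" shows "lie_potential z"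
proof (rule lie_potentialI[OF z \<open>vertical_symmetric z\<close>])
  fix a
  have "Dcov z (a, 0) (snd z) = D2cov z (S z) (0, snd z) a + Dcov z (snd z, 0) a + 2 * Dcov z (0, snd (S z)) a"
    using assms(3)[unfolded mixed_condition_def, rule_format, of a "snd z"] unfolding conn_y[OF z] .
  moreover have "Dcov z (S z) a = Dcov z (snd z, 0) a + Dcov z (0, snd (S z)) a"
    by (subst S_eq[OF z]) (rule Dcov_split[OF z])
  ultimately show "k * Dcov z (S z) a = Dcov z (a, 0) (snd z)"
    using D2cov_homogeneous[OF z, of "S z" a] by (simp add: algebra_simps)
qed

text \<open>
  The horizontal lift of \<open>y\<close> is \<open>S\<close> itself, so horizontal symmetry for the pair \<open>y, a\<close> computes
  \<open>S(\<theta>(a))\<close>; the vertical contribution \<open>g(y, n a)\<close> vanishes for \<open>k = 1\<close>.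
\<close>

lemma horizontal_imp_lie_potential:
  assumes z: "z \<in> U" and "vertical_symmetric z" and "horizontal_symmetric z" and "k = 1" shows "lie_potential z"
proof (rule lie_potentialI[OF z \<open>vertical_symmetric z\<close>])
  fix a
  have "Dcov z (snd z, conn z (snd z)) a = Dcov z (a, conn z a) (snd z)"
    using assms(3) unfolding horizontal_symmetric_def by blast
  then have "Dcov z (S z) a = Dcov z (a, conn z a) (snd z)"
    unfolding conn_y[OF z] S_eq[OF z, symmetric] .
  also have "\<dots> = Dcov z (a, 0) (snd z) + Dcov z (0, snd z) (conn z a)"
    using assms(2) Dcov_split[OF z, of a "conn z a"] unfolding vertical_symmetric_def by simp
  finally show "k * Dcov z (S z) a = Dcov z (a, 0) (snd z)"
    by (simp add: Dcov_homogeneous[OF z] \<open>k = 1\<close>)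
qed

text \<open>
  Symmetry of \<open>g\<close> on the whole open set passes to the derivatives of \<open>g\<close>.
\<close>

lemma D2cov_sym:
  assumes z: "z \<in> U" and "\<And>z. z \<in> U \<Longrightarrow> vertical_symmetric z"
  shows "D2cov z V (0, b) c = D2cov z V (0, c) b"
  unfolding D2cov_def
  by (subst fd_cong[OF open_U z, of _ "\<lambda>z. Dcov z (0, c) b"]) (use assms(2) in \<open>auto simp: vertical_symmetric_def\<close>)

text \<open>
  When the mixed conditions for \<open>a, d\<close> and for \<open>d, a\<close> are added, the derivatives along the base
  cancel and twice \<open>\<nabla>g = 0\<close> is left; given this, the condition reduces to horizontal symmetry.
\<close>

lemma mixed_iff:
  assumes z: "z \<in> U" and sym: "\<And>z. z \<in> U \<Longrightarrow> vertical_symmetric z"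
  shows "mixed_condition z \<longleftrightarrow> horizontal_symmetric z \<and> vertical_parallel z"
proof
  assume "mixed_condition z"
  then have m: "Dcov z (a, 0) d = D2cov z (S z) (0, d) a + Dcov z (d, 0) a + 2 * Dcov z (0, conn z d) a" for a d
    unfolding mixed_condition_def by blast
  have g: "Dcov z (0, b) c = Dcov z (0, c) b" for b c using sym[OF z] unfolding vertical_symmetric_def by blast
  have par: "D2cov z (S z) (0, b) c + Dcov z (0, conn z b) c + Dcov z (0, b) (conn z c) = 0" for b c
    using m[of b c] m[of c b] D2cov_sym[OF z sym, of "S z" b c] g[of b "conn z c"] by linarith
  moreover have "Dcov z (a, conn z a) c = Dcov z (c, conn z c) a" for a c
    using m[of a c] par[of c a] g[of c "conn z a"] Dcov_split[OF z, of a "conn z a" c] Dcov_split[OF z, of c "conn z c" a]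
    by linarith
  ultimately show "horizontal_symmetric z \<and> vertical_parallel z" unfolding horizontal_symmetric_def vertical_parallel_def by blast
next
  assume hp: "horizontal_symmetric z \<and> vertical_parallel z"
  show "mixed_condition z" unfolding mixed_condition_def
  proof (intro allI)
    fix a d
    have "Dcov z (a, 0) d + Dcov z (0, conn z a) d = Dcov z (d, 0) a + Dcov z (0, conn z d) a"
      using hp unfolding horizontal_symmetric_def Dcov_split[OF z, symmetric] by blast
    moreover have "D2cov z (S z) (0, d) a + Dcov z (0, conn z d) a + Dcov z (0, conn z a) d = 0"
      using hp sym[OF z] unfolding vertical_parallel_def vertical_symmetric_def by metis
    ultimately show "Dcov z (a, 0) d = D2cov z (S z) (0, d) a + Dcov z (d, 0) a + 2 * Dcov z (0, conn z d) a"
      by simp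
  qed
qed

text \<open>
  The derivative of the connection along \<open>S\<close>, the covariant derivative of a constant
  field, and the two-forms \<open>d\<theta>\<close> and \<open>\<nabla>d\<theta>\<close>.
\<close>

definition S_conn where "S_conn z a = fd (\<lambda>z. conn z a) z (S z)"
definition nabla_coord where "nabla_coord z X = (- conn z (fst X), - S_conn z (fst X) - conn z (snd X))"
definition d_coord where "d_coord z X Y = Dcov z X (fst Y) - Dcov z Y (fst X)"
definition nabla_d_coord where
  "nabla_d_coord z X Y = D2cov z (S z) X (fst Y) - D2cov z (S z) Y (fst X) - d_coord z (nabla_coord z X) Y - d_coord z X (nabla_coord z Y)"

lemma horizontal_derivative:
  assumes z: "z \<in> U" and h: "\<And>z. z \<in> U \<Longrightarrow> horizontal_symmetric z"
  shows "D2cov z (S z) (a, conn z a) c + Dcov z (0, S_conn z a) c = D2cov z (S z) (c, conn z c) a + Dcov z (0, S_conn z c) a"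
proof -
  have *: "fd (\<lambda>z. Dcov z (a, conn z a) c) z (S z) = D2cov z (S z) (a, conn z a) c + Dcov z (0, S_conn z a) c" for a c
  proof -
    have hd: "((\<lambda>z. (a, conn z a)) has_derivative (\<lambda>V. (0, fd (\<lambda>z. conn z a) z V))) (at z)"
      by (intro has_derivative_Pair has_derivative_const fd_has_derivative conn_differentiable z)
    then have "(\<lambda>z. (a, conn z a)) differentiable (at z)" unfolding differentiable_def by blast
    from fd_Dcov_along[OF z this] show ?thesis by (simp add: fd_eqI[OF hd] S_conn_def)
  qed
  show ?thesis
    unfolding *[symmetric]
    by (subst fd_cong[OF open_U z, of _ "\<lambda>z. Dcov z (c, conn z c) a"]) (use h in \<open>auto simp: horizontal_symmetric_def\<close>)
qed

text \<open>
  The component of \<open>\<nabla>d\<theta>\<close> on a vertical vector and a vector of the base is \<open>\<nabla>g\<close>.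
\<close>

lemma nabla_d_imp_parallel:
  assumes z: "z \<in> U" and "\<And>X Y. nabla_d_coord z X Y = 0" shows "vertical_parallel z"
  unfolding vertical_parallel_def
proof (intro allI)
  fix b c
  have lin: "Dcov z (0, - b) c = - Dcov z (0, b) c" "Dcov z V (- b) = - Dcov z V b" for V b c
    using linear_neg[OF Dcov_linear[OF z], of "(0,b)" c] linear_neg[OF Dcov_linear_right[OF z]] by auto
  have S_conn0: "S_conn z 0 = 0"
  proof -
    have "S_conn z 0 = fd (\<lambda>z. 0) z (S z)" unfolding S_conn_def
      by (subst fd_cong[OF open_U z, of _ "\<lambda>z. 0"]) (auto simp: linear_0[OF conn_linear])
    then show ?thesis by simp
  qed
  show "D2cov z (S z) (0, b) c + Dcov z (0, conn z b) c + Dcov z (0, b) (conn z c) = 0"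
    using assms(2)[of "(0,b)" "(c,0)"]
    by (simp add: nabla_d_coord_def d_coord_def nabla_coord_def S_conn0 lin linear_0[OF conn_linear[OF z]] D2cov_zero[OF z]
        linear_0[OF Dcov_linear_right[OF z]])
qed

text \<open>
  Write each vector as a horizontal lift plus a vertical vector.  The vertical-horizontal
  components are \<open>\<nabla>g\<close>; in the horizontal-horizontal ones all that survives is the
  derivative along \<open>S\<close> of the identity \<open>d\<^sub>h\<theta> = 0\<close>.
\<close>

lemma parallel_imp_nabla_d:
  assumes z: "z \<in> U" and sym: "vertical_symmetric z" and h: "\<And>z. z \<in> U \<Longrightarrow> horizontal_symmetric z" and par: "vertical_parallel z"
  shows "nabla_d_coord z X Y = 0"
proof -
  obtain a b where X: "X = (a, b)" by (cases X)
  obtain c d where Y: "Y = (c, d)" by (cases Y)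
  \<comment> \<open>Every expression is expanded in the vertical derivative \<open>g\<close>, the horizontal derivative \<open>H\<close>, and the
    derivative \<open>P\<close> of the latter along \<open>S\<close> without the contribution of the connection.\<close>
  define g where "g b c = Dcov z (0, b) c" for b c
  define P where "P a c = D2cov z (S z) (a, conn z a) c" for a c
  define H where "H a c = Dcov z (a, conn z a) c" for a c
  have gsym: "g b c = g c b" for b c using sym unfolding g_def vertical_symmetric_def by blast
  have g_diff: "g (b - b') c = g b c - g b' c" for b b' c
    using linear_diff[OF Dcov_linear[OF z], of "(0,b)" "(0,b')" c] by (simp add: g_def)
  have Dcov_neg: "Dcov z V (- c) = - Dcov z V c" for V c
    by (rule linear_neg[OF Dcov_linear_right[OF z]])
  have Dcov_H: "Dcov z (a, b) c = H a c + g b c - g (conn z a) c" for a b c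
    using linear_add[OF Dcov_linear[OF z], of "(a, conn z a)" "(0, b - conn z a)" c]
    by (simp add: H_def flip: g_def) (simp add: g_diff)
  have H_sym: "H a c = H c a" for a c using h[OF z] unfolding horizontal_symmetric_def H_def by blast
  have H_neg: "H (- a) c = - H a c" for a c
    unfolding H_sym[of _ c] unfolding H_def by (rule Dcov_neg)
  have par': "D2cov z (S z) (0, b) c = - g (conn z b) c - g b (conn z c)" for b c
    using par[unfolded vertical_parallel_def, rule_format, of b c] unfolding g_def by linarith
  note conn = linear_diff[OF conn_linear[OF z]] linear_neg[OF conn_linear[OF z]]
  have D2_P: "D2cov z (S z) (a, b) c = P a c - g (conn z b) c + g (conn z (conn z a)) c - g b (conn z c) + g (conn z a) (conn z c)" for a b c
    using linear_add[OF D2cov_linear_mid[OF z], of "S z" "(a, conn z a)" "(0, b - conn z a)" c]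
    by (simp add: P_def par' conn g_diff)
  have P: "P a c + g (S_conn z a) c = P c a + g (S_conn z c) a"
    using horizontal_derivative[OF z h] unfolding P_def g_def by blast
  have Dcov_nab: "Dcov z (nabla_coord z (a, b)) c = - H (conn z a) c - g (S_conn z a) c - g (conn z b) c + g (conn z (conn z a)) c" for a b c
  proof -
    have "g (- S_conn z a - conn z b) c = - g (S_conn z a) c - g (conn z b) c"
      using g_diff[of 0 "S_conn z a" c] g_diff[of "- S_conn z a" "conn z b" c] linear_0[OF Dcov_linear[OF z], of c]
      by (simp add: g_def flip: zero_prod_def)
    moreover have "g (- conn z (conn z a)) c = - g (conn z (conn z a)) c"
      using g_diff[of 0 "conn z (conn z a)" c] linear_0[OF Dcov_linear[OF z], of c] by (simp add: g_def flip: zero_prod_def)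
    ultimately show ?thesis by (simp add: nabla_coord_def Dcov_H H_neg conn)
  qed
  have Dcov_fst: "Dcov z (a, b) (fst (nabla_coord z (c, d))) = - H a (conn z c) - g b (conn z c) + g (conn z a) (conn z c)" for a b c d
    by (simp add: nabla_coord_def Dcov_neg Dcov_H)
  show ?thesis
    unfolding nabla_d_coord_def d_coord_def X Y fst_conv D2_P Dcov_nab Dcov_fst
    using P gsym[of "conn z c" "conn z a"] H_sym[of c "conn z a"] H_sym[of a "conn z c"] by linarith
qed

end

section \<open>The slit tangent bundle as a smooth atlas\<close>

lemma smooth_manifold_atlas:
  assumes "smooth_manifold T A" shows "smooth_atlas A"
proof
  fix c assume c: "c \<in> A"
  have U: "openin T (fst c)" and V: "open (snd c ` fst c)"
    and hom: "homeomorphic_map (subtopology T (fst c)) (top_of_set (snd c ` fst c)) (snd c)"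
    using assms c unfolding smooth_manifold_def by blast+
  have top: "topspace (subtopology T (fst c)) = fst c"
    using openin_subset[OF U] by auto
  show "inj_on (snd c) (fst c)"
    using homeomorphic_imp_injective_map[OF hom] unfolding top .
  fix c' assume c': "c' \<in> A"
  have "openin T (fst c')" using assms c' unfolding smooth_manifold_def by blast
  then have "openin (subtopology T (fst c)) (fst c \<inter> fst c')"
    by (metis inf_commute openin_subtopology)
  then have "openin (top_of_set (snd c ` fst c)) (snd c ` (fst c \<inter> fst c'))"
    using homeomorphic_imp_open_map[OF hom] unfolding open_map_def by blast
  then show "open (snd c ` (fst c \<inter> fst c'))"
    using V openin_open_eq by blast
  show "smooth_on (snd c ` (fst c \<inter> fst c')) (transition c c')"
    using assms c c' unfolding smooth_manifold_def by blast
qed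

locale base_atlas = base: smooth_atlas A for A :: "('a, 'e::euclidean_space) chart set"
begin

lemma slit_chart_mem:
  "u \<in> fst (slit_chart A c) \<longleftrightarrow> fst u \<in> fst c \<and> snd u \<in> tangent_space A (fst u) \<and> snd u \<noteq> (\<lambda>_. 0)"
  by (auto simp: slit_chart_def)

lemma slit_chart_apply: "snd (slit_chart A c) u = (snd c (fst u), snd u c)"
  by (simp add: slit_chart_def case_prod_beta)

lemma slit_fibre_nonzero:
  assumes "c \<in> A" "u \<in> fst (slit_chart A c)" shows "snd u c \<noteq> 0"
proof
  assume 0: "snd u c = 0"
  have u: "fst u \<in> fst c" "snd u \<in> tangent_space A (fst u)" "snd u \<noteq> (\<lambda>_. 0)"
    using assms(2) by (auto simp: slit_chart_mem)
  have "coord_field A c 0 (fst u) c' = 0" for c'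
    using linear_0[OF base.smooth_transition_all(3)[OF assms(1) _ u(1)]] by (auto simp: coord_field_def)
  then have "snd u = (\<lambda>_. 0)"
    using base.tangent_eq_coord_field[OF u(2) assms(1) u(1)] unfolding 0 by auto
  with u(3) show False by blast
qed

lemma slit_overlap:
  assumes c: "c \<in> A" "c' \<in> A"
  shows "snd (slit_chart A c) ` (fst (slit_chart A c) \<inter> fst (slit_chart A c'))
    = snd c ` (fst c \<inter> fst c') \<times> (UNIV - {0 :: 'e})"
proof (intro equalityI subsetI)
  fix z assume "z \<in> snd (slit_chart A c) ` (fst (slit_chart A c) \<inter> fst (slit_chart A c'))"
  then obtain u where u: "u \<in> fst (slit_chart A c)" "u \<in> fst (slit_chart A c')" "z = snd (slit_chart A c) u"
    by blast
  then have "fst u \<in> fst c \<inter> fst c'" by (simp add: slit_chart_mem)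
  then show "z \<in> snd c ` (fst c \<inter> fst c') \<times> (UNIV - {0 :: 'e})"
    unfolding u(3) slit_chart_apply using slit_fibre_nonzero[OF c(1) u(1)] by blast
next
  fix z assume "z \<in> snd c ` (fst c \<inter> fst c') \<times> (UNIV - {0 :: 'e})"
  then obtain q e where q: "q \<in> fst c" "q \<in> fst c'" "z = (snd c q, e)" "e \<noteq> 0" by blast
  define u where "u = (q, coord_field A c e q)"
  have "coord_field A c e q c \<noteq> 0" using q c by simp
  then have nz: "coord_field A c e q \<noteq> (\<lambda>_. 0)" by auto
  then have "u \<in> fst (slit_chart A c) \<inter> fst (slit_chart A c')" "z = snd (slit_chart A c) u"
    using q c nz by (simp_all add: u_def slit_chart_mem slit_chart_apply)
  then show "z \<in> snd (slit_chart A c) ` (fst (slit_chart A c) \<inter> fst (slit_chart A c'))" by blast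
qed

lemma slit_chart_inj:
  assumes c: "c \<in> A" shows "inj_on (snd (slit_chart A c)) (fst (slit_chart A c))"
proof (rule inj_onI)
  fix u v assume uv: "u \<in> fst (slit_chart A c)" "v \<in> fst (slit_chart A c)"
    "snd (slit_chart A c) u = snd (slit_chart A c) v"
  then have m: "fst u \<in> fst c" "fst v \<in> fst c" "snd u \<in> tangent_space A (fst u)"
    "snd v \<in> tangent_space A (fst v)" and e: "snd c (fst u) = snd c (fst v)" "snd u c = snd v c"
    by (simp_all add: slit_chart_mem slit_chart_apply)
  have f: "fst u = fst v" by (rule inj_onD[OF base.inj_chart[OF c] e(1) m(1,2)])
  have "snd u = coord_field A c (snd u c) (fst u)"
    by (rule base.tangent_eq_coord_field[OF m(3) c m(1), symmetric])
  also have "\<dots> = coord_field A c (snd v c) (fst v)" by (simp only: e f)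
  also have "\<dots> = snd v" by (rule base.tangent_eq_coord_field[OF m(4) c m(2)])
  finally have "snd u = snd v" .
  with f show "u = v" by (simp add: prod_eq_iff)
qed

lemma slit_transition:
  assumes c: "c \<in> A" "c' \<in> A" and z: "z \<in> snd c ` (fst c \<inter> fst c') \<times> (UNIV - {0})"
  shows "transition (slit_chart A c) (slit_chart A c') z
    = (transition c c' (fst z), fd (transition c c') (fst z) (snd z))"
proof -
  obtain u where u: "u \<in> fst (slit_chart A c)" "u \<in> fst (slit_chart A c')" "z = snd (slit_chart A c) u"
    using z unfolding slit_overlap[OF c, symmetric] by blast
  have m: "fst u \<in> fst c" "fst u \<in> fst c'" "snd u \<in> tangent_space A (fst u)"
    using u by (auto simp: slit_chart_mem)
  have "transition (slit_chart A c) (slit_chart A c') z = snd (slit_chart A c') u"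
    unfolding u(3) transition_def o_def chart_inv_def by (simp add: slit_chart_inj[OF c(1)] u(1))
  also have "\<dots> = (snd c' (fst u), base.jac c c' (fst u) (snd u c))"
    using base.tangent_change[OF m(3) c m(1,2)] by (simp add: slit_chart_apply)
  finally show ?thesis using m c u(3) by (simp add: slit_chart_apply)
qed

text \<open>
  The fibre component \<open>D\<tau>(x) y\<close> is smooth because it is a sum of products of the coordinates of
  \<open>y\<close> and the smooth functions \<open>x \<mapsto> D\<tau>(x) b\<close> for basis vectors \<open>b\<close>.
\<close>

lemma slit_smooth_atlas: "smooth_atlas (slit_atlas A)"
proof
  fix C assume "C \<in> slit_atlas A"
  then obtain c where c: "c \<in> A" "C = slit_chart A c" unfolding slit_atlas_def by blast
  show "inj_on (snd C) (fst C)" using slit_chart_inj c by blast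
  fix C' assume "C' \<in> slit_atlas A"
  then obtain c' where c': "c' \<in> A" "C' = slit_chart A c'" unfolding slit_atlas_def by blast
  let ?O = "snd c ` (fst c \<inter> fst c')"
  have O: "open ?O" by (rule base.open_overlap[OF c(1) c'(1)])
  have eq: "snd C ` (fst C \<inter> fst C') = ?O \<times> (UNIV - {0})"
    unfolding c c' by (rule slit_overlap[OF c(1) c'(1)])
  have op: "open (?O \<times> (UNIV - {0 :: 'e}))" by (intro open_Times O) auto
  show "open (snd C ` (fst C \<inter> fst C'))" unfolding eq by (rule op)
  have oU: "open (?O \<times> (UNIV :: 'e set))" by (intro open_Times O open_UNIV)
  have tr: "smooth_on ?O (transition c c')" by (rule base.smooth_transition[OF c(1) c'(1)])
  have 1: "smooth_on (?O \<times> UNIV) (\<lambda>z :: 'e \<times> 'e. (transition c c' (fst z), 0 :: 'e))"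
    by (rule smooth_on_bounded_linear[OF oU _ smooth_on_compose_fst[OF O tr]])
      (intro bounded_linear_Pair bounded_linear_ident bounded_linear_zero)
  have 2: "smooth_on (?O \<times> UNIV) (\<lambda>z :: 'e \<times> 'e. \<Sum>b\<in>Basis. (snd z \<bullet> b) *\<^sub>R fd (transition c c') (fst z) b)"
  proof (rule smooth_on_sum[OF oU finite_Basis])
    fix b :: 'e
    show "smooth_on (?O \<times> UNIV) (\<lambda>z :: 'e \<times> 'e. (snd z \<bullet> b) *\<^sub>R fd (transition c c') (fst z) b)"
      by (rule smooth_on_scaleR[OF oU
            smooth_on_linear[OF oU bounded_linear_compose[OF bounded_linear_inner_left bounded_linear_snd]]
            smooth_on_compose_fst[OF O smooth_on_fd[OF tr]]])
  qed
  have 3: "smooth_on (?O \<times> UNIV) (\<lambda>z :: 'e \<times> 'e. (0 :: 'e, \<Sum>b\<in>Basis. (snd z \<bullet> b) *\<^sub>R fd (transition c c') (fst z) b))"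
    by (rule smooth_on_bounded_linear[OF oU _ 2])
      (intro bounded_linear_Pair bounded_linear_ident bounded_linear_zero)
  have 4: "smooth_on (?O \<times> (UNIV - {0})) (\<lambda>z :: 'e \<times> 'e. (transition c c' (fst z), 0)
      + (0, \<Sum>b\<in>Basis. (snd z \<bullet> b) *\<^sub>R fd (transition c c') (fst z) b))"
    by (rule smooth_on_subset[OF smooth_on_add[OF oU 1 3]]) auto
  show "smooth_on (snd C ` (fst C \<inter> fst C')) (transition C C')"
    unfolding eq
  proof (rule smooth_on_cong[OF op _ 4])
    fix z assume z: "z \<in> ?O \<times> (UNIV - {0 :: 'e})"
    then have lin: "linear (fd (transition c c') (fst z))"
      using base.smooth_transition_all(3)[OF c(1) c'(1)] by auto
    have "fd (transition c c') (fst z) (snd z) = fd (transition c c') (fst z) (\<Sum>b\<in>Basis. (snd z \<bullet> b) *\<^sub>R b)"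
      by (simp only: euclidean_representation)
    also have "\<dots> = (\<Sum>b\<in>Basis. (snd z \<bullet> b) *\<^sub>R fd (transition c c') (fst z) b)"
      by (simp only: linear_sum[OF lin] linear_scale[OF lin])
    finally show "(transition c c' (fst z), 0) + (0, \<Sum>b\<in>Basis. (snd z \<bullet> b) *\<^sub>R fd (transition c c') (fst z) b)
        = transition C C' z"
      using slit_transition[OF c(1) c'(1) z] by (simp add: c(2) c'(2))
  qed
qed

sublocale slit: smooth_atlas "slit_atlas A" by (rule slit_smooth_atlas)

lemma slit_jacobian:
  assumes c: "c \<in> A" "c' \<in> A" and u: "u \<in> fst (slit_chart A c)" "u \<in> fst (slit_chart A c')"
  shows "slit.jac (slit_chart A c) (slit_chart A c') u V =
    (base.jac c c' (fst u) (fst V),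
     fd (\<lambda>x. fd (transition c c') x (snd u c)) (snd c (fst u)) (fst V) + base.jac c c' (fst u) (snd V))"
proof -
  let ?O = "snd c ` (fst c \<inter> fst c')" and ?z = "snd (slit_chart A c) u"
  have m: "fst u \<in> fst c" "fst u \<in> fst c'" using u by (auto simp: slit_chart_mem)
  have O: "open ?O" by (rule base.open_overlap[OF c])
  have op: "open (?O \<times> (UNIV - {0 :: 'e}))" by (intro open_Times O) auto
  have z: "?z \<in> ?O \<times> (UNIV - {0})" unfolding slit_overlap[OF c, symmetric] using u by blast
  have z': "?z = (snd c (fst u), snd u c)" by (rule slit_chart_apply)
  have dfst: "(fst :: 'e \<times> 'e \<Rightarrow> 'e) differentiable (at ?z)" "(snd :: 'e \<times> 'e \<Rightarrow> 'e) differentiable (at ?z)"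
    by (auto intro: bounded_linear_imp_differentiable bounded_linear_fst bounded_linear_snd)
  have ffst: "fd (fst :: 'e \<times> 'e \<Rightarrow> 'e) ?z = fst" "fd (snd :: 'e \<times> 'e \<Rightarrow> 'e) ?z = snd"
    by (auto intro!: fd_eqI bounded_linear_imp_has_derivative bounded_linear_fst bounded_linear_snd)
  have 1: "((\<lambda>z :: 'e \<times> 'e. transition c c' (fst z)) has_derivative (\<lambda>V. base.jac c c' (fst u) (fst V))) (at ?z)"
    using has_derivative_compose[OF bounded_linear_imp_has_derivative[OF bounded_linear_fst], of "transition c c'"
        "base.jac c c' (fst u)" ?z UNIV] fd_has_derivative[OF base.smooth_transition_all(1)[OF c m]] z' by simp
  have 2: "((\<lambda>z. fd (transition c c') (fst z) (snd z)) has_derivative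
      (\<lambda>V. fd (\<lambda>x. fd (transition c c') x (snd ?z)) (fst ?z) (fd fst ?z V)
        + fd (transition c c') (fst ?z) (fd snd ?z V))) (at ?z)"
  proof (rule has_derivative_pairing[where V = ?O and f = fst and g = snd and B = "fd (transition c c')"])
    fix x assume "x \<in> ?O" then show "linear (fd (transition c c') x)"
      using base.smooth_transition_all(3)[OF c] by auto
  next
    fix e show "(\<lambda>x. fd (transition c c') x e) differentiable (at (fst ?z))"
      using base.smooth_transition_all(2)[OF c m] by (simp add: z')
  qed (use O z dfst in auto)
  have "fd (transition (slit_chart A c) (slit_chart A c')) ?z
      = fd (\<lambda>z. (transition c c' (fst z), fd (transition c c') (fst z) (snd z))) ?z"
    by (rule fd_cong[OF op z]) (rule slit_transition[OF c])
  then show ?thesis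
    using fd_eqI[OF has_derivative_Pair[OF 1 2[unfolded ffst]]] by (simp add: z')
qed

lemma liouville_apply: "C \<in> slit_atlas A \<Longrightarrow> u \<in> fst C \<Longrightarrow> liouville A u C = (0, snd (snd C u))"
  by (simp add: liouville_def)

lemma liouville_vector_field: "vector_field (slit_atlas A) (liouville A)"
  unfolding vector_field_def
proof (intro conjI ballI)
  fix u assume "u \<in> points (slit_atlas A)"
  show "liouville A u \<in> tangent_space (slit_atlas A) u"
    unfolding tangent_space_def
  proof (intro CollectI conjI allI impI ballI)
    fix C assume "\<not> (C \<in> slit_atlas A \<and> u \<in> fst C)"
    then show "liouville A u C = 0" by (auto simp: liouville_def)
  next
    fix C C' assume C: "C \<in> slit_atlas A" "C' \<in> slit_atlas A" "u \<in> fst C" "u \<in> fst C'"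
    obtain c c' where c: "c \<in> A" "C = slit_chart A c" "c' \<in> A" "C' = slit_chart A c'"
      using C(1,2) unfolding slit_atlas_def by blast
    have m: "fst u \<in> fst c" "fst u \<in> fst c'" "snd u \<in> tangent_space A (fst u)"
      using C c by (auto simp: slit_chart_mem)
    have u: "u \<in> fst (slit_chart A c)" "u \<in> fst (slit_chart A c')" using C c by auto
    have lin: "linear (fd (\<lambda>x. fd (transition c c') x (snd u c)) (snd c (fst u)))"
      by (rule fd_linear[OF base.smooth_transition_all(2)[OF c(1,3) m(1,2)]])
    show "liouville A u C' = slit.jac C C' u (liouville A u C)"
      unfolding liouville_apply[OF C(1,3)] liouville_apply[OF C(2,4)]
      unfolding c(2,4) slit_jacobian[OF c(1,3) u]
      using base.tangent_change[OF m(3) c(1,3) m(1,2)]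
      by (simp add: slit_chart_apply linear_0[OF lin] linear_0[OF base.smooth_transition_all(3)[OF c(1,3) m(1,2)]])
  qed
next
  fix C assume C: "C \<in> slit_atlas A"
  have bl: "bounded_linear (\<lambda>z :: 'e \<times> 'e. (0 :: 'e, snd z))"
    by (intro bounded_linear_Pair bounded_linear_zero bounded_linear_snd)
  show "smooth_on (snd C ` fst C) (\<lambda>z. liouville A (chart_inv C z) C)"
  proof (rule smooth_on_cong[OF slit.open_image[OF C] _ smooth_on_linear[OF slit.open_image[OF C] bl]])
    fix z assume "z \<in> snd C ` fst C"
    then obtain u where u: "u \<in> fst C" "z = snd C u" by blast
    show "(0, snd z) = liouville A (chart_inv C z) C"
      using u C by (simp add: liouville_apply)
  qed
qed

lemma tangent_structure_tangent:
  assumes "\<xi> \<in> tangent_space (slit_atlas A) u"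
  shows "tangent_structure u \<xi> \<in> tangent_space (slit_atlas A) u"
  unfolding tangent_space_def
proof (intro CollectI conjI allI impI ballI)
  fix C assume "\<not> (C \<in> slit_atlas A \<and> u \<in> fst C)"
  then have "\<xi> C = 0" using assms unfolding tangent_space_def by blast
  then show "tangent_structure u \<xi> C = 0" by (simp add: tangent_structure_def zero_prod_def)
next
  fix C C' assume C: "C \<in> slit_atlas A" "C' \<in> slit_atlas A" "u \<in> fst C" "u \<in> fst C'"
  obtain c c' where c: "c \<in> A" "C = slit_chart A c" "c' \<in> A" "C' = slit_chart A c'"
    using C(1,2) unfolding slit_atlas_def by blast
  have u: "u \<in> fst (slit_chart A c)" "u \<in> fst (slit_chart A c')" using C c by auto
  then have m: "fst u \<in> fst c" "fst u \<in> fst c'" by (auto simp: slit_chart_mem)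
  have lin: "linear (fd (\<lambda>x. fd (transition c c') x (snd u c)) (snd c (fst u)))"
    by (rule fd_linear[OF base.smooth_transition_all(2)[OF c(1,3) m(1,2)]])
  have "\<xi> C' = slit.jac C C' u (\<xi> C)" by (rule slit.tangent_change[OF assms C])
  then have "fst (\<xi> C') = base.jac c c' (fst u) (fst (\<xi> C))"
    unfolding c(2,4) slit_jacobian[OF c(1,3) u] by simp
  then show "tangent_structure u \<xi> C' = slit.jac C C' u (tangent_structure u \<xi> C)"
    unfolding tangent_structure_def c(2,4) slit_jacobian[OF c(1,3) u]
    by (simp add: linear_0[OF lin] linear_0[OF base.smooth_transition_all(3)[OF c(1,3) m(1,2)]])
qed

text \<open>
  The differential of the projection reads off the base component, and the base components in
  two charts differ by the Jacobian of the base transition.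
\<close>

lemma verticalI:
  assumes \<xi>: "\<xi> \<in> tangent_space (slit_atlas A) u" and C: "C \<in> slit_atlas A" "u \<in> fst C"
    and 0: "fst (\<xi> C) = 0"
  shows "\<xi> \<in> vertical_space A u"
proof -
  define C0 where "C0 = chart_at (slit_atlas A) u"
  note ca = slit.chart_at[OF slit.pointsI[OF C], folded C0_def]
  obtain c c0 where c: "c \<in> A" "C = slit_chart A c" "c0 \<in> A" "C0 = slit_chart A c0"
    using C(1) ca(1) unfolding slit_atlas_def by blast
  have u: "u \<in> fst (slit_chart A c)" "u \<in> fst (slit_chart A c0)" using C ca c by auto
  then have m: "fst u \<in> fst c" "fst u \<in> fst c0" by (auto simp: slit_chart_mem)
  have "\<xi> C0 = slit.jac C C0 u (\<xi> C)" by (rule slit.tangent_change[OF \<xi> C(1) ca(1) C(2) ca(2)])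
  then have "fst (\<xi> C0) = base.jac c c0 (fst u) (fst (\<xi> C))"
    unfolding c(2,4) slit_jacobian[OF c(1,3) u] by simp
  then have z0: "fst (\<xi> C0) = 0"
    unfolding 0 linear_0[OF base.smooth_transition_all(3)[OF c(1,3) m(1,2)]] .
  have "fd (snd c' \<circ> fst \<circ> chart_inv C0) (snd C0 u) (\<xi> C0) = 0" if c': "c' \<in> A" "fst u \<in> fst c'" for c'
  proof -
    let ?O = "snd c0 ` (fst c0 \<inter> fst c') \<times> (UNIV - {0 :: 'e})"
    have O: "open ?O" by (intro open_Times base.open_overlap c c') auto
    have u': "u \<in> fst (slit_chart A c')" using u(1) c' by (simp add: slit_chart_mem)
    have zu: "snd C0 u \<in> ?O" unfolding slit_overlap[OF c(3) c'(1), symmetric] c(4) using u u' by blast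
    have "fd (snd c' \<circ> fst \<circ> chart_inv C0) (snd C0 u) = fd (\<lambda>z. transition c0 c' (fst z)) (snd C0 u)"
    proof (rule fd_cong[OF O zu])
      fix z assume "z \<in> ?O"
      then obtain w where w: "w \<in> fst (slit_chart A c0)" "w \<in> fst (slit_chart A c')" "z = snd C0 w"
        unfolding slit_overlap[OF c(3) c'(1), symmetric] c(4) by blast
      have "chart_inv C0 z = w"
        unfolding w(3) by (rule slit.chart_inv_apply[OF ca(1)]) (simp only: c(4) w(1))
      then show "(snd c' \<circ> fst \<circ> chart_inv C0) z = transition c0 c' (fst z)"
        using w c by (simp add: slit_chart_mem slit_chart_apply)
    qed
    also have "\<dots> = (\<lambda>V. base.jac c0 c' (fst u) (fst V))"
    proof (rule fd_eqI)
      show "((\<lambda>z :: 'e \<times> 'e. transition c0 c' (fst z)) has_derivative (\<lambda>V. base.jac c0 c' (fst u) (fst V))) (at (snd C0 u))"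
        using has_derivative_compose[OF bounded_linear_imp_has_derivative[OF bounded_linear_fst], of "transition c0 c'"
          "base.jac c0 c' (fst u)" "snd C0 u" UNIV]
          fd_has_derivative[OF base.smooth_transition_all(1)[OF c(3) c'(1) m(2) c'(2)]]
        by (simp add: c(4) slit_chart_apply)
    qed
    finally show ?thesis
      using linear_0[OF base.smooth_transition_all(3)[OF c(3) c'(1) m(2) c'(2)]] by (simp add: z0)
  qed
  then have "differential (slit_atlas A) A fst u \<xi> = (\<lambda>_. 0)"
    unfolding differential_def C0_def[symmetric] by (intro ext) simp
  with \<xi> show ?thesis unfolding vertical_space_def by blast
qed

end

section \<open>The operators of a spray in induced coordinates\<close>

locale spray_form = base_atlas A for A :: "('a, 'e::euclidean_space) chart set" +
  fixes S :: "(('a, 'e) tm, 'e \<times> 'e) vfield" and \<theta> :: "(('a, 'e) tm, 'e \<times> 'e) dform" and k :: int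
  assumes spray: "spray A S"
    and \<theta>_form: "form (slit_atlas A) 1 \<theta>"
    and \<theta>_semi_basic: "semi_basic A \<theta>"
    and \<theta>_homogeneous: "homogeneous_form A 1 (k - 1) \<theta>"
begin

abbreviation "N \<equiv> slit_atlas A"
abbreviation "S_in C \<equiv> (\<lambda>z. S (chart_inv C z) C)"
abbreviation "\<theta>_in C \<equiv> slit.comps \<theta> C"

lemma S_field: "vector_field N S" using spray unfolding spray_def semispray_def by blast

lemma S_local: "C \<in> N \<Longrightarrow> u \<in> fst C \<Longrightarrow> slit.local_field u S"
  by (rule slit.vector_field_local[OF S_field slit.pointsI])

lemma S_tangent: "C \<in> N \<Longrightarrow> u \<in> fst C \<Longrightarrow> S u \<in> tangent_space N u"
  by (rule slit.local_field_tangent[OF S_local])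

lemma fd_liouville:
  assumes C: "C \<in> N" "u \<in> fst C"
  shows "fd (\<lambda>z. liouville A (chart_inv C z) C) (snd C u) V = (0, snd V)"
proof -
  have bl: "bounded_linear (\<lambda>z :: 'e \<times> 'e. (0 :: 'e, snd z))"
    by (intro bounded_linear_Pair bounded_linear_zero bounded_linear_snd)
  have "fd (\<lambda>z. liouville A (chart_inv C z) C) (snd C u) = fd (\<lambda>z :: 'e \<times> 'e. (0 :: 'e, snd z)) (snd C u)"
    by (rule fd_cong[OF slit.open_image[OF C(1)]]) (use C in \<open>auto simp: liouville_apply\<close>)
  then show ?thesis by (simp add: fd_eqI[OF bounded_linear_imp_has_derivative[OF bl]])
qed

text \<open>
  Semi-basicity and homogeneity are translated into coordinates: the vectors with vanishing base component
  are vertical, and the bracket of the Liouville field with a coordinate field is vertical, hence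
  invisible to \<open>\<theta>\<close>.
\<close>

lemma spray_coordinates_chart:
  assumes C: "C \<in> N"
  shows "spray_coordinates (snd C ` fst C) (S_in C) (\<theta>_in C) (real_of_int k)"
proof (rule spray_coordinates.intro)
  show "open (snd C ` fst C)" by (rule slit.open_image[OF C])
  show "smooth_on (snd C ` fst C) (S_in C)" using S_field C unfolding vector_field_def by blast
  show "smooth_on (snd C ` fst C) (\<lambda>z. \<theta>_in C z X)" for X by (rule slit.comps_smooth[OF \<theta>_form C])
  fix z assume z: "z \<in> snd C ` fst C"
  then obtain u where u: "u \<in> fst C" "z = snd C u" by blast
  note uN = slit.pointsI[OF C u(1)]
  show "linear (\<theta>_in C z)" by (rule slit.comps_linear[OF \<theta>_form C z])
  have "tangent_structure u (S u) C = liouville A u C"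
    using spray uN unfolding spray_def semispray_def eq_vfield_def tensor_app_def by metis
  then show "fst (S_in C z) = snd z"
    using C u by (simp add: tangent_structure_def liouville_apply)
  have "bracket N (liouville A) S u C = S u C"
    using spray uN unfolding spray_def eq_vfield_def by metis
  then show "fd (S_in C) z (0, snd z) - (0, snd (S_in C z)) = S_in C z"
    using C u by (simp add: slit.bracket_apply fd_liouville liouville_apply)
  show vert: "\<theta>_in C z (0, b) = 0" for b
  proof -
    have "coord_field N C (0, b) u \<in> vertical_space A u"
      by (rule verticalI[OF _ C u(1)]) (use C u in auto)
    then have "\<theta> u [coord_field N C (0, b) u] = 0"
      using \<theta>_semi_basic uN unfolding semi_basic_def by blast
    then show ?thesis using C u by (simp add: slit.comps_def)
  qed
  show "fd (\<lambda>z. \<theta>_in C z X) z (0, snd z) = (real_of_int k - 1) * \<theta>_in C z X" for X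
  proof -
    let ?v = "coord_field N C X u"
    have v: "?v \<in> tangent_space N u" "?v C = X" using C u by auto
    have "lie_form N (liouville A) \<theta> u [?v] = real_of_int (k - 1) * \<theta> u [?v]"
      using \<theta>_homogeneous uN v(1) unfolding homogeneous_form_def eq_form_def scale_form_def by simp
    also have "lie_form N (liouville A) \<theta> u [?v] = fd (\<lambda>z. \<theta>_in C z X) z (0, snd z)"
      unfolding slit.lie_form_1form[OF \<theta>_form liouville_vector_field C u(1) v(1)] v(2)
        fd_liouville[OF C u(1)] liouville_apply[OF C u(1)]
      using vert by (simp add: u(2))
    also have "\<theta> u [?v] = \<theta>_in C z X"
      using slit.comps_eval[OF v(1) C u(1), of \<theta>] by (simp only: v(2) u(2))
    finally show ?thesis by simp
  qed
qed

abbreviation "lie C \<equiv> spray_coordinates.lie (S_in C) (\<theta>_in C)"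
abbreviation "d_coord C \<equiv> spray_coordinates.d_coord (\<theta>_in C)"
abbreviation "Dcov C \<equiv> spray_coordinates.Dcov (\<theta>_in C)"
abbreviation "conn C \<equiv> spray_coordinates.conn (S_in C)"
abbreviation "nabla_coord C \<equiv> spray_coordinates.nabla_coord (S_in C)"
abbreviation "nabla_d_coord C \<equiv> spray_coordinates.nabla_d_coord (S_in C) (\<theta>_in C)"
abbreviation "vertical_symmetric C \<equiv> spray_coordinates.vertical_symmetric (\<theta>_in C)"
abbreviation "horizontal_symmetric C \<equiv> spray_coordinates.horizontal_symmetric (S_in C) (\<theta>_in C)"
abbreviation "lie_closed C \<equiv> spray_coordinates.lie_closed (S_in C) (\<theta>_in C)"
abbreviation "lie_potential C \<equiv> spray_coordinates.lie_potential (S_in C) (\<theta>_in C) (real_of_int k)"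

lemma lie_form_in_chart:
  assumes C: "C \<in> N" "w \<in> fst C" and \<xi>: "\<xi> \<in> tangent_space N w"
  shows "lie_form N S \<theta> w [\<xi>] = lie C (snd C w) (\<xi> C)"
proof -
  interpret L: spray_coordinates "snd C ` fst C" "S_in C" "\<theta>_in C" "real_of_int k"
    by (rule spray_coordinates_chart[OF C(1)])
  show ?thesis
    using slit.lie_form_1form[OF \<theta>_form S_field C \<xi>] L.lie_eq[of "snd C w" "\<xi> C"] C by simp
qed

lemma ext_d_in_chart:
  assumes C: "C \<in> N" "w \<in> fst C" and "\<xi> \<in> tangent_space N w" "\<zeta> \<in> tangent_space N w"
  shows "ext_d N \<theta> w [\<xi>, \<zeta>] = d_coord C (snd C w) (\<xi> C) (\<zeta> C)"
proof -
  interpret L: spray_coordinates "snd C ` fst C" "S_in C" "\<theta>_in C" "real_of_int k"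
    by (rule spray_coordinates_chart[OF C(1)])
  have "snd C w \<in> snd C ` fst C" using C by blast
  then show ?thesis
    using slit.ext_d_1form[OF \<theta>_form assms] by (simp only: L.fd_th L.d_coord_def)
qed

lemma ext_d_in_chart_at:
  assumes u: "u \<in> points N" and C_def: "C = chart_at N u"
  shows "ext_d N \<theta> u [\<xi>, \<zeta>] = d_coord C (snd C u) (\<xi> C) (\<zeta> C)"
proof -
  note C = slit.chart_at[OF u, folded C_def]
  interpret L: spray_coordinates "snd C ` fst C" "S_in C" "\<theta>_in C" "real_of_int k"
    by (rule spray_coordinates_chart[OF C(1)])
  have z: "snd C u \<in> snd C ` fst C" using C by blast
  have "ext_d N \<theta> u [\<xi>, \<zeta>] = fd (\<lambda>z. \<theta>_in C z (\<zeta> C)) (snd C u) (\<xi> C) - fd (\<lambda>z. \<theta>_in C z (\<xi> C)) (snd C u) (\<zeta> C)"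
    by (rule slit.ext_d_at[OF u C_def]) (simp only: slit.comps_def)
  then show ?thesis by (simp only: L.fd_th[OF z] L.d_coord_def)
qed

lemma local_ext_field:
  assumes "C \<in> N" "w \<in> fst C" shows "slit.local_field w (local_ext N w \<xi>)"
proof -
  note ca = slit.chart_at[OF slit.pointsI[OF assms]]
  show ?thesis unfolding local_ext_def by (rule slit.coord_field_local[OF ca])
qed

lemma local_ext_tangent:
  assumes "C \<in> N" "w \<in> fst C" "\<xi> \<in> tangent_space N w" shows "local_ext N w \<xi> w = \<xi>"
proof -
  note ca = slit.chart_at[OF slit.pointsI[OF assms(1,2)]]
  show ?thesis unfolding local_ext_def by (rule slit.tangent_eq_coord_field[OF assms(3) ca])
qed

lemma local_field_tangent_structure:
  assumes "slit.local_field w Y" shows "slit.local_field w (tensor_app tangent_structure Y)"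
proof -
  have bl: "bounded_linear (\<lambda>v :: 'e \<times> 'e. (0 :: 'e, fst v))"
    by (intro bounded_linear_Pair bounded_linear_zero bounded_linear_fst)
  have "(\<lambda>z. tensor_app tangent_structure Y (chart_inv C z) C) differentiable (at (snd C w))"
    if "(\<lambda>z. Y (chart_inv C z) C) differentiable (at (snd C w))" for C
    unfolding tensor_app_def tangent_structure_def by (rule differentiable_bounded_linear[OF bl that])
  moreover have "tensor_app tangent_structure Y q \<in> tangent_space N q" if "Y q \<in> tangent_space N q" for q
    unfolding tensor_app_def by (rule tangent_structure_tangent[OF that])
  ultimately show ?thesis using assms unfolding slit.local_field_def by blast
qed

text \<open>
  The tensor \<open>\<L>\<^sub>S J\<close> depends on the extension of \<open>\<xi>\<close> only through its value, as the derivatives of the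
  extension cancel.  Therefore the extension chosen at \<open>w\<close> may be used in every chart.
\<close>

lemma lie_tensor_in_chart:
  assumes C: "C \<in> N" "w \<in> fst C" and \<xi>: "local_ext N w \<xi> w C = \<xi> C"
  shows "lie_tensor N S tangent_structure w \<xi> C
    = (- fst (\<xi> C), snd (\<xi> C) - 2 *\<^sub>R conn C (snd C w) (fst (\<xi> C)))"
proof -
  interpret L: spray_coordinates "snd C ` fst C" "S_in C" "\<theta>_in C" "real_of_int k"
    by (rule spray_coordinates_chart[OF C(1)])
  define Y where "Y = local_ext N w \<xi>"
  let ?z = "snd C w"
  have z: "?z \<in> snd C ` fst C" using C by blast
  have bl: "bounded_linear (\<lambda>v :: 'e \<times> 'e. (0 :: 'e, fst v))"
    by (intro bounded_linear_Pair bounded_linear_zero bounded_linear_fst)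
  have "(\<lambda>z. Y (chart_inv C z) C) differentiable (at ?z)"
    using local_ext_field[OF C, of \<xi>] C unfolding Y_def slit.local_field_def by blast
  then have "fd (\<lambda>z. tensor_app tangent_structure Y (chart_inv C z) C) ?z V = (0, fst (fd (\<lambda>z. Y (chart_inv C z) C) ?z V))" for V
    unfolding tensor_app_def tangent_structure_def by (rule fd_bounded_linear[OF bl])
  then show ?thesis
    using \<xi> L.fd_S_vertical[OF z] L.fst_fd_S[OF z]
    by (simp add: lie_tensor_def tlin_def slit.bracket_apply[OF C] tangent_structure_def
        tensor_app_def prod_eq_iff flip: Y_def)
qed

text \<open>
  The hypothesis on \<open>\<xi>\<close> covers two cases: tangent vectors in an arbitrary chart, and arbitrary
  families of components in the chart chosen at \<open>w\<close>.
\<close>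

lemma projectors_in_chart:
  assumes C: "C \<in> N" "w \<in> fst C" and \<xi>: "local_ext N w \<xi> w C = \<xi> C"
  shows "hproj A S w \<xi> C = (fst (\<xi> C), conn C (snd C w) (fst (\<xi> C)))"
    and "vproj A S w \<xi> C = (0, snd (\<xi> C) - conn C (snd C w) (fst (\<xi> C)))"
  using lie_tensor_in_chart[OF assms]
  by (simp_all add: hproj_def vproj_def tlin_def prod_eq_iff scaleR_diff_right flip: scaleR_left_distrib)

lemma hproj_in_chart:
  assumes C: "C \<in> N" "w \<in> fst C" and \<xi>: "\<xi> \<in> tangent_space N w"
  shows "hproj A S w \<xi> C = (fst (\<xi> C), conn C (snd C w) (fst (\<xi> C)))"
  by (rule projectors_in_chart(1)[OF C]) (simp only: local_ext_tangent[OF C \<xi>])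

lemma vproj_in_chart:
  assumes C: "C \<in> N" "w \<in> fst C" and \<xi>: "\<xi> \<in> tangent_space N w"
  shows "vproj A S w \<xi> C = (0, snd (\<xi> C) - conn C (snd C w) (fst (\<xi> C)))"
  by (rule projectors_in_chart(2)[OF C]) (simp only: local_ext_tangent[OF C \<xi>])

lemma hproj_tangent:
  assumes C: "C \<in> N" "w \<in> fst C" and \<xi>: "\<xi> \<in> tangent_space N w"
  shows "hproj A S w \<xi> \<in> tangent_space N w"
  unfolding hproj_def lie_tensor_def
  by (intro slit.tlin_tangent \<xi> tangent_structure_tangent slit.bracket_tangent S_local[OF C]
      local_field_tangent_structure local_ext_field[OF C])

lemma \<theta>_fst:
  assumes C: "C \<in> N" "w \<in> fst C" and "\<xi> \<in> tangent_space N w" "\<zeta> \<in> tangent_space N w"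
    and "fst (\<xi> C) = fst (\<zeta> C)"
  shows "\<theta> w [\<xi>] = \<theta> w [\<zeta>]"
proof -
  interpret L: spray_coordinates "snd C ` fst C" "S_in C" "\<theta>_in C" "real_of_int k"
    by (rule spray_coordinates_chart[OF C(1)])
  have z: "snd C w \<in> snd C ` fst C" using C by blast
  show ?thesis
    unfolding slit.comps_eval[OF assms(3) C] slit.comps_eval[OF assms(4) C] L.th_eq_cov[OF z] assms(5) ..
qed

lemma eq_form_1I:
  assumes "\<And>u C \<xi>. C \<in> N \<Longrightarrow> u \<in> fst C \<Longrightarrow> \<xi> \<in> tangent_space N u \<Longrightarrow> \<omega> u [\<xi>] = \<eta> u [\<xi>]"
  shows "eq_form N 1 \<omega> \<eta>"
  unfolding eq_form_def
proof (intro ballI allI impI)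
  fix u vs assume u: "u \<in> points N" and vs: "set vs \<subseteq> tangent_space N u" "length vs = 1"
  then obtain \<xi> where "vs = [\<xi>]" "\<xi> \<in> tangent_space N u" by (auto simp: length_Suc_conv)
  then show "\<omega> u vs = \<eta> u vs" using assms[OF slit.chart_at[OF u]] by blast
qed

lemma eq_form_1D:
  "eq_form N 1 \<omega> \<eta> \<Longrightarrow> u \<in> points N \<Longrightarrow> \<xi> \<in> tangent_space N u \<Longrightarrow> \<omega> u [\<xi>] = \<eta> u [\<xi>]"
  unfolding eq_form_def by simp

text \<open>
  For semi-basic \<open>\<theta>\<close> one has \<open>i\<^sub>h\<theta> = \<theta>\<close> and \<open>i\<^sub>J\<theta> = 0\<close>, so that \<open>d\<^sub>h\<theta>\<close> and \<open>d\<^sub>J\<theta>\<close> are algebraic in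
  \<open>d\<theta>\<close>.
\<close>

lemma i_hproj_\<theta>: "eq_form N 1 (i_tensor (hproj A S) \<theta>) \<theta>"
proof (rule eq_form_1I)
  fix u C \<xi> assume a: "C \<in> N" "u \<in> fst C" "\<xi> \<in> tangent_space N u"
  have "\<theta> u [hproj A S u \<xi>] = \<theta> u [\<xi>]"
    by (rule \<theta>_fst[OF a(1,2) hproj_tangent[OF a] a(3)]) (simp add: hproj_in_chart[OF a])
  then show "i_tensor (hproj A S) \<theta> u [\<xi>] = \<theta> u [\<xi>]" by (simp add: i_tensor_def)
qed

lemma i_tangent_structure_\<theta>: "eq_form N 1 (i_tensor tangent_structure \<theta>) zero_form"
proof (rule eq_form_1I)
  fix u C \<xi> assume a: "C \<in> N" "u \<in> fst C" "\<xi> \<in> tangent_space N u"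
  have v: "tangent_structure u \<xi> \<in> vertical_space A u"
    by (rule verticalI[OF tangent_structure_tangent[OF a(3)] a(1,2)]) (simp add: tangent_structure_def)
  have "\<theta> u [tangent_structure u \<xi>] = 0"
    using \<theta>_semi_basic slit.pointsI[OF a(1,2)] v unfolding semi_basic_def by blast
  then show "i_tensor tangent_structure \<theta> u [\<xi>] = zero_form u [\<xi>]" by (simp add: i_tensor_def zero_form_def)
qed

lemma ext_d_zero: "ext_d N zero_form u [\<xi>, \<zeta>] = 0"
proof -
  have "deriv_along N u v (\<lambda>q. 0) = 0" for v
    unfolding deriv_along_def o_def by simp
  then show ?thesis by (simp add: ext_d_def zero_form_def)
qed

lemma d_hproj_in_chart:
  assumes C: "C \<in> N" "w \<in> fst C" and \<xi>: "\<xi> \<in> tangent_space N w" and \<zeta>: "\<zeta> \<in> tangent_space N w"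
  shows "d_tensor N (hproj A S) \<theta> w [\<xi>, \<zeta>] =
    Dcov C (snd C w) (fst (\<xi> C), conn C (snd C w) (fst (\<xi> C))) (fst (\<zeta> C))
    - Dcov C (snd C w) (fst (\<zeta> C), conn C (snd C w) (fst (\<zeta> C))) (fst (\<xi> C))"
proof -
  interpret L: spray_coordinates "snd C ` fst C" "S_in C" "\<theta>_in C" "real_of_int k"
    by (rule spray_coordinates_chart[OF C(1)])
  have "d_tensor N (hproj A S) \<theta> w [\<xi>, \<zeta>] = ext_d N \<theta> w [hproj A S w \<xi>, \<zeta>] + ext_d N \<theta> w [\<xi>, hproj A S w \<zeta>]
      - ext_d N \<theta> w [\<xi>, \<zeta>]"
    using slit.ext_d_cong[OF i_hproj_\<theta> slit.pointsI[OF C], of "[\<xi>, \<zeta>]"]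
    by (simp add: d_tensor_def diff_form_def i_tensor_def)
  then show ?thesis
    by (simp add: ext_d_in_chart[OF C] hproj_tangent[OF C] hproj_in_chart[OF C] \<xi> \<zeta> L.d_coord_def)
qed

lemma d_tangent_structure_in_chart:
  assumes C: "C \<in> N" "w \<in> fst C" and \<xi>: "\<xi> \<in> tangent_space N w" and \<zeta>: "\<zeta> \<in> tangent_space N w"
  shows "d_tensor N tangent_structure \<theta> w [\<xi>, \<zeta>] =
    Dcov C (snd C w) (0, fst (\<xi> C)) (fst (\<zeta> C)) - Dcov C (snd C w) (0, fst (\<zeta> C)) (fst (\<xi> C))"
proof -
  interpret L: spray_coordinates "snd C ` fst C" "S_in C" "\<theta>_in C" "real_of_int k"
    by (rule spray_coordinates_chart[OF C(1)])
  have z: "snd C w \<in> snd C ` fst C" using C by blast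
  have "d_tensor N tangent_structure \<theta> w [\<xi>, \<zeta>]
      = ext_d N \<theta> w [tangent_structure w \<xi>, \<zeta>] + ext_d N \<theta> w [\<xi>, tangent_structure w \<zeta>]"
    using slit.ext_d_cong[OF i_tangent_structure_\<theta> slit.pointsI[OF C], of "[\<xi>, \<zeta>]"] ext_d_zero
    by (simp add: d_tensor_def diff_form_def i_tensor_def)
  then show ?thesis
    by (simp add: ext_d_in_chart[OF C] tangent_structure_tangent \<xi> \<zeta> L.d_coord_def)
      (simp add: tangent_structure_def linear_0[OF L.Dcov_linear_right[OF z]])
qed

lemma eq_form_2_zero_iff:
  "eq_form N 2 \<omega> zero_form \<longleftrightarrow>
    (\<forall>u\<in>points N. \<forall>\<xi>\<in>tangent_space N u. \<forall>\<zeta>\<in>tangent_space N u. \<omega> u [\<xi>, \<zeta>] = 0)"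
  unfolding eq_form_def zero_form_def by (auto simp: numeral_2_eq_2 length_Suc_conv)

text \<open>
  A condition that is tensorial may be tested in the chart chosen at each point and then used at
  all points of an arbitrary chart, where it can be differentiated.
\<close>

lemma point_chart_iff:
  assumes "\<And>C u. C \<in> N \<Longrightarrow> u \<in> fst C \<Longrightarrow> P u \<longleftrightarrow> Q C (snd C u)"
  shows "(\<forall>u\<in>points N. P u) \<longleftrightarrow> (\<forall>C\<in>N. \<forall>z\<in>snd C ` fst C. Q C z)"
    and "(\<forall>u\<in>points N. P u) \<longleftrightarrow> (\<forall>u\<in>points N. Q (chart_at N u) (snd (chart_at N u) u))"
proof -
  show "(\<forall>u\<in>points N. P u) \<longleftrightarrow> (\<forall>C\<in>N. \<forall>z\<in>snd C ` fst C. Q C z)"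
  proof (intro iffI ballI)
    fix C z assume P: "\<forall>u\<in>points N. P u" and C: "C \<in> N" and "z \<in> snd C ` fst C"
    then obtain u where u: "u \<in> fst C" "z = snd C u" by blast
    show "Q C z" using assms[OF C u(1)] P slit.pointsI[OF C u(1)] u(2) by blast
  next
    fix u assume Q: "\<forall>C\<in>N. \<forall>z\<in>snd C ` fst C. Q C z" and u: "u \<in> points N"
    show "P u" using assms[OF slit.chart_at[OF u]] Q slit.chart_at[OF u] by blast
  qed
  show "(\<forall>u\<in>points N. P u) \<longleftrightarrow> (\<forall>u\<in>points N. Q (chart_at N u) (snd (chart_at N u) u))"
    using assms[OF slit.chart_at] by (rule ball_cong[OF refl])
qed

lemma tangent_pair_iff:
  assumes "C \<in> N" "u \<in> fst C"
  shows "(\<forall>\<xi>\<in>tangent_space N u. \<forall>\<zeta>\<in>tangent_space N u. F (\<xi> C) (\<zeta> C)) \<longleftrightarrow> (\<forall>X Y. F X Y)"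
proof (intro iffI allI ballI)
  fix X Y assume "\<forall>\<xi>\<in>tangent_space N u. \<forall>\<zeta>\<in>tangent_space N u. F (\<xi> C) (\<zeta> C)"
  then have "F (coord_field N C X u C) (coord_field N C Y u C)"
    using slit.coord_field_tangent[OF assms] by blast
  then show "F X Y" by (simp only: slit.coord_field_self[OF assms])
qed blast

lemma d_tangent_structure_point:
  assumes C: "C \<in> N" "u \<in> fst C"
  shows "(\<forall>\<xi>\<in>tangent_space N u. \<forall>\<zeta>\<in>tangent_space N u. d_tensor N tangent_structure \<theta> u [\<xi>, \<zeta>] = 0)
    \<longleftrightarrow> vertical_symmetric C (snd C u)"
proof -
  interpret L: spray_coordinates "snd C ` fst C" "S_in C" "\<theta>_in C" "real_of_int k"
    by (rule spray_coordinates_chart[OF C(1)])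
  have "(\<forall>\<xi>\<in>tangent_space N u. \<forall>\<zeta>\<in>tangent_space N u. d_tensor N tangent_structure \<theta> u [\<xi>, \<zeta>] = 0)
    \<longleftrightarrow> (\<forall>\<xi>\<in>tangent_space N u. \<forall>\<zeta>\<in>tangent_space N u.
      (\<lambda>X Y. L.Dcov (snd C u) (0, fst X) (fst Y) = L.Dcov (snd C u) (0, fst Y) (fst X)) (\<xi> C) (\<zeta> C))"
    by (simp add: d_tangent_structure_in_chart[OF C])
  also have "\<dots> \<longleftrightarrow> vertical_symmetric C (snd C u)"
    unfolding tangent_pair_iff[OF C, where F = "\<lambda>X Y. L.Dcov (snd C u) (0, fst X) (fst Y) = L.Dcov (snd C u) (0, fst Y) (fst X)"]
    by (simp only: L.vertical_symmetric_def split_paired_All fst_conv simp_thms)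
  finally show ?thesis .
qed

lemma d_hproj_point:
  assumes C: "C \<in> N" "u \<in> fst C"
  shows "(\<forall>\<xi>\<in>tangent_space N u. \<forall>\<zeta>\<in>tangent_space N u. d_tensor N (hproj A S) \<theta> u [\<xi>, \<zeta>] = 0)
    \<longleftrightarrow> horizontal_symmetric C (snd C u)"
proof -
  interpret L: spray_coordinates "snd C ` fst C" "S_in C" "\<theta>_in C" "real_of_int k"
    by (rule spray_coordinates_chart[OF C(1)])
  have "(\<forall>\<xi>\<in>tangent_space N u. \<forall>\<zeta>\<in>tangent_space N u. d_tensor N (hproj A S) \<theta> u [\<xi>, \<zeta>] = 0)
    \<longleftrightarrow> (\<forall>\<xi>\<in>tangent_space N u. \<forall>\<zeta>\<in>tangent_space N u.
      (\<lambda>X Y. L.Dcov (snd C u) (fst X, L.conn (snd C u) (fst X)) (fst Y)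
        = L.Dcov (snd C u) (fst Y, L.conn (snd C u) (fst Y)) (fst X)) (\<xi> C) (\<zeta> C))"
    by (simp add: d_hproj_in_chart[OF C])
  also have "\<dots> \<longleftrightarrow> horizontal_symmetric C (snd C u)"
    unfolding tangent_pair_iff[OF C, where F = "\<lambda>X Y. L.Dcov (snd C u) (fst X, L.conn (snd C u) (fst X)) (fst Y)
        = L.Dcov (snd C u) (fst Y, L.conn (snd C u) (fst Y)) (fst X)"]
    by (simp only: L.horizontal_symmetric_def split_paired_All fst_conv simp_thms)
  finally show ?thesis .
qed

lemma d_tangent_structure_iff:
  "eq_form N 2 (d_tensor N tangent_structure \<theta>) zero_form \<longleftrightarrow> (\<forall>C\<in>N. \<forall>z\<in>snd C ` fst C. vertical_symmetric C z)"
  "eq_form N 2 (d_tensor N tangent_structure \<theta>) zero_form \<longleftrightarrow>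
    (\<forall>u\<in>points N. vertical_symmetric (chart_at N u) (snd (chart_at N u) u))"
  unfolding eq_form_2_zero_iff
  by (rule point_chart_iff[where Q = vertical_symmetric], rule d_tangent_structure_point; assumption)+

lemma d_hproj_iff:
  "eq_form N 2 (d_tensor N (hproj A S) \<theta>) zero_form \<longleftrightarrow> (\<forall>C\<in>N. \<forall>z\<in>snd C ` fst C. horizontal_symmetric C z)"
  "eq_form N 2 (d_tensor N (hproj A S) \<theta>) zero_form \<longleftrightarrow>
    (\<forall>u\<in>points N. horizontal_symmetric (chart_at N u) (snd (chart_at N u) u))"
  unfolding eq_form_2_zero_iff
  by (rule point_chart_iff[where Q = horizontal_symmetric], rule d_hproj_point; assumption)+

lemma closed_iff:
  "closed_form N 1 (lie_form N S \<theta>) \<longleftrightarrow>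
    (\<forall>u\<in>points N. lie_closed (chart_at N u) (snd (chart_at N u) u))"
proof -
  have "(\<forall>\<xi>\<in>tangent_space N u. \<forall>\<zeta>\<in>tangent_space N u. ext_d N (lie_form N S \<theta>) u [\<xi>, \<zeta>] = 0)
    \<longleftrightarrow> lie_closed (chart_at N u) (snd (chart_at N u) u)" if u: "u \<in> points N" for u
  proof -
    define C where "C = chart_at N u"
    note C = slit.chart_at[OF u, folded C_def]
    interpret L: spray_coordinates "snd C ` fst C" "S_in C" "\<theta>_in C" "real_of_int k"
      by (rule spray_coordinates_chart[OF C(1)])
    have "ext_d N (lie_form N S \<theta>) u [\<xi>, \<zeta>]
        = fd (\<lambda>z. L.lie z (\<zeta> C)) (snd C u) (\<xi> C) - fd (\<lambda>z. L.lie z (\<xi> C)) (snd C u) (\<zeta> C)" for \<xi> \<zeta>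
    proof (rule slit.ext_d_at[OF u C_def])
      fix z e assume "z \<in> snd C ` fst C"
      then obtain w where w: "w \<in> fst C" "z = snd C w" by blast
      show "lie_form N S \<theta> (chart_inv C z) [coord_field N C e (chart_inv C z)] = L.lie z e"
        using lie_form_in_chart[OF C(1) w(1) slit.coord_field_tangent[OF C(1) w(1)], of e] C w by simp
    qed
    then have "(\<forall>\<xi>\<in>tangent_space N u. \<forall>\<zeta>\<in>tangent_space N u. ext_d N (lie_form N S \<theta>) u [\<xi>, \<zeta>] = 0)
      \<longleftrightarrow> (\<forall>\<xi>\<in>tangent_space N u. \<forall>\<zeta>\<in>tangent_space N u.
        (\<lambda>X Y. fd (\<lambda>z. L.lie z Y) (snd C u) X = fd (\<lambda>z. L.lie z X) (snd C u) Y) (\<xi> C) (\<zeta> C))" by simp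
    also have "\<dots> \<longleftrightarrow> lie_closed C (snd C u)"
      unfolding L.lie_closed_def
      by (rule tangent_pair_iff[OF C, where F = "\<lambda>X Y. fd (\<lambda>z. L.lie z Y) (snd C u) X = fd (\<lambda>z. L.lie z X) (snd C u) Y"])
    finally show ?thesis unfolding C_def .
  qed
  then show ?thesis
    unfolding closed_form_def One_nat_def numeral_2_eq_2[symmetric] eq_form_2_zero_iff by blast
qed

lemma ext_d_inner_in_chart:
  assumes C: "C \<in> N" "w \<in> fst C" and \<xi>: "\<xi> \<in> tangent_space N w"
  shows "ext_d N (inner_form S \<theta>) w [\<xi>] = fd (\<lambda>z. spray_coordinates.cov (\<theta>_in C) z (snd z)) (snd C w) (\<xi> C)"
proof -
  interpret L: spray_coordinates "snd C ` fst C" "S_in C" "\<theta>_in C" "real_of_int k"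
    by (rule spray_coordinates_chart[OF C(1)])
  have "fd (\<lambda>z. inner_form S \<theta> (chart_inv C z) []) (snd C w) = fd (\<lambda>z. L.cov z (snd z)) (snd C w)"
  proof (rule fd_cong[OF slit.open_image[OF C(1)]])
    fix z assume z: "z \<in> snd C ` fst C"
    then obtain q where q: "q \<in> fst C" "z = snd C q" by blast
    have "inner_form S \<theta> (chart_inv C z) [] = \<theta>_in C z (S_in C z)"
      using slit.comps_eval[OF S_tangent[OF C(1) q(1)] C(1) q(1), of \<theta>] C q by (simp add: inner_form_def)
    then show "inner_form S \<theta> (chart_inv C z) [] = L.cov z (snd z)"
      by (simp only: L.th_eq_cov[OF z] L.fst_S[OF z])
  qed (use C in blast)
  then show ?thesis
    using slit.ext_d_0form[OF slit.inner_form_0form[OF \<theta>_form S_field] C \<xi>] by simp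
qed

lemma potential_iff:
  "eq_form N 1 (scale_form (of_int k) (lie_form N S \<theta>)) (ext_d N (inner_form S \<theta>)) \<longleftrightarrow>
    (\<forall>u\<in>points N. lie_potential (chart_at N u) (snd (chart_at N u) u))"
proof -
  have "(\<forall>\<xi>\<in>tangent_space N u. scale_form (of_int k) (lie_form N S \<theta>) u [\<xi>] = ext_d N (inner_form S \<theta>) u [\<xi>])
    \<longleftrightarrow> lie_potential (chart_at N u) (snd (chart_at N u) u)" if u: "u \<in> points N" for u
  proof -
    define C where "C = chart_at N u"
    note C = slit.chart_at[OF u, folded C_def]
    interpret L: spray_coordinates "snd C ` fst C" "S_in C" "\<theta>_in C" "real_of_int k"
      by (rule spray_coordinates_chart[OF C(1)])
    have "(\<forall>\<xi>\<in>tangent_space N u. scale_form (of_int k) (lie_form N S \<theta>) u [\<xi>] = ext_d N (inner_form S \<theta>) u [\<xi>])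
      \<longleftrightarrow> (\<forall>\<xi>\<in>tangent_space N u. k * L.lie (snd C u) (\<xi> C) = fd (\<lambda>z. L.cov z (snd z)) (snd C u) (\<xi> C))"
      by (simp add: scale_form_def lie_form_in_chart[OF C] ext_d_inner_in_chart[OF C])
    also have "\<dots> \<longleftrightarrow> lie_potential C (snd C u)"
      unfolding L.lie_potential_def
      using tangent_pair_iff[OF C, where F = "\<lambda>X Y. k * L.lie (snd C u) X = fd (\<lambda>z. L.cov z (snd z)) (snd C u) X"]
        slit.coord_field_tangent[OF C] by blast
    finally show ?thesis unfolding C_def .
  qed
  moreover have "eq_form N 1 \<omega> \<eta> \<longleftrightarrow> (\<forall>u\<in>points N. \<forall>\<xi>\<in>tangent_space N u. \<omega> u [\<xi>] = \<eta> u [\<xi>])" for \<omega> \<eta>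
    unfolding eq_form_def by (auto simp: length_Suc_conv)
  ultimately show ?thesis by blast
qed

text \<open>
  Both brackets are taken of fields whose components near \<open>u\<close> are \<open>(a, n a)\<close> and \<open>(0, b - n a)\<close>
  with constant \<open>a, b\<close>, so only the derivatives of \<open>n\<close> and of \<open>S\<close> appear.
\<close>

lemma nabla_vfield_in_chart:
  assumes u: "u \<in> points N" and C_def: "C = chart_at N u"
  shows "nabla_vfield A S (local_ext N u \<xi>) u C = nabla_coord C (snd C u) (\<xi> C)"
proof -
  note C = slit.chart_at[OF u, folded C_def]
  interpret L: spray_coordinates "snd C ` fst C" "S_in C" "\<theta>_in C" "real_of_int k"
    by (rule spray_coordinates_chart[OF C(1)])
  let ?X = "local_ext N u \<xi>" and ?z = "snd C u"
  define a b where "a = fst (\<xi> C)" and "b = snd (\<xi> C)"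
  have z: "?z \<in> snd C ` fst C" using C by blast
  have ext: "local_ext N u \<zeta> u C = \<zeta> C" for \<zeta> using C by (simp add: local_ext_def flip: C_def)
  have X: "?X q \<in> tangent_space N q" "?X q C = (a, b)" if "q \<in> fst C" for q
    using C that by (simp_all add: local_ext_def a_def b_def flip: C_def)
  have hX: "tensor_app (hproj A S) ?X q C = (a, conn C (snd C q) a)"
    and vX: "tensor_app (vproj A S) ?X q C = (0, b - conn C (snd C q) a)" if "q \<in> fst C" for q
    using hproj_in_chart[OF C(1) that X(1)[OF that]] vproj_in_chart[OF C(1) that X(1)[OF that]] X(2)[OF that]
    by (simp_all add: tensor_app_def)
  have 1: "fd (\<lambda>z. tensor_app (hproj A S) ?X (chart_inv C z) C) ?z V = (0, fd (\<lambda>z. conn C z a) ?z V)" for V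
  proof -
    have "fd (\<lambda>z. tensor_app (hproj A S) ?X (chart_inv C z) C) ?z = fd (\<lambda>z. (a, conn C z a)) ?z"
      by (rule fd_cong[OF slit.open_image[OF C(1)] z]) (use hX C in auto)
    also have "\<dots> = (\<lambda>V. (0, fd (\<lambda>z. conn C z a) ?z V))"
      by (intro fd_eqI has_derivative_Pair has_derivative_const fd_has_derivative L.conn_differentiable z)
    finally show ?thesis by simp
  qed
  have 2: "fd (\<lambda>z. tensor_app (vproj A S) ?X (chart_inv C z) C) ?z V = (0, - fd (\<lambda>z. conn C z a) ?z V)" for V
  proof -
    have "fd (\<lambda>z. tensor_app (vproj A S) ?X (chart_inv C z) C) ?z = fd (\<lambda>z. (0, b - conn C z a)) ?z"
      by (rule fd_cong[OF slit.open_image[OF C(1)] z]) (use vX C in auto)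
    also have "\<dots> = (\<lambda>V. (0, 0 - fd (\<lambda>z. conn C z a) ?z V))"
      by (intro fd_eqI has_derivative_Pair has_derivative_diff has_derivative_const fd_has_derivative
          L.conn_differentiable z)
    finally show ?thesis by simp
  qed
  note conn = linear_diff[OF L.conn_linear[OF z]] linear_neg[OF L.conn_linear[OF z]]
  have b1: "bracket N S (tensor_app (hproj A S) ?X) u C
      = (0, L.S_conn ?z a) - fd (S_in C) ?z (a, conn C ?z a)"
    unfolding slit.bracket_apply[OF C] hX[OF C(2)] 1 L.S_conn_def using C by simp
  have b2: "bracket N S (tensor_app (vproj A S) ?X) u C
      = (0, - L.S_conn ?z a) - (b - conn C ?z a, 2 *\<^sub>R conn C ?z (b - conn C ?z a))"
    unfolding slit.bracket_apply[OF C] vX[OF C(2)] 2 L.S_conn_def L.fd_S_vertical[OF z] using C by simp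
  have h: "hproj A S u (bracket N S (tensor_app (hproj A S) ?X) u) C = (- conn C ?z a, - conn C ?z (conn C ?z a))"
    unfolding projectors_in_chart(1)[OF C ext] b1 by (simp add: L.fst_fd_S[OF z] conn)
  have v: "vproj A S u (bracket N S (tensor_app (vproj A S) ?X) u) C
      = (0, - L.S_conn ?z a - conn C ?z (b - conn C ?z a))"
    unfolding projectors_in_chart(2)[OF C ext] b2 by (simp add: conn scaleR_2 algebra_simps)
  show ?thesis
    unfolding nabla_vfield_def tlin_def h v L.nabla_coord_def by (simp add: conn flip: a_def b_def)
qed

lemma nabla_in_chart:
  assumes u: "u \<in> points N" and C_def: "C = chart_at N u"
  shows "nabla_form A S (ext_d N \<theta>) u [\<xi>, \<zeta>] = nabla_d_coord C (snd C u) (\<xi> C) (\<zeta> C)"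
proof -
  note C = slit.chart_at[OF u, folded C_def]
  interpret L: spray_coordinates "snd C ` fst C" "S_in C" "\<theta>_in C" "real_of_int k"
    by (rule spray_coordinates_chart[OF C(1)])
  let ?z = "snd C u"
  have z: "?z \<in> snd C ` fst C" using C by blast
  have "fd (\<lambda>z. ext_d N \<theta> (chart_inv C z) [local_ext N u \<xi> (chart_inv C z), local_ext N u \<zeta> (chart_inv C z)]) ?z
      = fd (\<lambda>z. L.Dcov z (\<xi> C) (fst (\<zeta> C)) - L.Dcov z (\<zeta> C) (fst (\<xi> C))) ?z"
  proof (rule fd_cong[OF slit.open_image[OF C(1)] z])
    fix z assume "z \<in> snd C ` fst C"
    then obtain q where q: "q \<in> fst C" "z = snd C q" by blast
    show "ext_d N \<theta> (chart_inv C z) [local_ext N u \<xi> (chart_inv C z), local_ext N u \<zeta> (chart_inv C z)]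
        = L.Dcov z (\<xi> C) (fst (\<zeta> C)) - L.Dcov z (\<zeta> C) (fst (\<xi> C))"
      using C q by (simp add: local_ext_def ext_d_in_chart[OF C(1) q(1)] L.d_coord_def flip: C_def)
  qed
  then have "deriv_along N u (S u) (\<lambda>w. ext_d N \<theta> w [local_ext N u \<xi> w, local_ext N u \<zeta> w])
      = L.D2cov ?z (S u C) (\<xi> C) (fst (\<zeta> C)) - L.D2cov ?z (S u C) (\<zeta> C) (fst (\<xi> C))"
    unfolding deriv_along_def o_def C_def[symmetric] L.D2cov_def
    by (simp add: fd_diff[OF L.Dcov_differentiable[OF z] L.Dcov_differentiable[OF z]])
  then show ?thesis
    using C by (simp add: nabla_form_def ext_d_in_chart_at[OF u C_def] nabla_vfield_in_chart[OF u C_def] L.nabla_d_coord_def)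
qed

lemma nabla_iff:
  "eq_form N 2 (nabla_form A S (ext_d N \<theta>)) zero_form \<longleftrightarrow>
    (\<forall>u\<in>points N. \<forall>X Y. nabla_d_coord (chart_at N u) (snd (chart_at N u) u) X Y = 0)"
proof -
  have "(\<forall>\<xi>\<in>tangent_space N u. \<forall>\<zeta>\<in>tangent_space N u. nabla_form A S (ext_d N \<theta>) u [\<xi>, \<zeta>] = 0)
    \<longleftrightarrow> (\<forall>X Y. nabla_d_coord (chart_at N u) (snd (chart_at N u) u) X Y = 0)" if u: "u \<in> points N" for u
    unfolding nabla_in_chart[OF u refl]
    by (rule tangent_pair_iff[OF slit.chart_at[OF u],
          where F = "\<lambda>X Y. nabla_d_coord (chart_at N u) (snd (chart_at N u) u) X Y = 0"])
  then show ?thesis unfolding eq_form_2_zero_iff by (rule ball_cong[OF refl])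
qed

lemma potential_imp_exact:
  assumes "k \<noteq> 0"
    and pot: "eq_form N 1 (scale_form (of_int k) (lie_form N S \<theta>)) (ext_d N (inner_form S \<theta>))"
  shows "exact_form N 1 (lie_form N S \<theta>)"
  unfolding exact_form_def
proof (intro exI conjI)
  let ?\<eta> = "scale_form (1 / of_int k) (inner_form S \<theta>)"
  have i: "form N 0 (inner_form S \<theta>)" by (rule slit.inner_form_0form[OF \<theta>_form S_field])
  have sm: "smooth_on (snd C ` fst C) (\<lambda>z. inner_form S \<theta> (chart_inv C z) [])" if "C \<in> N" for C
    using i that unfolding form_def by (auto dest!: bspec spec[of _ "[]"])
  show \<eta>: "form N 0 ?\<eta>"
  proof (rule slit.form_0I)
    fix C assume C: "C \<in> N"
    show "smooth_on (snd C ` fst C) (\<lambda>z. ?\<eta> (chart_inv C z) [])"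
      unfolding scale_form_def
      by (rule smooth_on_bounded_linear[OF slit.open_image[OF C] bounded_linear_mult_right sm[OF C]])
  qed
  show "eq_form N 1 (lie_form N S \<theta>) (ext_d N ?\<eta>)"
  proof (rule eq_form_1I)
    fix u C \<xi> assume a: "C \<in> N" "u \<in> fst C" "\<xi> \<in> tangent_space N u"
    have d: "(\<lambda>z. inner_form S \<theta> (chart_inv C z) []) differentiable (at (snd C u))"
      using smooth_on_differentiable[OF sm[OF a(1)]] a(2) by blast
    have "ext_d N ?\<eta> u [\<xi>] = 1 / of_int k * ext_d N (inner_form S \<theta>) u [\<xi>]"
      unfolding slit.ext_d_0form[OF \<eta> a] slit.ext_d_0form[OF i a]
      unfolding scale_form_def by (rule fd_cmult[OF d])
    also have "\<dots> = lie_form N S \<theta> u [\<xi>]"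
      unfolding eq_form_1D[OF pot slit.pointsI[OF a(1,2)] a(3), symmetric] scale_form_def
      using \<open>k \<noteq> 0\<close> by simp
    finally show "lie_form N S \<theta> u [\<xi>] = ext_d N ?\<eta> u [\<xi>]" by simp
  qed
qed simp

lemma in_chart_at:
  assumes "u \<in> points N"
  shows "spray_coordinates (snd (chart_at N u) ` fst (chart_at N u)) (S_in (chart_at N u)) (\<theta>_in (chart_at N u)) (real_of_int k)"
    and "snd (chart_at N u) u \<in> snd (chart_at N u) ` fst (chart_at N u)"
  using spray_coordinates_chart slit.chart_at[OF assms] by blast+

section \<open>The equivalences\<close>

text \<open>
  Symmetry of \<open>g\<close> has to be established at all points first, because the decomposition of
  the mixed condition differentiates it; likewise \<open>d\<^sub>h\<theta> = 0\<close> has to hold everywhere before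
  \<open>\<nabla>d\<theta> = 0\<close> can be derived.
\<close>

lemma closed_imp_Helmholtz:
  assumes "closed_form N 1 (lie_form N S \<theta>)"
  shows "eq_form N 1 (scale_form (of_int k) (lie_form N S \<theta>)) (ext_d N (inner_form S \<theta>))"
    and "eq_form N 2 (d_tensor N (hproj A S) \<theta>) zero_form"
    and "eq_form N 2 (d_tensor N tangent_structure \<theta>) zero_form"
    and "eq_form N 2 (nabla_form A S (ext_d N \<theta>)) zero_form"
proof -
  note cl = assms[unfolded closed_iff, rule_format]
  show J: "eq_form N 2 (d_tensor N tangent_structure \<theta>) zero_form"
    unfolding d_tangent_structure_iff(2)
    using spray_coordinates.lie_closed_imp(1)[OF in_chart_at cl] by blast
  have sym: "vertical_symmetric C z" if "C \<in> N" "z \<in> snd C ` fst C" for C z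
    using J that unfolding d_tangent_structure_iff(1) by blast
  have mixed_condition: "spray_coordinates.mixed_condition (S_in (chart_at N u)) (\<theta>_in (chart_at N u)) (snd (chart_at N u) u)"
    if "u \<in> points N" for u
    by (rule spray_coordinates.lie_closed_imp(2)[OF in_chart_at cl]) (rule that)+
  show "eq_form N 1 (scale_form (of_int k) (lie_form N S \<theta>)) (ext_d N (inner_form S \<theta>))"
    unfolding potential_iff
    using spray_coordinates.mixed_imp_lie_potential[OF in_chart_at sym[OF slit.chart_at(1) in_chart_at(2)] mixed_condition] by blast
  have hp: "horizontal_symmetric (chart_at N u) (snd (chart_at N u) u)
      \<and> spray_coordinates.vertical_parallel (S_in (chart_at N u)) (\<theta>_in (chart_at N u)) (snd (chart_at N u) u)"
    if u: "u \<in> points N" for u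
    using spray_coordinates.mixed_iff[OF in_chart_at[OF u] sym[OF slit.chart_at(1)[OF u]]] mixed_condition[OF u] by blast
  then show H: "eq_form N 2 (d_tensor N (hproj A S) \<theta>) zero_form"
    unfolding d_hproj_iff(2) by blast
  have hor: "horizontal_symmetric C z" if "C \<in> N" "z \<in> snd C ` fst C" for C z
    using H that unfolding d_hproj_iff(1) by blast
  show "eq_form N 2 (nabla_form A S (ext_d N \<theta>)) zero_form"
    unfolding nabla_iff
  proof (intro ballI allI)
    fix u X Y assume u: "u \<in> points N"
    show "nabla_d_coord (chart_at N u) (snd (chart_at N u) u) X Y = 0"
      by (rule spray_coordinates.parallel_imp_nabla_d[OF in_chart_at[OF u]
            sym[OF slit.chart_at(1)[OF u] in_chart_at(2)[OF u]] hor[OF slit.chart_at(1)[OF u]]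
            conjunct2[OF hp[OF u]]])
  qed
qed

lemma Helmholtz_imp_potential:
  assumes H: "eq_form N 2 (d_tensor N (hproj A S) \<theta>) zero_form"
    and J: "eq_form N 2 (d_tensor N tangent_structure \<theta>) zero_form"
    and V: "k = 1 \<or> eq_form N 2 (nabla_form A S (ext_d N \<theta>)) zero_form"
  shows "eq_form N 1 (scale_form (of_int k) (lie_form N S \<theta>)) (ext_d N (inner_form S \<theta>))"
  unfolding potential_iff
proof
  fix u assume u: "u \<in> points N"
  define C where "C = chart_at N u"
  note C = slit.chart_at[OF u, folded C_def]
  interpret L: spray_coordinates "snd C ` fst C" "S_in C" "\<theta>_in C" "real_of_int k"
    by (rule spray_coordinates_chart[OF C(1)])
  have z: "snd C u \<in> snd C ` fst C" using C by blast
  have sym: "vertical_symmetric C z" if "z \<in> snd C ` fst C" for z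
    using J that C(1) unfolding d_tangent_structure_iff(1) by blast
  have hor: "horizontal_symmetric C (snd C u)" using H C(1) z unfolding d_hproj_iff(1) by blast
  show "lie_potential (chart_at N u) (snd (chart_at N u) u)"
    unfolding C_def[symmetric]
  proof (cases "k = 1")
    case True
    then show "lie_potential C (snd C u)"
      using L.horizontal_imp_lie_potential[OF z sym[OF z] hor] by simp
  next
    case False
    then have "L.vertical_parallel (snd C u)"
      using V u L.nabla_d_imp_parallel[OF z] unfolding nabla_iff C_def by blast
    then have "L.mixed_condition (snd C u)" using L.mixed_iff[OF z sym] hor by blast
    then show "lie_potential C (snd C u)" by (rule L.mixed_imp_lie_potential[OF z sym[OF z]])
  qed
qed

end

theorem theorem4p3:
  fixes T :: "'a topology"
    and A :: "('a, real ^ 'n::finite) chart set"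
    and S :: "(('a, real ^ 'n) tm, (real ^ 'n) \<times> (real ^ 'n)) vfield"
    and \<theta> :: "(('a, real ^ 'n) tm, (real ^ 'n) \<times> (real ^ 'n)) dform"
    and k :: int
  assumes "smooth_manifold T A"
    and "spray A S"
    and "k \<noteq> 0"
    and "form (slit_atlas A) 1 \<theta>"
    and "semi_basic A \<theta>"
    and "homogeneous_form A 1 (k - 1) \<theta>"
  defines "N \<equiv> slit_atlas A"
  shows "(closed_form N 1 (lie_form N S \<theta>) \<longleftrightarrow> exact_form N 1 (lie_form N S \<theta>)) \<and>
    (closed_form N 1 (lie_form N S \<theta>) \<longleftrightarrow>
       eq_form N 1 (scale_form (of_int k) (lie_form N S \<theta>)) (ext_d N (inner_form S \<theta>))) \<and>
    (k = 1 \<longrightarrow>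
       (closed_form N 1 (lie_form N S \<theta>) \<longleftrightarrow>
          eq_form N 2 (d_tensor N (hproj A S) \<theta>) zero_form \<and>
          eq_form N 2 (d_tensor N tangent_structure \<theta>) zero_form)) \<and>
    (k \<notin> {-1, 0, 1} \<longrightarrow>
       (closed_form N 1 (lie_form N S \<theta>) \<longleftrightarrow>
          eq_form N 2 (d_tensor N (hproj A S) \<theta>) zero_form \<and>
          eq_form N 2 (d_tensor N tangent_structure \<theta>) zero_form \<and>
          eq_form N 2 (nabla_form A S (ext_d N \<theta>)) zero_form))"
proof -
  interpret base: smooth_atlas A by (rule smooth_manifold_atlas[OF assms(1)])
  interpret spray_form A S \<theta> k by unfold_locales (fact assms)+
  have exact: "exact_form N 1 (lie_form N S \<theta>)"
    if "eq_form N 1 (scale_form (of_int k) (lie_form N S \<theta>)) (ext_d N (inner_form S \<theta>))"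
    using potential_imp_exact[OF assms(3)] that unfolding N_def .
  have closed: "closed_form N 1 (lie_form N S \<theta>)" if "exact_form N 1 (lie_form N S \<theta>)"
    using slit.exact_closed that unfolding N_def .
  show ?thesis
    using exact closed closed_imp_Helmholtz[folded N_def] Helmholtz_imp_potential[folded N_def] by blast
qed

end
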